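(* Let $W\in gr^{(2)}$ (equivalently $W=g(t)H_n^{(0)}$ with $g\in GL_n(L)^{(2)}$) and let $\sigma(|W\rangle)=\sum_{\alpha\in M}\tau_\alpha(x)e^\alpha$ be its tau-function. For $i\neq j$ define \[ \gamma_{ij}(x)=\varepsilon_{ji}\left(\frac{\tau_{\delta_i-\delta_j}(x)}{\tau_0(x)}\right)\Big|_{x^{(\ell)}_{2k}=0\ \text{for all }k\ge1,\,1\le\ell\le n}. \] Then, with $u_i=x^{(i)}_1$ and $\partial_i=\partial/\partial u_i$ (the variables $x^{(\ell)}_{2k+1}$, $k\ge1$, being parameters), the $\gamma_{ij}$ satisfy the Darboux–Egoroff system: for pairwise distinct $i,j,k$, \[ \gamma_{ij}=\gamma_{ji},\qquad \partial_k\gamma_{ij}=\gamma_{ik}\gamma_{kj},\qquad \sum_{k=1}^n\partial_k\gamma_{ij}=0. \]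
   Context: Standing setup. Fix $n\ge2$, let $e_1,\dots,e_n$ be the standard basis of $\mathbb{C}^n$ and $H_n=\mathbb{C}^n((t))$ (formal Laurent series with finitely many negative powers). For $1\le j\le n$, $k\in\mathbb{Z}$ put $v_{-n(k+1)+j-\frac12}=v^{(j)}_{-k-\frac12}:=e_jt^k$. Let $H_n^{(j)}$ be the space of sums $\sum_{m<j}b_mv_m$ (so $H_n^{(0)}=\mathbb{C}^n[[t]]$); $Gr_0$ is the set of subspaces $W\subset H_n$ with $H_n^{(j)}\subset W$ and $\dim W/H_n^{(j)}=-j$ for all $j\ll0$; $gr_0=\{W\in Gr_0:tW\subset W\}$; $\langle u,v\rangle=i\,\mathrm{Res}_t\sum_a u_a(t)v_a(-t)$; $gr^{(2)}=\{W\in gr_0:\langle W,W\rangle=0\}$; $L=\mathbb{C}[t,t^{-1}]$ and $GL_n(L)^{(2)}=\{A(t)\in GL_n(L):A(-t)=(A(t)^T)^{-1}\}$. Fock space: $F^{(0)}$ is the span of semi-infinite wedges $u_{-\frac12}\wedge u_{-\frac32}\wedge\cdots$ ($u_m\in H_n$, $u_m=v_m$ for $m\ll0$), multilinear and alternating, with vacuum $|0\rangle=v_{-\frac12}\wedge v_{-\frac32}\wedge\cdots$; $F=\oplus_cF^{(c)}$ is defined similarly with tails $v_{c-\frac12-k}$. For $W\in Gr_0$ choose $N$ with $H_n^{(-N)}\subset W$, $\dim W/H_n^{(-N)}=N$, and a basis $w_{-\frac12},\dots,w_{-N+\frac12}$ of $W$ mod $H_n^{(-N)}$; set $|W\rangle=w_{-\frac12}\wedge\cdots\wedge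 w_{-N+\frac12}\wedge v_{-N-\frac12}\wedge v_{-N-\frac32}\wedge\cdots$ (defined up to a nonzero scalar). For $w\in H_n$, $\psi(w)$ is left wedging with $w$; for a continuous linear functional $f$, $\psi(f)(u_1\wedge u_2\wedge\cdots)=\sum_{k\ge1}(-1)^{k-1}f(u_k)\,u_1\wedge\cdots\wedge\widehat{u_k}\wedge\cdots$. Let $v^{(j)*}_r$ be the functional with $v^{(j)*}_r(v^{(i)}_s)=\delta_{ij}\delta_{r,-s}$. Put $\psi^{+(j)}_k=\psi(v^{(j)}_{-k})$, $\psi^{-(j)}_k=\psi(v^{(j)*}_{-k})$ ($k\in\frac12+\mathbb{Z}$), and $\alpha^{(j)}_k=\sum_{\ell}\psi^{+(j)}_\ell\psi^{-(j)}_{k-\ell}$ for $k\ne0$, $\alpha^{(j)}_0=\sum_{\ell>0}\psi^{+(j)}_{-\ell}\psi^{-(j)}_{\ell}-\sum_{\ell>0}\psi^{-(j)}_{-\ell}\psi^{+(j)}_{\ell}$. Let $Q_i$ ($1\le i\le n$) be the operators on $F$ determined by $Q_i|0\rangle=\psi^{+(i)}_{-\frac12}|0\rangle$ and $Q_i\psi^{\pm(j)}_k=(-1)^{\delta_{ij}+1}\psi^{\pm(j)}_{k\mp\delta_{ij}}Q_i$. Let $N=\oplus_i\mathbb{Z}\delta_i$ with $(\delta_i|\delta_j)=\delta_{ij}$, $M=\{\gamma\in N:(\delta_1+\dots+\delta_n|\gamma)=0\}$, $\varepsilon_{ij}=-1$ if $i>j$ and $1$ if $i\le j$, $\varepsilon$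 the bimultiplicative function with $\varepsilon(\delta_i,\delta_j)=\varepsilon_{ij}$, and $\mathbb{C}[M]$ the twisted group algebra with basis $e^\gamma$, $e^\alpha e^\beta=\varepsilon(\alpha,\beta)e^{\alpha+\beta}$. Let $x=\{x^{(i)}_k\}_{k\ge1,1\le i\le n}$. The boson–fermion correspondence is the linear isomorphism $\sigma:F^{(0)}\to\mathbb{C}[x]\otimes\mathbb{C}[M]$, $\sigma(\alpha^{(i_1)}_{-m_1}\cdots\alpha^{(i_s)}_{-m_s}Q_1^{k_1}\cdots Q_n^{k_n}|0\rangle)=m_1\cdots m_s\,x^{(i_1)}_{m_1}\cdots x^{(i_s)}_{m_s}\otimes e^{k_1\delta_1+\dots+k_n\delta_n}$ ($m_r>0$, $\sum k_i=0$). The tau-function of $W\in Gr_0$ is $\sigma(|W\rangle)=\sum_{\alpha\in M}\tau_\alpha(x)e^\alpha$, $\tau_\alpha\in\mathbb{C}[x]$. All ratios are taken where $\tau_0\neq0$. *)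

theory Defs
  imports "HOL-Analysis.Analysis" "HOL-Combinatorics.Permutations"
begin

text \<open>Basis vectors v_m of H_n are indexed by half-integers m; we index them by the
  integer label p = m + 1/2.  The vector e_j t^k = v_{-n(k+1)+j-1/2} has label
  lab n j k = -n(k+1)+j.  An element of H_n is its coefficient function
  h :: int => complex (h p = coefficient of the basis vector with label p);
  finitely many negative powers of t means h p = 0 for all large p.\<close>

definition lab :: "nat \<Rightarrow> nat \<Rightarrow> int \<Rightarrow> int" where
  "lab n j k = - int n * (k + 1) + int j"

definition Hn :: "(int \<Rightarrow> complex) set" where
  "Hn = {h. \<exists>N. \<forall>p>N. h p = 0}"

text \<open>H_n^{(j)}: sums of b_m v_m over m < j, i.e. labels p \<le> j.\<close>
definition Hsub :: "int \<Rightarrow> (int \<Rightarrow> complex) set" where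
  "Hsub j = {h. \<forall>p>j. h p = 0}"

text \<open>Multiplication by t: e_a t^k \<mapsto> e_a t^(k+1), i.e. label p \<mapsto> p - n.\<close>
definition tmul :: "nat \<Rightarrow> (int \<Rightarrow> complex) \<Rightarrow> (int \<Rightarrow> complex)" where
  "tmul n h = (\<lambda>p. h (p + int n))"

text \<open>\<langle>u,v\<rangle> = i Res_t \<Sum>_a u_a(t) v_a(-t) = i \<Sum>_a \<Sum>_k u_{a,k} v_{a,-1-k} (-1)^(-1-k)
  (a finite sum for u, v in H_n).\<close>
definition pairing :: "nat \<Rightarrow> (int \<Rightarrow> complex) \<Rightarrow> (int \<Rightarrow> complex) \<Rightarrow> complex" where
  "pairing n u v = \<i> * (\<Sum>a\<in>{1..n}.
      \<Sum>k\<in>{k. u (lab n a k) \<noteq> 0 \<and> v (lab n a (-1-k)) \<noteq> 0}.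
        u (lab n a k) * v (lab n a (-1-k)) * (-1) powi (-1-k))"

definition subspace_H :: "(int \<Rightarrow> complex) set \<Rightarrow> bool" where
  "subspace_H W \<longleftrightarrow> W \<subseteq> Hn \<and> (\<lambda>_. 0) \<in> W \<and>
     (\<forall>u\<in>W. \<forall>v\<in>W. (\<lambda>p. u p + v p) \<in> W) \<and> (\<forall>c. \<forall>u\<in>W. (\<lambda>p. c * u p) \<in> W)"

definition qbasis :: "(int \<Rightarrow> complex) set \<Rightarrow> int \<Rightarrow> nat \<Rightarrow> (nat \<Rightarrow> int \<Rightarrow> complex) \<Rightarrow> bool" where
  "qbasis W j d w \<longleftrightarrow> (\<forall>a<d. w a \<in> W) \<and>
     (\<forall>u\<in>W. \<exists>c. (\<lambda>p. u p - (\<Sum>a<d. c a * w a p)) \<in> Hsub j) \<and>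
     (\<forall>c. (\<lambda>p. \<Sum>a<d. c a * w a p) \<in> Hsub j \<longrightarrow> (\<forall>a<d. c a = 0))"

definition Gr0 :: "(int \<Rightarrow> complex) set set" where
  "Gr0 = {W. subspace_H W \<and>
     (\<exists>J. \<forall>j\<le>J. j \<le> 0 \<and> Hsub j \<subseteq> W \<and> (\<exists>w. qbasis W j (nat (-j)) w))}"

definition gr0 :: "nat \<Rightarrow> (int \<Rightarrow> complex) set set" where
  "gr0 n = {W. W \<in> Gr0 \<and> (\<forall>h\<in>W. tmul n h \<in> W)}"

definition gr2 :: "nat \<Rightarrow> (int \<Rightarrow> complex) set set" where
  "gr2 n = {W. W \<in> gr0 n \<and> (\<forall>u\<in>W. \<forall>v\<in>W. pairing n u v = 0)}"

text \<open>A semi-infinite wedge v_{s_1} \<and> v_{s_2} \<and> ... (labels s_1 > s_2 > ...) is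
  identified with the set S = {s_1, s_2, ...} of labels (a Maya diagram: bounded above and
  containing all sufficiently small integers).  F is the space of finitely supported
  complex functions on Maya diagrams.\<close>

definition maya :: "int set \<Rightarrow> bool" where
  "maya S \<longleftrightarrow> (\<exists>a b. {..a} \<subseteq> S \<and> S \<subseteq> {..b})"

definition charge :: "int set \<Rightarrow> int" where
  "charge S = int (card {s\<in>S. s > 0}) - int (card {s. s \<le> 0 \<and> s \<notin> S})"

definition fockv :: "(int set \<Rightarrow> complex) \<Rightarrow> bool" where
  "fockv f \<longleftrightarrow> finite {S. f S \<noteq> 0} \<and> (\<forall>S. f S \<noteq> 0 \<longrightarrow> maya S)"

definition F0 :: "(int set \<Rightarrow> complex) \<Rightarrow> bool" where
  "F0 f \<longleftrightarrow> fockv f \<and> (\<forall>S. f S \<noteq> 0 \<longrightarrow> charge S = 0)"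

text \<open>vacuum |0> = v_{-1/2} \<and> v_{-3/2} \<and> ... (labels 0, -1, -2, ...)\<close>
definition vac :: "int set \<Rightarrow> complex" where
  "vac = (\<lambda>T. if T = {..0} then 1 else 0)"

text \<open>psi(v_p) (left wedging with the basis vector of label p) and psi(v_p^*)
  (contraction with the dual functional), on coefficient functions.\<close>
definition psi_plus :: "int \<Rightarrow> (int set \<Rightarrow> complex) \<Rightarrow> (int set \<Rightarrow> complex)" where
  "psi_plus p f = (\<lambda>T. if p \<in> T then (-1) ^ card {s\<in>T. s > p} * f (T - {p}) else 0)"

definition psi_minus :: "int \<Rightarrow> (int set \<Rightarrow> complex) \<Rightarrow> (int set \<Rightarrow> complex)" where
  "psi_minus p f = (\<lambda>T. if p \<notin> T then (-1) ^ card {s\<in>T. s > p} * f (insert p T) else 0)"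

text \<open>Half-integer indices k are encoded by the integer \<kappa> with k = \<kappa> + 1/2.
  psip n j \<kappa> = psi^{+(j)}_{\<kappa>+1/2} = psi(v^{(j)}_{-\<kappa>-1/2}) = psi(e_j t^\<kappa>);
  psim n j \<kappa> = psi^{-(j)}_{\<kappa>+1/2} = psi(v^{(j)*}_{-\<kappa>-1/2}), the dual of
  v^{(j)}_{\<kappa>+1/2} = e_j t^{-\<kappa>-1}.\<close>
definition psip :: "nat \<Rightarrow> nat \<Rightarrow> int \<Rightarrow> (int set \<Rightarrow> complex) \<Rightarrow> (int set \<Rightarrow> complex)" where
  "psip n j \<kappa> = psi_plus (lab n j \<kappa>)"

definition psim :: "nat \<Rightarrow> nat \<Rightarrow> int \<Rightarrow> (int set \<Rightarrow> complex) \<Rightarrow> (int set \<Rightarrow> complex)" where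
  "psim n j \<kappa> = psi_minus (lab n j (- \<kappa> - 1))"

text \<open>alpha^{(j)}_k = \<Sum>_l psi^{+(j)}_l psi^{-(j)}_{k-l} for k \<noteq> 0 (l = \<lambda>+1/2, k-l = (k-\<lambda>-1)+1/2);
  on each coefficient only finitely many terms are nonzero.\<close>
definition alpha :: "nat \<Rightarrow> nat \<Rightarrow> int \<Rightarrow> (int set \<Rightarrow> complex) \<Rightarrow> (int set \<Rightarrow> complex)" where
  "alpha n j k f = (\<lambda>T. \<Sum>l\<in>{l. psip n j l (psim n j (k - l - 1) f) T \<noteq> 0}.
                          psip n j l (psim n j (k - l - 1) f) T)"

text \<open>Q_i: the (linear) operator on F determined by Q_i|0> = psi^{+(i)}_{-1/2}|0> and
  Q_i psi^{\<plusminus>(j)}_k = (-1)^{\<delta>_ij+1} psi^{\<plusminus>(j)}_{k\<mp>\<delta>_ij} Q_i (set to 0 off F).\<close>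
definition Qop :: "nat \<Rightarrow> nat \<Rightarrow> (int set \<Rightarrow> complex) \<Rightarrow> (int set \<Rightarrow> complex)" where
  "Qop n i = (THE Q.
     (\<forall>f. fockv f \<longrightarrow> fockv (Q f)) \<and>
     (\<forall>f. \<not> fockv f \<longrightarrow> Q f = (\<lambda>_. 0)) \<and>
     (\<forall>f g. fockv f \<longrightarrow> fockv g \<longrightarrow> Q (\<lambda>T. f T + g T) = (\<lambda>T. Q f T + Q g T)) \<and>
     (\<forall>c f. fockv f \<longrightarrow> Q (\<lambda>T. c * f T) = (\<lambda>T. c * Q f T)) \<and>
     Q vac = psip n i (-1) vac \<and>
     (\<forall>j\<in>{1..n}. \<forall>\<kappa> f. fockv f \<longrightarrow>
        Q (psip n j \<kappa> f) = (\<lambda>T. (if i = j then 1 else -1) *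
              psip n j (\<kappa> - (if i = j then 1 else 0)) (Q f) T)) \<and>
     (\<forall>j\<in>{1..n}. \<forall>\<kappa> f. fockv f \<longrightarrow>
        Q (psim n j \<kappa> f) = (\<lambda>T. (if i = j then 1 else -1) *
              psim n j (\<kappa> + (if i = j then 1 else 0)) (Q f) T)))"

definition Qinv :: "nat \<Rightarrow> nat \<Rightarrow> (int set \<Rightarrow> complex) \<Rightarrow> (int set \<Rightarrow> complex)" where
  "Qinv n i = (THE R.
     (\<forall>f. fockv f \<longrightarrow> fockv (R f) \<and> Qop n i (R f) = f) \<and>
     (\<forall>f. \<not> fockv f \<longrightarrow> R f = (\<lambda>_. 0)))"

definition Qpow :: "nat \<Rightarrow> nat \<Rightarrow> int \<Rightarrow> (int set \<Rightarrow> complex) \<Rightarrow> (int set \<Rightarrow> complex)" where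
  "Qpow n i k = (if 0 \<le> k then Qop n i ^^ nat k else Qinv n i ^^ nat (-k))"

definition qprod :: "nat \<Rightarrow> (nat \<Rightarrow> int) \<Rightarrow> (int set \<Rightarrow> complex)" where
  "qprod n ks = foldr (\<lambda>i g. Qpow n i (ks i) g) [1..<n+1] vac"

definition alpha_chain :: "nat \<Rightarrow> (nat \<times> nat) list \<Rightarrow> (int set \<Rightarrow> complex) \<Rightarrow> (int set \<Rightarrow> complex)" where
  "alpha_chain n ps v = foldr (\<lambda>(i, m) g. alpha n i (- int m) g) ps v"

text \<open>The lattice M: \<gamma> = \<Sum> \<gamma>_l \<delta>_l encoded as l \<mapsto> \<gamma>_l (zero outside 1..n).
  C[x] is represented by polynomial functions of the point x :: nat \<times> nat \<Rightarrow> complex,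
  x (l, k) = x^{(l)}_k; an element of C[x] \<otimes> C[M] is a map M \<rightarrow> C[x] with finite support.\<close>
definition Mlat :: "nat \<Rightarrow> (nat \<Rightarrow> int) set" where
  "Mlat n = {\<gamma>. (\<forall>l. l \<notin> {1..n} \<longrightarrow> \<gamma> l = 0) \<and> (\<Sum>l\<in>{1..n}. \<gamma> l) = 0}"

definition sigma :: "nat \<Rightarrow> (int set \<Rightarrow> complex) \<Rightarrow> (nat \<Rightarrow> int) \<Rightarrow> (nat \<times> nat \<Rightarrow> complex) \<Rightarrow> complex" where
  "sigma n = (THE \<sigma>.
     (\<forall>f g. F0 f \<longrightarrow> F0 g \<longrightarrow> \<sigma> (\<lambda>T. f T + g T) = (\<lambda>\<beta> x. \<sigma> f \<beta> x + \<sigma> g \<beta> x)) \<and>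
     (\<forall>c f. F0 f \<longrightarrow> \<sigma> (\<lambda>T. c * f T) = (\<lambda>\<beta> x. c * \<sigma> f \<beta> x)) \<and>
     (\<forall>f. \<not> F0 f \<longrightarrow> \<sigma> f = (\<lambda>\<beta> x. 0)) \<and>
     (\<forall>ps ks. (\<forall>(i, m)\<in>set ps. i \<in> {1..n} \<and> m \<ge> 1) \<longrightarrow> ks \<in> Mlat n \<longrightarrow>
        \<sigma> (alpha_chain n ps (qprod n ks)) =
          (\<lambda>\<beta> x. if \<beta> = ks then (\<Prod>(i, m)\<leftarrow>ps. of_nat m * x (i, m)) else 0)))"

text \<open>|W> = w_{-1/2} \<and> ... \<and> w_{-N+1/2} \<and> v_{-N-1/2} \<and> v_{-N-3/2} \<and> ..., with w a = w_{-a-1/2};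
  its coefficient at the wedge of labels T is obtained by multilinear alternating expansion
  (tail labels \<le> -N, head labels taken in decreasing order).\<close>
definition wedgeW :: "nat \<Rightarrow> (nat \<Rightarrow> int \<Rightarrow> complex) \<Rightarrow> (int set \<Rightarrow> complex)" where
  "wedgeW N w = (\<lambda>T.
     if {..- int N} \<subseteq> T \<and> finite (T - {..- int N}) \<and> card (T - {..- int N}) = N then
       (let qs = rev (sorted_list_of_set (T - {..- int N})) in
        \<Sum>\<pi>\<in>{\<pi>. \<pi> permutes {..<N}}. of_int (sign \<pi>) * (\<Prod>a<N. w a (qs ! \<pi> a)))
     else 0)"

definition tau :: "nat \<Rightarrow> nat \<Rightarrow> (nat \<Rightarrow> int \<Rightarrow> complex) \<Rightarrow> (nat \<Rightarrow> int) \<Rightarrow> (nat \<times> nat \<Rightarrow> complex) \<Rightarrow> complex" where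
  "tau n N w \<alpha> x = sigma n (wedgeW N w) \<alpha> x"

definition eps :: "nat \<Rightarrow> nat \<Rightarrow> complex" where
  "eps i j = (if i > j then -1 else 1)"

definition ddelta :: "nat \<Rightarrow> nat \<Rightarrow> (nat \<Rightarrow> int)" where
  "ddelta i j = (\<lambda>l. (if l = i then 1 else 0) - (if l = j then 1 else 0))"

text \<open>gamma_ij = eps_ji tau_{\<delta>_i-\<delta>_j}/tau_0, evaluated at points with even variables zero\<close>
definition egamma :: "nat \<Rightarrow> nat \<Rightarrow> (nat \<Rightarrow> int \<Rightarrow> complex) \<Rightarrow> nat \<Rightarrow> nat \<Rightarrow> (nat \<times> nat \<Rightarrow> complex) \<Rightarrow> complex" where
  "egamma n N w i j x = eps j i * tau n N w (ddelta i j) x / tau n N w (\<lambda>_. 0) x"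

end

theory Submission
  imports Defs "HOL-Library.Function_Algebras" "Jordan_Normal_Form.Determinant"
begin

text \<open>Write \<open>exp (\<xi> x)\<close> for multiplication by the diagonal matrix with entries
  \<open>exp (\<Sum>k. x (j, k) t^k)\<close>.  The tau-function at \<open>x\<close> consists of the minors of \<open>exp (\<xi> x) W\<close>.
  Hence, where \<open>tau\<^sub>0 \<noteq> 0\<close>, the space \<open>exp (\<xi> x) W\<close> has a basis
  \<open>b\<^sub>j = e\<^sub>j + \<Sum>i. \<beta> i j e\<^sub>i t^(-1) + O(t^(-2))\<close> modulo positive powers of \<open>t\<close>, and by Cramer's rule
  \<open>\<gamma> i j = - \<beta> i j\<close> for \<open>i \<noteq> j\<close>.  Differentiating in \<open>x (k, 1)\<close> multiplies the \<open>k\<close>-th component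
  by \<open>t\<close>, which gives the quadratic equations; stability of \<open>W\<close> under \<open>t\<close> makes the derivatives sum to
  zero; and if only odd variables are nonzero then \<open>exp (\<xi> x)\<close> preserves the pairing, so that
  \<open>0 = \<langle>b\<^sub>i, b\<^sub>j\<rangle>\<close> is the symmetry of \<open>\<beta>\<close>.

  That the tau-function consists of minors rests on the boson-fermion correspondence.  Its
  uniqueness follows from \<open>\<Sum>j k. \<alpha>\<^sub>-\<^sub>k \<alpha>\<^sub>k v = e v\<close> for a basis wedge \<open>v\<close> of energy \<open>e\<close>; its existence
  from defining it by Euler's identity \<open>e \<sigma>(v) = \<Sum>j k. k x (j, k) \<sigma>(\<alpha>\<^sub>k v)\<close> and the Heisenberg
  commutation relations.  The minors satisfy the same identity.\<close>

section \<open>Fock space\<close>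

text \<open>\<open>Qop\<close>, \<open>Qinv\<close> and \<open>sigma\<close> are definite
  descriptions, so nothing can be said about a tau-function until each is shown to exist and to be
  unique; hence the explicit models \<open>QQ\<close>, \<open>RR\<close> and \<open>SIG\<close>. For
  \<open>sigma\<close> the prescription on chains of creation modes does not settle existence, since
  relations between chains are not excluded in advance; a recursion on the energy avoids any choice
  of a basis of chains. The other obstacle is that exp(\<xi> x) turns basis vectors into infinite
  series. It never raises a label, so modulo labels at most - M only a finite window matters, and
  wedges, minors and derivatives become finite sums. M is taken at least n because the ground state
  of charge \<delta>_i - \<delta>_j vacates the label j - n; as a column this label has index n - j,
  the second index of \<open>nrm\<close>. The sign in \<gamma> = - \<beta> has three sources: the
  ground vector carries (-1)^(n - j) \<open>eps i j\<close>, moving the column of label i to the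
  front costs (-1)^(n - j) again, and \<open>eps j i\<close> times \<open>eps i j\<close> is
  -1.\<close>

lemma sum_fun_apply: "(sum f A) x = (\<Sum>i\<in>A. f i x)" for f :: "'a \<Rightarrow> 'b \<Rightarrow> complex"
  by (induction A rule: infinite_finite_induct) auto

section \<open>Coefficient functions and Maya diagrams\<close>

definition ev :: "int set \<Rightarrow> int set \<Rightarrow> complex" where
  "ev S = (\<lambda>T. if T = S then 1 else 0)"

text \<open>Sums of vectors use the pointwise group structure of functions; the scalar multiple is a
  constant of its own, so that linear combinations can be rewritten without opening the coefficient
  functions.\<close>

definition scl :: "complex \<Rightarrow> (int set \<Rightarrow> complex) \<Rightarrow> int set \<Rightarrow> complex" where
  "scl c f = (\<lambda>T. c * f T)"

lemma scl_apply [simp]: "scl c f T = c * f T"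
  by (simp add: scl_def)

lemma scl_simps [simp]:
  "scl c 0 = 0" "scl 0 f = 0" "scl 1 f = f" "scl c (scl d f) = scl (c * d) f"
  "scl (-1) f = - f"
  by (auto simp: fun_eq_iff)

lemma scl_add: "scl c (f + g) = scl c f + scl c g"
  by (auto simp: fun_eq_iff algebra_simps)

lemma scl_add_left: "scl (c + d) f = scl c f + scl d f"
  by (auto simp: fun_eq_iff algebra_simps)

lemma scl_minus: "scl c (- f) = - scl c f" "scl (- c) f = - scl c f"
  by (auto simp: fun_eq_iff algebra_simps)

lemma scl_diff: "scl c (f - g) = scl c f - scl c g"
  by (auto simp: fun_eq_iff algebra_simps)

lemma scl_sum: "scl c (sum f A) = (\<Sum>i\<in>A. scl c (f i))"
  by (auto simp: fun_eq_iff sum_fun_apply sum_distrib_left)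

lemma sum_scl_of_nat: "(\<Sum>i\<in>A. f) = scl (of_nat (card A)) f"
  by (auto simp: fun_eq_iff sum_fun_apply)

lemma vac_ev: "vac = ev {..0}"
  by (simp add: vac_def ev_def)

lemma maya_atMost [simp]: "maya {..c}"
  unfolding maya_def by blast

lemma maya_insert [simp]: "maya S \<Longrightarrow> maya (insert p S)"
proof -
  assume "maya S"
  then obtain a b where ab: "{..a} \<subseteq> S" "S \<subseteq> {..b}" by (auto simp: maya_def)
  have "{..a} \<subseteq> insert p S" using ab(1) by blast
  moreover have "insert p S \<subseteq> {..max p b}" using ab(2) by auto
  ultimately show ?thesis unfolding maya_def by blast
qed

lemma maya_remove [simp]: "maya S \<Longrightarrow> maya (S - {p})"
proof -
  assume "maya S"
  then obtain a b where ab: "{..a} \<subseteq> S" "S \<subseteq> {..b}" by (auto simp: maya_def)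
  have "{..min a (p - 1)} \<subseteq> S - {p}" using ab(1) by auto
  moreover have "S - {p} \<subseteq> {..b}" using ab(2) by auto
  ultimately show ?thesis unfolding maya_def by blast
qed

lemma maya_finite_above: "maya S \<Longrightarrow> finite {s \<in> S. s > p}"
proof -
  assume "maya S"
  then obtain b where "S \<subseteq> {..b}" by (auto simp: maya_def)
  then have "{s \<in> S. s > p} \<subseteq> {p..b}" by auto
  then show ?thesis by (rule finite_subset) simp
qed

lemma maya_finite_holes: "maya S \<Longrightarrow> finite {s. s \<notin> S \<and> s \<le> p}"
proof -
  assume "maya S"
  then obtain a where "{..a} \<subseteq> S" by (auto simp: maya_def)
  then have "s \<in> {a..p}" if "s \<notin> S" "s \<le> p" for s using that by (cases "s \<le> a") auto
  then have "{s. s \<notin> S \<and> s \<le> p} \<subseteq> {a..p}" by blast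
  then show ?thesis by (rule finite_subset) simp
qed

text \<open>A Maya diagram differs from the sea \<open>{..c}\<close> by finitely many holes and
  finitely many particles; removing the former and then inserting the latter reaches it. For wedges
  this says that the sea vector generates Fock space under the fermions.\<close>

lemma maya_induct [consumes 1, case_names vac insert remove]:
  assumes "maya S" and "P {..c}"
    and ins: "\<And>S p. maya S \<Longrightarrow> P S \<Longrightarrow> p \<notin> S \<Longrightarrow> P (insert p S)"
    and rem: "\<And>S p. maya S \<Longrightarrow> P S \<Longrightarrow> p \<in> S \<Longrightarrow> P (S - {p})"
  shows "P S"
proof -
  have "S - {..c} = {s \<in> S. s > c}" "{..c} - S = {s. s \<notin> S \<and> s \<le> c}" by auto
  then have fin: "finite (S - {..c})" "finite ({..c} - S)"
    using maya_finite_above[OF assms(1), of c] maya_finite_holes[OF assms(1), of c] by simp_all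
  have 1: "maya ({..c} - A) \<and> P ({..c} - A)" if "finite A" "A \<subseteq> {..c}" for A
    using that
  proof (induction A)
    case (insert x A)
    have "{..c} - insert x A = ({..c} - A) - {x}" by blast
    moreover have "x \<in> {..c} - A" using insert by auto
    ultimately show ?case using insert rem by simp
  qed (use assms(2) in auto)
  have 2: "maya (({..c} \<inter> S) \<union> A) \<and> P (({..c} \<inter> S) \<union> A)" if "finite A" "A \<inter> {..c} = {}" for A
    using that
  proof (induction A)
    case empty
    have "{..c} \<inter> S = {..c} - ({..c} - S)" by blast
    then show ?case using 1[OF fin(2)] by auto
  next
    case (insert x A)
    then show ?case using ins by auto
  qed
  have "({..c} \<inter> S) \<union> (S - {..c}) = S" by blast
  then show ?thesis using 2[OF fin(1)] by auto
qed

section \<open>Vectors and linear operators of Fock space\<close>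

lemma fockv_0 [simp]: "fockv 0"
  by (simp add: fockv_def)

lemma fockv_ev [simp]: "maya S \<Longrightarrow> fockv (ev S)"
  by (auto simp: fockv_def ev_def)

lemma fockv_add [simp]:
  assumes "fockv f" "fockv g" shows "fockv (f + g)"
proof -
  have "{S. (f + g) S \<noteq> 0} \<subseteq> {S. f S \<noteq> 0} \<union> {S. g S \<noteq> 0}" by auto
  then have "finite {S. (f + g) S \<noteq> 0}"
    by (rule finite_subset) (use assms in \<open>simp add: fockv_def\<close>)
  moreover have "maya S" if "(f + g) S \<noteq> 0" for S
    using that assms by (cases "f S = 0") (auto simp: fockv_def)
  ultimately show ?thesis unfolding fockv_def by blast
qed

lemma fockv_scl [simp]:
  assumes "fockv f" shows "fockv (scl c f)"
proof -
  have "{S. scl c f S \<noteq> 0} \<subseteq> {S. f S \<noteq> 0}" by auto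
  then have "finite {S. scl c f S \<noteq> 0}"
    by (rule finite_subset) (use assms in \<open>simp add: fockv_def\<close>)
  then show ?thesis using assms by (auto simp: fockv_def)
qed

lemma fockv_uminus [simp]: "fockv f \<Longrightarrow> fockv (- f)"
  using fockv_scl[of f "-1"] by simp

lemma fockv_diff [simp]: "fockv f \<Longrightarrow> fockv g \<Longrightarrow> fockv (f - g)"
  using fockv_add[of f "- g"] by simp

lemma fockv_sum [simp]: "(\<And>i. i \<in> A \<Longrightarrow> fockv (f i)) \<Longrightarrow> fockv (sum f A)"
  by (induction A rule: infinite_finite_induct) auto

lemma fun_expand:
  assumes "finite {S. f S \<noteq> 0}" shows "f = (\<Sum>S\<in>{S. f S \<noteq> 0}. scl (f S) (ev S))"
proof
  fix T
  have "(\<Sum>S\<in>{S. f S \<noteq> 0}. scl (f S) (ev S)) T = (\<Sum>S\<in>{S. f S \<noteq> 0}. if S = T then f T else 0)"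
    unfolding sum_fun_apply by (rule sum.cong) (auto simp: ev_def)
  also have "\<dots> = f T" using assms by (simp add: sum.delta)
  finally show "f T = (\<Sum>S\<in>{S. f S \<noteq> 0}. scl (f S) (ev S)) T" by simp
qed

lemma fockv_expand: "fockv f \<Longrightarrow> f = (\<Sum>S\<in>{S. f S \<noteq> 0}. scl (f S) (ev S))"
  by (rule fun_expand) (simp add: fockv_def)

text \<open>Linearity is asked on Fock space only: on other coefficient functions the value 0
  prescribed for \<open>Qop\<close>, and the value 0 of the infinite sums in \<open>alpha\<close>,
  can destroy additivity.\<close>

definition lin :: "((int set \<Rightarrow> complex) \<Rightarrow> (int set \<Rightarrow> complex)) \<Rightarrow> bool" where
  "lin A \<longleftrightarrow> (\<forall>f. fockv f \<longrightarrow> fockv (A f)) \<and>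
     (\<forall>f g. fockv f \<longrightarrow> fockv g \<longrightarrow> A (f + g) = A f + A g) \<and>
     (\<forall>c f. fockv f \<longrightarrow> A (scl c f) = scl c (A f))"

lemma lin_fockv: "lin A \<Longrightarrow> fockv f \<Longrightarrow> fockv (A f)"
  by (simp add: lin_def)

lemma lin_add: "lin A \<Longrightarrow> fockv f \<Longrightarrow> fockv g \<Longrightarrow> A (f + g) = A f + A g"
  by (simp add: lin_def)

lemma lin_scl: "lin A \<Longrightarrow> fockv f \<Longrightarrow> A (scl c f) = scl c (A f)"
  by (simp add: lin_def)

lemma lin_0: "lin A \<Longrightarrow> A 0 = 0"
  using lin_scl[of A 0 0] by simp

lemma lin_uminus: "lin A \<Longrightarrow> fockv f \<Longrightarrow> A (- f) = - A f"
  using lin_scl[of A f "-1"] by simp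

lemma lin_diff: "lin A \<Longrightarrow> fockv f \<Longrightarrow> fockv g \<Longrightarrow> A (f - g) = A f - A g"
  using lin_add[of A f "- g"] lin_uminus[of A g] by simp

lemma lin_sum: "lin A \<Longrightarrow> (\<And>i. i \<in> I \<Longrightarrow> fockv (f i)) \<Longrightarrow> A (sum f I) = (\<Sum>i\<in>I. A (f i))"
  by (induction I rule: infinite_finite_induct) (auto simp: lin_0 lin_add)

lemma lin_eqI:
  assumes "lin A" "lin B" "\<And>S. maya S \<Longrightarrow> A (ev S) = B (ev S)" "fockv f"
  shows "A f = B f"
proof -
  let ?I = "{S. f S \<noteq> 0}"
  have m: "maya S" if "S \<in> ?I" for S using assms(4) that by (auto simp: fockv_def)
  have "A (\<Sum>S\<in>?I. scl (f S) (ev S)) = (\<Sum>S\<in>?I. A (scl (f S) (ev S)))"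
    using m by (intro lin_sum[OF assms(1)]) simp
  also have "\<dots> = (\<Sum>S\<in>?I. B (scl (f S) (ev S)))"
    using m by (intro sum.cong) (auto simp: lin_scl[OF assms(1)] lin_scl[OF assms(2)] assms(3))
  also have "\<dots> = B (\<Sum>S\<in>?I. scl (f S) (ev S))"
    using m by (intro lin_sum[OF assms(2), symmetric]) simp
  finally have "A (\<Sum>S\<in>?I. scl (f S) (ev S)) = B (\<Sum>S\<in>?I. scl (f S) (ev S))" .
  then show ?thesis using fockv_expand[OF assms(4)] by simp
qed

lemma lin_id: "lin (\<lambda>f. f)"
  by (simp add: lin_def)

lemma lin_zero: "lin (\<lambda>f. 0)"
  by (simp add: lin_def)

lemma lin_compose: "lin A \<Longrightarrow> lin B \<Longrightarrow> lin (\<lambda>f. A (B f))"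
  by (simp add: lin_def)

lemma lin_scale: "lin A \<Longrightarrow> lin (\<lambda>f. scl c (A f))"
  by (simp add: lin_def scl_add mult.commute)

lemma lin_plus: "lin A \<Longrightarrow> lin B \<Longrightarrow> lin (\<lambda>f. A f + B f)"
  by (simp add: lin_def scl_add algebra_simps)

lemma lin_neg: "lin A \<Longrightarrow> lin (\<lambda>f. - A f)"
  by (simp add: lin_def scl_minus algebra_simps)

lemma lin_minus: "lin A \<Longrightarrow> lin B \<Longrightarrow> lin (\<lambda>f. A f - B f)"
  by (simp add: lin_def scl_diff algebra_simps)

lemma lin_Sum: "(\<And>i. i \<in> I \<Longrightarrow> lin (A i)) \<Longrightarrow> lin (\<lambda>f. \<Sum>i\<in>I. A i f)"
  by (simp add: lin_def scl_sum sum.distrib)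

section \<open>Signs and the canonical anticommutation relations\<close>

definition sg :: "int set \<Rightarrow> int \<Rightarrow> complex" where
  "sg S p = (-1) ^ card {s \<in> S. s > p}"

lemma sg_sq [simp]: "sg S p * sg S p = 1" "sg S p * (sg S p * z) = z"
proof -
  show *: "sg S p * sg S p = 1" by (simp add: sg_def flip: power_mult_distrib)
  show "sg S p * (sg S p * z) = z" by (simp add: * flip: mult.assoc)
qed

lemma sg_nz [simp]: "sg S p \<noteq> 0"
  by (simp add: sg_def)

lemma sg_insert:
  assumes "maya S" "q \<notin> S"
  shows "sg (insert q S) p = (if q > p then - sg S p else sg S p)"
proof (cases "q > p")
  case True
  then have "{s \<in> insert q S. s > p} = insert q {s \<in> S. s > p}" by auto
  then show ?thesis using True assms maya_finite_above[of S p] by (simp add: sg_def)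
next
  case False
  then have "{s \<in> insert q S. s > p} = {s \<in> S. s > p}" by auto
  then show ?thesis using False by (simp add: sg_def)
qed

lemma sg_remove:
  assumes "maya S" "q \<in> S"
  shows "sg (S - {q}) p = (if q > p then - sg S p else sg S p)"
  using sg_insert[of "S - {q}" q p] assms by (simp add: insert_absorb)

lemma psi_plus_ev: "psi_plus p (ev S) = (if p \<in> S then 0 else scl (sg S p) (ev (insert p S)))"
proof
  fix T
  show "psi_plus p (ev S) T = (if p \<in> S then 0 else scl (sg S p) (ev (insert p S))) T"
  proof (cases "p \<in> T \<and> T - {p} = S")
    case True
    then have "{s \<in> T. s > p} = {s \<in> S. s > p}" "T = insert p S" "p \<notin> S" by auto
    then show ?thesis by (simp add: psi_plus_def ev_def sg_def)
  next
    case False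
    then show ?thesis by (auto simp: psi_plus_def ev_def)
  qed
qed

lemma psi_minus_ev: "psi_minus p (ev S) = (if p \<in> S then scl (sg S p) (ev (S - {p})) else 0)"
proof
  fix T
  show "psi_minus p (ev S) T = (if p \<in> S then scl (sg S p) (ev (S - {p})) else 0) T"
  proof (cases "p \<notin> T \<and> insert p T = S")
    case True
    then have "{s \<in> T. s > p} = {s \<in> S. s > p}" "T = S - {p}" "p \<in> S" by auto
    then show ?thesis using True by (simp add: psi_minus_def ev_def sg_def)
  next
    case False
    then show ?thesis by (auto simp: psi_minus_def ev_def)
  qed
qed

lemma psi_plus_add: "psi_plus p (f + g) = psi_plus p f + psi_plus p g"
  by (auto simp: psi_plus_def fun_eq_iff algebra_simps)

lemma psi_minus_add: "psi_minus p (f + g) = psi_minus p f + psi_minus p g"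
  by (auto simp: psi_minus_def fun_eq_iff algebra_simps)

lemma psi_plus_scl: "psi_plus p (scl c f) = scl c (psi_plus p f)"
  by (auto simp: psi_plus_def fun_eq_iff algebra_simps)

lemma psi_minus_scl: "psi_minus p (scl c f) = scl c (psi_minus p f)"
  by (auto simp: psi_minus_def fun_eq_iff algebra_simps)

lemma psi_0 [simp]: "psi_plus p 0 = 0" "psi_minus p 0 = 0"
  by (simp_all add: psi_plus_def psi_minus_def fun_eq_iff)

lemma lin_psi_plus [simp]: "lin (psi_plus p)"
proof -
  have "fockv (psi_plus p f)" if "fockv f" for f
  proof -
    have eq: "psi_plus p (sum g I) = (\<Sum>i\<in>I. psi_plus p (g i))" if "finite I"
      for g :: "int set \<Rightarrow> int set \<Rightarrow> complex" and I
      using that by (induction I) (simp_all only: sum.empty sum.insert psi_0 psi_plus_add not_False_eq_True)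
    have "psi_plus p f = (\<Sum>S\<in>{S. f S \<noteq> 0}. psi_plus p (scl (f S) (ev S)))"
      using fockv_expand[OF that] that eq[of "{S. f S \<noteq> 0}" "\<lambda>S. scl (f S) (ev S)"]
      by (simp add: fockv_def)
    moreover have "fockv (psi_plus p (scl (f S) (ev S)))" if "S \<in> {S. f S \<noteq> 0}" for S
      using that \<open>fockv f\<close> by (auto simp: psi_plus_scl psi_plus_ev fockv_def[of f])
    ultimately show ?thesis by (metis (no_types, lifting) fockv_sum)
  qed
  then show ?thesis by (simp add: lin_def psi_plus_add psi_plus_scl)
qed

lemma lin_psi_minus [simp]: "lin (psi_minus p)"
proof -
  have "fockv (psi_minus p f)" if "fockv f" for f
  proof -
    have eq: "psi_minus p (sum g I) = (\<Sum>i\<in>I. psi_minus p (g i))" if "finite I"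
      for g :: "int set \<Rightarrow> int set \<Rightarrow> complex" and I
      using that by (induction I) (simp_all only: sum.empty sum.insert psi_0 psi_minus_add not_False_eq_True)
    have "psi_minus p f = (\<Sum>S\<in>{S. f S \<noteq> 0}. psi_minus p (scl (f S) (ev S)))"
      using fockv_expand[OF that] that eq[of "{S. f S \<noteq> 0}" "\<lambda>S. scl (f S) (ev S)"]
      by (simp add: fockv_def)
    moreover have "fockv (psi_minus p (scl (f S) (ev S)))" if "S \<in> {S. f S \<noteq> 0}" for S
      using that \<open>fockv f\<close> by (auto simp: psi_minus_scl psi_minus_ev fockv_def[of f])
    ultimately show ?thesis by (metis (no_types, lifting) fockv_sum)
  qed
  then show ?thesis by (simp add: lin_def psi_minus_add psi_minus_scl)
qed

lemma lin_psi_plus': "lin A \<Longrightarrow> lin (\<lambda>f. psi_plus p (A f))"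
  by (rule lin_compose[OF lin_psi_plus])

lemma lin_psi_minus': "lin A \<Longrightarrow> lin (\<lambda>f. psi_minus p (A f))"
  by (rule lin_compose[OF lin_psi_minus])

lemmas lin_intros = lin_psi_plus' lin_psi_minus' lin_scale lin_plus lin_minus lin_neg lin_Sum lin_id lin_zero

lemmas fockv_psi [simp] = lin_fockv[OF lin_psi_plus] lin_fockv[OF lin_psi_minus]

text \<open>Inserting a label reverses the sign attached to every lower label and to no higher one,
  so exactly one of the two orders picks up an extra minus sign. The same count gives the other
  anticommutation relations.\<close>

lemma psi_plus_plus:
  assumes "fockv f" shows "psi_plus p (psi_plus q f) = - psi_plus q (psi_plus p f)"
proof (rule lin_eqI[where A = "\<lambda>f. psi_plus p (psi_plus q f)" and B = "\<lambda>f. - psi_plus q (psi_plus p f)", OF _ _ _ assms])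
  fix S assume S: "maya S"
  show "psi_plus p (psi_plus q (ev S)) = - psi_plus q (psi_plus p (ev S))"
    using S by (auto simp: psi_plus_ev psi_plus_scl sg_insert insert_commute scl_minus mult.commute)
qed (intro lin_intros)+

lemma psi_minus_minus:
  assumes "fockv f" shows "psi_minus p (psi_minus q f) = - psi_minus q (psi_minus p f)"
proof (rule lin_eqI[where A = "\<lambda>f. psi_minus p (psi_minus q f)" and B = "\<lambda>f. - psi_minus q (psi_minus p f)", OF _ _ _ assms])
  fix S assume S: "maya S"
  have "S - {p} - {q} = S - {q} - {p}" by blast
  then show "psi_minus p (psi_minus q (ev S)) = - psi_minus q (psi_minus p (ev S))"
    using S by (auto simp: psi_minus_ev psi_minus_scl sg_remove scl_minus mult.commute)
qed (intro lin_intros)+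

lemma psi_plus_minus_same:
  assumes "fockv f" shows "psi_plus p (psi_minus p f) = f - psi_minus p (psi_plus p f)"
proof (rule lin_eqI[where A = "\<lambda>f. psi_plus p (psi_minus p f)" and B = "\<lambda>f. f - psi_minus p (psi_plus p f)", OF _ _ _ assms])
  fix S assume S: "maya S"
  show "psi_plus p (psi_minus p (ev S)) = ev S - psi_minus p (psi_plus p (ev S))"
    using S by (cases "p \<in> S") (auto simp: psi_minus_ev psi_minus_scl psi_plus_scl psi_plus_ev
        sg_remove sg_insert insert_absorb)
qed (intro lin_intros)+

lemma psi_plus_minus_diff:
  assumes "fockv f" "p \<noteq> q" shows "psi_plus p (psi_minus q f) = - psi_minus q (psi_plus p f)"
proof (rule lin_eqI[where A = "\<lambda>f. psi_plus p (psi_minus q f)" and B = "\<lambda>f. - psi_minus q (psi_plus p f)", OF _ _ _ assms(1)])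
  fix S assume S: "maya S"
  have "insert p (S - {q}) = insert p S - {q}" using assms(2) by blast
  then show "psi_plus p (psi_minus q (ev S)) = - psi_minus q (psi_plus p (ev S))"
    using S assms(2) by (auto simp: psi_minus_ev psi_minus_scl psi_plus_scl psi_plus_ev
        sg_remove sg_insert scl_minus mult.commute)
qed (intro lin_intros)+

lemma psi_plus_minus:
  assumes "fockv f"
  shows "psi_plus p (psi_minus q f) = (if p = q then f else 0) - psi_minus q (psi_plus p f)"
  using psi_plus_minus_same[OF assms] psi_plus_minus_diff[OF assms] by auto

section \<open>Colours and levels of labels\<close>

definition colour :: "nat \<Rightarrow> int \<Rightarrow> nat" where
  "colour n p = nat ((p - 1) mod int n) + 1"

text \<open>The label of e_j t^k is j + n (- k - 1), so the level is - k - 1: labels at most 0 are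
  the nonnegative powers of t. The shift by one in both definitions makes colours run through 1..n
  instead of 0..n - 1.\<close>

definition lev :: "nat \<Rightarrow> int \<Rightarrow> int" where
  "lev n p = (p - 1) div int n"

lemma colour_range: "n \<ge> 1 \<Longrightarrow> colour n p \<in> {1..n}"
proof -
  assume "n \<ge> 1"
  then have "(p - 1) mod int n < int n" "(p-1) mod int n \<ge> 0" by auto
  then have "nat ((p - 1) mod int n) < n" by (simp add: nat_less_iff)
  then show ?thesis unfolding colour_def by auto
qed

lemma colour_lev: "n \<ge> 1 \<Longrightarrow> int (colour n p) + int n * lev n p = p"
proof -
  assume n: "n \<ge> 1"
  then have "(p-1) mod int n \<ge> 0" by auto
  then have "int (colour n p) = (p-1) mod int n + 1" by (simp add: colour_def)
  moreover have "(p-1) mod int n + int n * ((p - 1) div int n) = p - 1" by simp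
  ultimately show ?thesis unfolding lev_def by linarith
qed

lemma colour_lev_unique:
  assumes "n \<ge> 1" "j \<in> {1..n}" "p = int j + int n * l"
  shows "colour n p = j" "lev n p = l"
proof -
  have "p - 1 = (int j - 1) + int n * l" using assms by simp
  moreover have "0 \<le> int j - 1" "int j - 1 < int n" using assms by auto
  moreover have "((int j - 1) + int n * l) mod int n = int j - 1" "((int j - 1) + int n * l) div int n = l"
    using calculation by (simp_all add: div_add1_eq)
  ultimately have "(p - 1) mod int n = int j - 1" "(p - 1) div int n = l" by metis+
  then show "colour n p = j" "lev n p = l" using assms(2) by (auto simp: colour_def lev_def)
qed

lemma colour_lab: "n \<ge> 1 \<Longrightarrow> j \<in> {1..n} \<Longrightarrow> colour n (lab n j k) = j"
  by (rule colour_lev_unique(1)[of _ _ _ "- (k + 1)"]) (auto simp: lab_def algebra_simps)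

lemma colour_add [simp]: "colour n (p + int n * k) = colour n p" "colour n (p - int n * k) = colour n p"
  "colour n (p + int n) = colour n p" "colour n (p - int n) = colour n p"
proof -
  have *: "colour n (p + int n * k) = colour n p" for k
    unfolding colour_def by (metis add_diff_eq diff_add_eq mod_mult_self2)
  show "colour n (p + int n * k) = colour n p" "colour n (p - int n * k) = colour n p"
    "colour n (p + int n) = colour n p" "colour n (p - int n) = colour n p"
    using *[of k] *[of "-k"] *[of 1] *[of "-1"] by auto
qed

lemma colour_add' [simp]: "colour n (p + k * int n) = colour n p" "colour n (p - k * int n) = colour n p"
  using colour_add(1,2)[of n p k] by (simp_all only: mult.commute)

lemma lev_add: "n \<ge> 1 \<Longrightarrow> lev n (p + int n * k) = lev n p + k"
proof -
  assume "n \<ge> 1"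
  then have "(p - 1 + int n * k) div int n = (p - 1) div int n + k" by simp
  then show ?thesis unfolding lev_def by (simp add: algebra_simps)
qed

lemma lab_surj: "n \<ge> 1 \<Longrightarrow> colour n p = j \<Longrightarrow> p = lab n j (- lev n p - 1)"
  using colour_lev[of n p] by (simp add: lab_def)

lemma lab_inj: "n \<ge> 1 \<Longrightarrow> inj (lab n j)"
  by (auto simp: inj_def lab_def)

lemma same_colour: "n \<ge> 1 \<Longrightarrow> colour n p = colour n q \<longleftrightarrow> (\<exists>k. q = p + int n * k)"
proof
  assume n: "n \<ge> 1" and "colour n p = colour n q"
  then have "q = p + int n * (lev n q - lev n p)"
    using colour_lev[OF n, of p] colour_lev[OF n, of q] by (simp add: algebra_simps)
  then show "\<exists>k. q = p + int n * k" by blast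
qed auto

section \<open>The currents as sums of hops\<close>

abbreviation hop :: "int \<Rightarrow> int \<Rightarrow> (int set \<Rightarrow> complex) \<Rightarrow> int set \<Rightarrow> complex" where
  "hop p q f \<equiv> psi_plus p (psi_minus q f)"

lemma hop_ev:
  assumes "maya S" "p \<noteq> q"
  shows "hop p q (ev S) = (if q \<in> S \<and> p \<notin> S then scl (sg S q * sg (S - {q}) p) (ev (insert p (S - {q}))) else 0)"
  using assms by (auto simp: psi_minus_ev psi_plus_scl psi_plus_ev)

lemma hop_ev_zero:
  "maya S \<Longrightarrow> p \<noteq> q \<Longrightarrow> \<not> (q \<in> S \<and> p \<notin> S) \<Longrightarrow> hop p q (ev S) = 0"
  using hop_ev[of S p q] by auto

text \<open>A hop that does not vanish takes a particle at p + d to a hole at p. Particles are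
  bounded above and holes below, which confines p to an interval.\<close>

lemma hop_finite_ev:
  assumes "maya S" "d \<noteq> 0"
  shows "finite {p. hop p (p + d) (ev S) \<noteq> 0}"
proof -
  obtain a b where ab: "{..a} \<subseteq> S" "S \<subseteq> {..b}" using assms by (auto simp: maya_def)
  have "{p. hop p (p + d) (ev S) \<noteq> 0} \<subseteq> {a..b - d}"
  proof
    fix p assume p: "p \<in> {p. hop p (p + d) (ev S) \<noteq> 0}"
    then have "p + d \<in> S \<and> p \<notin> S"
      using hop_ev[OF assms(1), of p "p + d"] assms(2) by (auto split: if_splits)
    then have "p > a" "p + d \<le> b" using ab by (auto simp: not_less[symmetric] subset_iff)
    then show "p \<in> {a..b - d}" by auto
  qed
  then show ?thesis by (rule finite_subset) simp
qed

lemma hop_finite: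
  assumes "fockv f" "d \<noteq> 0"
  shows "finite {p. hop p (p + d) f \<noteq> 0}"
proof -
  let ?I = "{S. f S \<noteq> 0}"
  have m: "maya S" if "S \<in> ?I" for S using assms(1) that by (auto simp: fockv_def)
  have l: "lin (\<lambda>f. hop p (p + d) f)" for p by (intro lin_intros)
  have eq: "hop p (p + d) f = (\<Sum>S\<in>?I. scl (f S) (hop p (p + d) (ev S)))" for p
  proof -
    have "hop p (p + d) f = hop p (p + d) (\<Sum>S\<in>?I. scl (f S) (ev S))"
      using fockv_expand[OF assms(1)] by simp
    also have "\<dots> = (\<Sum>S\<in>?I. scl (f S) (hop p (p + d) (ev S)))"
      using m lin_sum[OF l, of ?I "\<lambda>S. scl (f S) (ev S)"] by (simp add: psi_plus_scl psi_minus_scl)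
    finally show ?thesis .
  qed
  have "{p. hop p (p + d) f \<noteq> 0} \<subseteq> (\<Union>S\<in>?I. {p. hop p (p + d) (ev S) \<noteq> 0})"
  proof
    fix p assume "p \<in> {p. hop p (p + d) f \<noteq> 0}"
    then have "\<exists>S\<in>?I. hop p (p + d) (ev S) \<noteq> 0" using eq[of p]
      by (metis (mono_tags, lifting) mem_Collect_eq scl_simps(1) sum.not_neutral_contains_not_neutral)
    then show "p \<in> (\<Union>S\<in>?I. {p. hop p (p + d) (ev S) \<noteq> 0})" by blast
  qed
  moreover have "finite (\<Union>S\<in>?I. {p. hop p (p + d) (ev S) \<noteq> 0})"
    using assms hop_finite_ev m by (auto simp: fockv_def)
  ultimately show ?thesis by (rule finite_subset)
qed

text \<open>In \<open>alpha\<close> the index set depends on the diagram at which the result is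
  evaluated. Replacing it by one finite set of labels turns \<open>alpha\<close> into a finite sum
  of operators, to which linearity applies.\<close>

lemma alpha_eq_sum:
  assumes n: "n \<ge> 1" "j \<in> {1..n}" and P: "finite P"
    and nz: "\<And>p. p \<in> P \<Longrightarrow> colour n p = j" "\<And>p. colour n p = j \<Longrightarrow> p \<notin> P \<Longrightarrow> hop p (p + int n * k) f = 0"
  shows "alpha n j k f = (\<Sum>p\<in>P. hop p (p + int n * k) f)"
proof
  fix T
  have lab: "lab n j (- (k - l - 1) - 1) = lab n j l + int n * k" for l
    by (simp add: lab_def algebra_simps)
  let ?g = "\<lambda>p. hop p (p + int n * k) f T"
  have "alpha n j k f T = (\<Sum>l\<in>{l. ?g (lab n j l) \<noteq> 0}. ?g (lab n j l))"
    unfolding alpha_def psip_def psim_def lab ..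
  also have "\<dots> = (\<Sum>p\<in>lab n j ` {l. ?g (lab n j l) \<noteq> 0}. ?g p)"
    by (subst sum.reindex) (auto intro: inj_on_subset[OF lab_inj[OF n(1)]])
  also have "\<dots> = (\<Sum>p\<in>P. ?g p)"
  proof (rule sum.mono_neutral_left[OF P])
    show "lab n j ` {l. ?g (lab n j l) \<noteq> 0} \<subseteq> P"
      using nz(2) colour_lab[OF n] by (force simp: fun_eq_iff)
    show "\<forall>p\<in>P - lab n j ` {l. ?g (lab n j l) \<noteq> 0}. ?g p = 0"
    proof
      fix p assume p: "p \<in> P - lab n j ` {l. ?g (lab n j l) \<noteq> 0}"
      then have "p = lab n j (- lev n p - 1)" using lab_surj[OF n(1)] nz(1) by auto
      then show "?g p = 0" using p by (metis (mono_tags, lifting) DiffD2 image_eqI mem_Collect_eq)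
    qed
  qed
  finally show "alpha n j k f T = (\<Sum>p\<in>P. hop p (p + int n * k) f) T" by (simp add: sum_fun_apply)
qed

definition hops :: "nat \<Rightarrow> nat \<Rightarrow> int \<Rightarrow> (int set \<Rightarrow> complex) \<Rightarrow> int set" where
  "hops n j k f = {p. colour n p = j \<and> hop p (p + int n * k) f \<noteq> 0}"

lemma finite_hops: "n \<ge> 1 \<Longrightarrow> k \<noteq> 0 \<Longrightarrow> fockv f \<Longrightarrow> finite (hops n j k f)"
  unfolding hops_def by (rule finite_subset[OF _ hop_finite[of f "int n * k"]]) auto

lemma alpha_sum:
  assumes "n \<ge> 1" "j \<in> {1..n}" "finite P" "hops n j k f \<subseteq> P"
  shows "alpha n j k f = (\<Sum>p\<in>{p\<in>P. colour n p = j}. hop p (p + int n * k) f)"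
  using assms by (intro alpha_eq_sum) (auto simp: hops_def)

lemma lin_alpha:
  assumes "n \<ge> 1" "j \<in> {1..n}" "k \<noteq> 0"
  shows "lin (alpha n j k)"
  unfolding lin_def
proof (intro conjI allI impI)
  fix f assume f: "fockv f"
  show "fockv (alpha n j k f)"
    using alpha_sum[OF assms(1,2) finite_hops[OF assms(1,3) f] subset_refl] f by simp
  fix c
  have "hops n j k (scl c f) \<subseteq> hops n j k f"
    by (auto simp: hops_def psi_plus_scl psi_minus_scl)
  then show "alpha n j k (scl c f) = scl c (alpha n j k f)"
    using alpha_sum[OF assms(1,2) finite_hops[OF assms(1,3) f, of j], where f = "scl c f" and k = k]
      alpha_sum[OF assms(1,2) finite_hops[OF assms(1,3) f, of j], where f = f and k = k]
    by (simp add: psi_plus_scl psi_minus_scl scl_sum)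
next
  fix f g assume f: "fockv f" "fockv g"
  let ?P = "hops n j k f \<union> hops n j k g"
  have "finite ?P" using finite_hops[OF assms(1,3)] f by simp
  moreover have "hops n j k (f + g) \<subseteq> ?P"
    by (auto simp: hops_def psi_plus_add psi_minus_add)
  ultimately show "alpha n j k (f + g) = alpha n j k f + alpha n j k g"
    using alpha_sum[OF assms(1,2), of ?P k f] alpha_sum[OF assms(1,2), of ?P k g]
      alpha_sum[OF assms(1,2), of ?P k "f + g"]
    by (simp add: psi_plus_add psi_minus_add sum.distrib)
qed

lemma lin_alpha': "n \<ge> 1 \<Longrightarrow> j \<in> {1..n} \<Longrightarrow> k \<noteq> 0 \<Longrightarrow> lin A \<Longrightarrow> lin (\<lambda>f. alpha n j k (A f))"
  by (rule lin_compose[OF lin_alpha])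

lemma fockv_alpha [simp]: "n \<ge> 1 \<Longrightarrow> j \<in> {1..n} \<Longrightarrow> k \<noteq> 0 \<Longrightarrow> fockv f \<Longrightarrow> fockv (alpha n j k f)"
  using lin_fockv lin_alpha by blast

text \<open>The current acts on wedges as the derivation induced by t^k on component j, which sends
  the vector of label r to that of label r - n k. The extra term arises at the single p for which
  the contraction meets r, and this p is added to the index set.\<close>

lemma alpha_psi_plus:
  assumes n: "n \<ge> 1" "j \<in> {1..n}" "k \<noteq> 0" and f: "fockv f"
  shows "alpha n j k (psi_plus r f) = psi_plus r (alpha n j k f)
     + (if colour n r = j then psi_plus (r - int n * k) f else 0)"
proof -
  let ?P = "hops n j k f \<union> hops n j k (psi_plus r f) \<union> {r - int n * k}"
  let ?Q = "{p\<in>?P. colour n p = j}"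
  have fin: "finite ?P" using finite_hops[OF n(1,3)] f by simp
  have "alpha n j k (psi_plus r f) = (\<Sum>p\<in>?Q. hop p (p + int n * k) (psi_plus r f))"
    by (rule alpha_sum[OF n(1,2) fin]) auto
  also have "\<dots> = (\<Sum>p\<in>?Q. psi_plus r (hop p (p + int n * k) f)
      + (if p = r - int n * k then psi_plus p f else 0))"
  proof (rule sum.cong[OF refl])
    fix p
    have "psi_minus (p + int n * k) (psi_plus r f) =
       (if r = p + int n * k then f else 0) - psi_plus r (psi_minus (p + int n * k) f)"
      using psi_plus_minus[OF f, of r "p + int n * k"] by simp
    then have "hop p (p + int n * k) (psi_plus r f) =
      psi_plus p (if r = p + int n * k then f else 0) - psi_plus p (psi_plus r (psi_minus (p + int n * k) f))"
      using f by (simp add: lin_diff[OF lin_psi_plus])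
    then show "hop p (p + int n * k) (psi_plus r f) = psi_plus r (hop p (p + int n * k) f)
      + (if p = r - int n * k then psi_plus p f else 0)"
      using psi_plus_plus[of "psi_minus (p + int n * k) f" p r] f by auto
  qed
  also have "\<dots> = psi_plus r (\<Sum>p\<in>?Q. hop p (p + int n * k) f)
      + (\<Sum>p\<in>?Q. if p = r - int n * k then psi_plus p f else 0)"
    using f by (subst lin_sum[OF lin_psi_plus]) (auto simp: sum.distrib)
  also have "(\<Sum>p\<in>?Q. hop p (p + int n * k) f) = alpha n j k f"
    by (rule alpha_sum[OF n(1,2) fin, symmetric]) auto
  also have "(\<Sum>p\<in>?Q. if p = r - int n * k then psi_plus p f else 0) =
     (if colour n r = j then psi_plus (r - int n * k) f else 0)"
    using fin by (subst sum.delta) auto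
  finally show ?thesis .
qed

text \<open>On functionals t^k acts by minus its transpose, whence the sign and the shift in the
  opposite direction. Here the exceptional summand is p = r, where creation and contraction fail to
  anticommute.\<close>

lemma alpha_psi_minus:
  assumes n: "n \<ge> 1" "j \<in> {1..n}" "k \<noteq> 0" and f: "fockv f"
  shows "alpha n j k (psi_minus r f) = psi_minus r (alpha n j k f)
     - (if colour n r = j then psi_minus (r + int n * k) f else 0)"
proof -
  let ?P = "hops n j k f \<union> hops n j k (psi_minus r f) \<union> {r}"
  let ?Q = "{p\<in>?P. colour n p = j}"
  have fin: "finite ?P" using finite_hops[OF n(1,3)] f by simp
  have "alpha n j k (psi_minus r f) = (\<Sum>p\<in>?Q. hop p (p + int n * k) (psi_minus r f))"
    by (rule alpha_sum[OF n(1,2) fin]) auto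
  also have "\<dots> = (\<Sum>p\<in>?Q. psi_minus r (hop p (p + int n * k) f)
      - (if p = r then psi_minus (p + int n * k) f else 0))"
  proof (rule sum.cong[OF refl])
    fix p
    have "hop p (p + int n * k) (psi_minus r f) = - psi_plus p (psi_minus r (psi_minus (p + int n * k) f))"
      using psi_minus_minus[OF f, of "p + int n * k" r] f by (simp add: lin_uminus[OF lin_psi_plus])
    then show "hop p (p + int n * k) (psi_minus r f) = psi_minus r (hop p (p + int n * k) f)
      - (if p = r then psi_minus (p + int n * k) f else 0)"
      using psi_plus_minus[of "psi_minus (p + int n * k) f" p r] f by auto
  qed
  also have "\<dots> = psi_minus r (\<Sum>p\<in>?Q. hop p (p + int n * k) f)
      - (\<Sum>p\<in>?Q. if p = r then psi_minus (p + int n * k) f else 0)"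
    using f by (subst lin_sum[OF lin_psi_minus]) (auto simp: sum_subtractf)
  also have "(\<Sum>p\<in>?Q. hop p (p + int n * k) f) = alpha n j k f"
    by (rule alpha_sum[OF n(1,2) fin, symmetric]) auto
  also have "(\<Sum>p\<in>?Q. if p = r then psi_minus (p + int n * k) f else 0) =
     (if colour n r = j then psi_minus (r + int n * k) f else 0)"
    using fin by (subst sum.delta) auto
  finally show ?thesis .
qed

lemma alpha_sea:
  assumes n: "n \<ge> 1" "j \<in> {1..n}" "k > 0"
  shows "alpha n j k (ev {..c}) = 0"
proof -
  have "alpha n j k (ev {..c}) = (\<Sum>p\<in>{p\<in>{}. colour n p = j}. hop p (p + int n * k) (ev {..c}))"
  proof (rule alpha_sum[OF n(1,2)])
    have "hop p (p + int n * k) (ev {..c}) = 0" for p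
    proof -
      have "int n * k > 0" using n by auto
      then have "p \<noteq> p + int n * k" by linarith
      moreover have "\<not> (p + int n * k \<le> c \<and> \<not> p \<le> c)" using \<open>int n * k > 0\<close> by linarith
      ultimately show ?thesis by (intro hop_ev_zero) auto
    qed
    then show "hops n j k (ev {..c}) \<subseteq> {}" by (auto simp: hops_def)
  qed simp
  then show ?thesis by simp
qed

text \<open>Schur's lemma for the fermions: the sea vector is cyclic, so an operator that commutes
  with all fermions is determined by its value there.\<close>

lemma commuting_scalar:
  assumes Z: "lin Z"
    and p: "\<And>r f. fockv f \<Longrightarrow> Z (psi_plus r f) = psi_plus r (Z f)"
    and m: "\<And>r f. fockv f \<Longrightarrow> Z (psi_minus r f) = psi_minus r (Z f)"
    and v: "Z (ev {..c}) = scl z (ev {..c})"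
    and f: "fockv f"
  shows "Z f = scl z f"
proof (rule lin_eqI[where B = "\<lambda>f. scl z f", OF Z _ _ f])
  fix S assume "maya S"
  then show "Z (ev S) = scl z (ev S)"
  proof (induction rule: maya_induct[where c = c])
    case vac show ?case by (rule v)
  next
    case (insert S r)
    then have "ev (insert r S) = scl (sg S r) (psi_plus r (ev S))" by (simp add: psi_plus_ev)
    moreover have "Z (ev S) = scl z (ev S)" by (rule insert.IH)
    ultimately have "Z (ev (insert r S)) = scl z (ev (insert r S))"
      using insert(1) p[of "ev S" r] by (simp add: lin_scl[OF Z] psi_plus_scl mult.commute)
    then show ?case .
  next
    case (remove S r)
    then have "ev (S - {r}) = scl (sg S r) (psi_minus r (ev S))" by (simp add: psi_minus_ev)
    moreover have "Z (ev S) = scl z (ev S)" by (rule remove.IH)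
    ultimately have "Z (ev (S - {r})) = scl z (ev (S - {r}))"
      using remove(1) m[of "ev S" r] by (simp add: lin_scl[OF Z] psi_minus_scl mult.commute)
    then show ?case .
  qed
qed (intro lin_intros)

text \<open>The labels in question are those of colour j on the levels 0 to m - 1. They index the
  hops that return to the vacuum in \<open>alpha_commutator_vac\<close>, and their number is the
  origin of the central term.\<close>

lemma card_residue_interval:
  assumes "n \<ge> 1" "j \<in> {1..n}" "m \<ge> 0"
  shows "card {p. colour n p = j \<and> 0 < p \<and> p \<le> int n * m} = nat m"
    and "finite {p. colour n p = j \<and> 0 < p \<and> p \<le> int n * m}"
proof -
  have "{p. colour n p = j \<and> 0 < p \<and> p \<le> int n * m} = (\<lambda>l. int j + int n * l) ` {0..<m}"
  proof (intro Set.set_eqI iffI)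
    fix p assume p: "p \<in> {p. colour n p = j \<and> 0 < p \<and> p \<le> int n * m}"
    then have e: "p = int j + int n * lev n p" using colour_lev[OF assms(1), of p] by auto
    have "lev n p \<ge> 0" using p assms(1) unfolding lev_def by (auto intro: div_int_pos_iff[THEN iffD2])
    moreover have "lev n p < m"
    proof (rule ccontr)
      assume "\<not> lev n p < m"
      then have "int n * lev n p \<ge> int n * m" by (intro mult_left_mono) auto
      then show False using p e assms(2) by auto
    qed
    ultimately show "p \<in> (\<lambda>l. int j + int n * l) ` {0..<m}" using e by auto
  next
    fix p assume "p \<in> (\<lambda>l. int j + int n * l) ` {0..<m}"
    then obtain l where l: "0 \<le> l" "l < m" "p = int j + int n * l" by auto
    have "int n * l \<ge> 0" using l by auto
    moreover have "int n * (l + 1) \<le> int n * m" using l by (intro mult_left_mono) auto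
    ultimately show "p \<in> {p. colour n p = j \<and> 0 < p \<and> p \<le> int n * m}"
      using l(3) colour_lev_unique(1)[OF assms(1,2) l(3)] assms(2) by (auto simp: distrib_left)
  qed
  moreover have "inj_on (\<lambda>l. int j + int n * l) {0..<m}" using assms(1) by (auto simp: inj_on_def)
  ultimately show "card {p. colour n p = j \<and> 0 < p \<and> p \<le> int n * m} = nat m"
    "finite {p. colour n p = j \<and> 0 < p \<and> p \<le> int n * m}" by (simp_all add: card_image)
qed

text \<open>\<alpha>_(-m) creates the hops from p - n m to p with 0 < p \<le> n m, and \<alpha>_k
  then lowers the particle or, with a minus sign, raises the hole. If k = m, lowering the particle
  closes the hop and gives back the vacuum once for each p. If k differs from m, both families
  become, after a shift of p, the same sum of hops and cancel.\<close>

lemma alpha_commutator_vac: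
  assumes n: "n \<ge> 1" "i \<in> {1..n}" "j \<in> {1..n}" "k > 0" "m > 0"
  shows "alpha n i k (alpha n j (- m) (ev {..0})) = scl (if i = j \<and> k = m then of_int k else 0) (ev {..0})"
proof -
  let ?v = "ev {..0}"
  let ?P = "{p. colour n p = j \<and> 0 < p \<and> p \<le> int n * m}"
  have fin: "finite ?P" using card_residue_interval[OF n(1,3), of m] n by simp
  have nm: "int n * m > 0" "int n * k > 0" using n by auto
  have hv: "hop p q ?v = (if q \<le> 0 \<and> p > 0 then hop p q ?v else 0)" if "p \<noteq> q" for p q
    using that by (simp add: hop_ev)
  have "alpha n j (- m) ?v = (\<Sum>p\<in>{p\<in>?P. colour n p = j}. hop p (p + int n * (- m)) ?v)"
  proof (rule alpha_sum[OF n(1,3) fin])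
    have "hop p (p - int n * m) ?v = 0" if "\<not> (0 < p \<and> p \<le> int n * m)" for p
    proof -
      have "p \<noteq> p - int n * m" using nm by linarith
      then show ?thesis using that by (auto simp: hop_ev)
    qed
    then show "hops n j (- m) ?v \<subseteq> ?P" by (force simp: hops_def)
  qed
  then have "alpha n j (- m) ?v = (\<Sum>p\<in>?P. hop p (p - int n * m) ?v)"
    by (simp add: conj_ac cong: conj_cong)
  then have "alpha n i k (alpha n j (- m) ?v) = (\<Sum>p\<in>?P. alpha n i k (hop p (p - int n * m) ?v))"
    using n by (simp add: lin_sum[OF lin_alpha[OF n(1,2)]])
  also have "\<dots> = (\<Sum>p\<in>?P. if i = j then hop (p - int n * k) (p - int n * m) ?v
        - hop p (p - int n * (m - k)) ?v else 0)"
  proof (rule sum.cong[OF refl])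
    fix p assume p: "p \<in> ?P"
    have 1: "alpha n i k (psi_minus (p - int n * m) ?v) =
       - (if i = j then psi_minus (p - int n * (m - k)) ?v else 0)"
    proof -
      have e: "p - int n * m + int n * k = p - int n * (m - k)" by (simp add: algebra_simps)
      have "colour n (p - int n * m) = j" using p by simp
      then show ?thesis
        using alpha_psi_minus[OF n(1,2), of k ?v "p - int n * m"] n alpha_sea[OF n(1,2), of k 0]
        unfolding e by auto
    qed
    have "alpha n i k (hop p (p - int n * m) ?v) = psi_plus p (alpha n i k (psi_minus (p - int n * m) ?v))
       + (if i = j then psi_plus (p - int n * k) (psi_minus (p - int n * m) ?v) else 0)"
      using alpha_psi_plus[OF n(1,2), of k "psi_minus (p - int n * m) ?v" p] n p by auto
    then show "alpha n i k (hop p (p - int n * m) ?v) = (if i = j then hop (p - int n * k) (p - int n * m) ?v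
        - hop p (p - int n * (m - k)) ?v else 0)"
      unfolding 1 by (simp add: lin_uminus[OF lin_psi_plus])
  qed
  also have "\<dots> = (if i = j then (\<Sum>p\<in>?P. hop (p - int n * k) (p - int n * m) ?v)
      - (\<Sum>p\<in>?P. hop p (p - int n * (m - k)) ?v) else 0)"
    by (simp add: sum_subtractf)
  also have "\<dots> = scl (if i = j \<and> k = m then of_int k else 0) ?v"
  proof (cases "k = m")
    case True
    have a: "hop (p - int n * k) (p - int n * m) ?v = ?v" if "p \<in> ?P" for p
      using that True by (auto simp: psi_minus_ev psi_plus_scl psi_plus_ev sg_remove insert_absorb)
    have b: "hop p (p - int n * (m - k)) ?v = 0" if "p \<in> ?P" for p
      using that True by (auto simp: psi_minus_ev)
    have "(\<Sum>p\<in>?P. hop (p - int n * k) (p - int n * m) ?v) = (\<Sum>p\<in>?P. ?v)"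
      using a by (rule sum.cong[OF refl])
    moreover have "(\<Sum>p\<in>?P. hop p (p - int n * (m - k)) ?v) = 0" using b by (intro sum.neutral) blast
    moreover have "card ?P = nat m" using card_residue_interval[OF n(1,3), of m] n by simp
    ultimately show ?thesis using True n by (simp add: sum_scl_of_nat del: sum_constant)
  next
    case False
    let ?R = "{p. colour n p = j \<and> 0 < p \<and> p \<le> int n * (m - k)}"
    have "int n * (m - k) \<noteq> 0" using False n by simp
    then have "p \<noteq> p - int n * (m - k)" for p by linarith
    then have z: "hop p (p - int n * (m - k)) ?v = 0" if "\<not> (0 < p \<and> p \<le> int n * (m - k))" for p
      using that by (auto simp: hop_ev)
    have sub: "?R \<subseteq> ?P" using nm by (auto simp: algebra_simps)
    have A: "(\<Sum>p\<in>?P. hop p (p - int n * (m - k)) ?v) = (\<Sum>p\<in>?R. hop p (p - int n * (m - k)) ?v)"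
      using z by (intro sum.mono_neutral_right[OF fin sub]) auto
    let ?P' = "(\<lambda>p. p - int n * k) ` ?P"
    have "(\<Sum>p\<in>?P. hop (p - int n * k) (p - int n * m) ?v) = (\<Sum>p\<in>?P'. hop p (p - int n * (m - k)) ?v)"
      by (subst sum.reindex) (auto simp: inj_on_def algebra_simps)
    also have "\<dots> = (\<Sum>p\<in>?R. hop p (p - int n * (m - k)) ?v)"
    proof (rule sum.mono_neutral_right)
      show "?R \<subseteq> ?P'"
      proof
        fix p assume "p \<in> ?R"
        then have "p + int n * k \<in> ?P" using nm by (auto simp: algebra_simps)
        then have "(p + int n * k) - int n * k \<in> ?P'" by (rule imageI)
        then show "p \<in> ?P'" by simp
      qed
      show "\<forall>p\<in>?P' - ?R. hop p (p - int n * (m - k)) ?v = 0"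
        using z by auto
    qed (use fin in simp)
    finally show ?thesis using A False by simp
  qed
  finally show ?thesis .
qed

text \<open>The shifts by which the two currents act on fermions commute, so the commutator commutes
  with every fermion and is a scalar, read off at the vacuum.\<close>

lemma alpha_commutator:
  assumes n: "n \<ge> 1" "i \<in> {1..n}" "j \<in> {1..n}" "k > 0" "m > 0" and f: "fockv f"
  shows "alpha n i k (alpha n j (- m) f) = alpha n j (- m) (alpha n i k f)
     + scl (if i = j \<and> k = m then of_int k else 0) f"
proof -
  let ?Z = "\<lambda>f. alpha n i k (alpha n j (- m) f) - alpha n j (- m) (alpha n i k f)"
  have kz: "k \<noteq> 0" "- m \<noteq> 0" using n by auto
  note la = lin_alpha[OF n(1,2) kz(1)] lin_alpha[OF n(1,3) kz(2)]
  have "?Z f = scl (if i = j \<and> k = m then of_int k else 0) f"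
  proof (rule commuting_scalar[where c = 0 and Z = ?Z])
    show "lin ?Z" by (intro lin_minus lin_compose[OF la(1) la(2)] lin_compose[OF la(2) la(1)])
    show "fockv f" by fact
    show "?Z (ev {..0}) = scl (if i = j \<and> k = m then of_int k else 0) (ev {..0})"
      using alpha_commutator_vac[OF n] alpha_sea[OF n(1,2,4)] lin_0[OF la(2)] by simp
  next
    fix r and f :: "int set \<Rightarrow> complex" assume f: "fockv f"
    note f1 = lin_fockv[OF la(1) f] lin_fockv[OF la(2) f] f
    note P1 = alpha_psi_plus[OF n(1,2) kz(1)] and P2 = alpha_psi_plus[OF n(1,3) kz(2)]
    note M1 = alpha_psi_minus[OF n(1,2) kz(1)] and M2 = alpha_psi_minus[OF n(1,3) kz(2)]
    have c: "colour n (r - int n * k) = colour n r" "colour n (r + int n * m) = colour n r" by simp_all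
    show "?Z (psi_plus r f) = psi_plus r (?Z f)"
      using f1 n c
      by (simp add: P1 P2 lin_add[OF la(1)] lin_add[OF la(2)] lin_diff[OF lin_psi_plus]
          lin_0[OF la(1)] lin_0[OF la(2)] c algebra_simps del: colour_add)
    have c: "colour n (r - int n * m) = colour n r" "colour n (r + int n * k) = colour n r" by simp_all
    show "?Z (psi_minus r f) = psi_minus r (?Z f)"
      using f1 n c
      by (simp add: M1 M2 lin_diff[OF la(1)] lin_diff[OF la(2)] lin_diff[OF lin_psi_minus]
          lin_0[OF la(1)] lin_0[OF la(2)] c algebra_simps del: colour_add)
  qed
  then show ?thesis by (simp add: algebra_simps)
qed

section \<open>Energy\<close>

text \<open>For each colour, the pairs of a particle and a lower hole correspond to the boxes of the
  partition that the Maya diagram of this colour encodes.\<close>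

definition boxes :: "nat \<Rightarrow> int set \<Rightarrow> (int \<times> int) set" where
  "boxes n S = {(s, h). s \<in> S \<and> h \<notin> S \<and> h < s \<and> colour n s = colour n h}"

text \<open>The total size of the partitions of the \<open>n\<close> coloured components.\<close>
definition en :: "nat \<Rightarrow> int set \<Rightarrow> nat" where
  "en n S = card (boxes n S)"

lemma maya_bounds:
  assumes "maya S" obtains L where "L > 0" "{..- L} \<subseteq> S" "S \<subseteq> {..L}"
proof -
  obtain a b where ab: "{..a} \<subseteq> S" "S \<subseteq> {..b}" using assms by (auto simp: maya_def)
  show ?thesis
  proof (rule that[of "\<bar>a\<bar> + \<bar>b\<bar> + 1"])
    show "{..- (\<bar>a\<bar> + \<bar>b\<bar> + 1)} \<subseteq> S" using ab(1) by (auto simp: subset_iff)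
    show "S \<subseteq> {..\<bar>a\<bar> + \<bar>b\<bar> + 1}" using ab(2) by (force simp: subset_iff)
  qed simp
qed

lemma finite_boxes: assumes "maya S" shows "finite (boxes n S)"
proof -
  obtain L where L: "L > 0" "{..- L} \<subseteq> S" "S \<subseteq> {..L}" using maya_bounds[OF assms] .
  have "boxes n S \<subseteq> {- L..L} \<times> {- L..L}"
  proof
    fix z assume "z \<in> boxes n S"
    then obtain s h where z: "z = (s, h)" "s \<in> S" "h \<notin> S" "h < s" by (auto simp: boxes_def)
    then have "s \<le> L" "\<not> h \<le> - L" using L by auto
    then show "z \<in> {- L..L} \<times> {- L..L}" using z by auto
  qed
  then show ?thesis by (rule finite_subset) simp
qed

lemma quad_swap:
  assumes f: "fockv f"
  shows "psi_plus d (psi_plus c (psi_minus b (psi_minus a f))) = - psi_plus c (psi_plus d (psi_minus b (psi_minus a f)))"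
    "psi_plus d (psi_plus c (psi_minus b (psi_minus a f))) = - psi_plus d (psi_plus c (psi_minus a (psi_minus b f)))"
  using f by (auto simp: psi_plus_plus[of _ d c] psi_minus_minus[of _ b a] lin_uminus[OF lin_psi_plus])

lemma hop_hop:
  assumes f: "fockv f" and "b \<noteq> c"
  shows "hop d b (hop c a f) = - psi_plus d (psi_plus c (psi_minus b (psi_minus a f)))"
proof -
  have "psi_minus b (psi_plus c (psi_minus a f)) = - psi_plus c (psi_minus b (psi_minus a f))"
    using psi_plus_minus[of "psi_minus a f" c b] f assms(2) by simp
  then show ?thesis using f by (simp add: lin_uminus[OF lin_psi_plus])
qed

text \<open>Two moves, from a to c and from b to d, change sign when their targets are exchanged and
  also when their sources are exchanged. These are the two forms of the cancellation in
  \<open>energy_identity\<close>.\<close>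

lemma hop_hop_swap:
  assumes f: "fockv f" and "b \<noteq> c"
  shows "b \<noteq> d \<Longrightarrow> hop c b (hop d a f) = - hop d b (hop c a f)"
    "a \<noteq> c \<Longrightarrow> hop d a (hop c b f) = - hop d b (hop c a f)"
  using f assms(2) quad_swap[OF f, of d c b a] by (simp_all add: hop_hop)

lemma hop_back:
  assumes "maya S" "a \<in> S" "c \<notin> S"
  shows "hop a c (hop c a (ev S)) = ev S"
proof -
  have ac: "a \<noteq> c" using assms by blast
  have 1: "hop c a (ev S) = scl (sg S a * sg (S - {a}) c) (ev (insert c (S - {a})))"
    using hop_ev[OF assms(1), of c a] ac assms by auto
  have 2: "insert a (insert c (S - {a}) - {c}) = S" "insert c (S - {a}) - {c} = S - {a}"
    using assms ac by auto
  have 3: "hop a c (ev (insert c (S - {a}))) = scl (sg (insert c (S - {a})) c * sg (S - {a}) a) (ev S)"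
    using hop_ev[of "insert c (S - {a})" a c] ac assms 2 by auto
  have 4: "sg (insert c (S - {a})) c = sg (S - {a}) c" "sg (S - {a}) a = sg S a"
    using assms ac by (auto simp: sg_insert sg_remove)
  show ?thesis unfolding 1 psi_plus_scl psi_minus_scl 3 4 by (simp add: mult.assoc mult.left_commute)
qed

text \<open>Expanded, each summand moves c + n k to c and then d - n k to d. If the second move
  undoes the first, the wedge returns unchanged, and this happens once for each box. All other terms
  cancel in pairs.\<close>

lemma energy_identity:
  assumes n: "n \<ge> 1" and S: "maya S"
  obtains K :: int where "K \<ge> 0" "\<And>K'. K' \<ge> K \<Longrightarrow>
    (\<Sum>k\<in>{1..K'}. \<Sum>j\<in>{1..n}. alpha n j (- k) (alpha n j k (ev S))) = scl (of_nat (en n S)) (ev S)"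
proof -
  obtain L where L: "L > 0" "{..- L} \<subseteq> S" "S \<subseteq> {..L}" using maya_bounds[OF S] .
  \<comment> \<open>A nonzero term has its hole c above - L and its particle c + n k at most L,
    hence k < 2 L.\<close>
  have "(\<Sum>k\<in>{1..K}. \<Sum>j\<in>{1..n}. alpha n j (- k) (alpha n j k (ev S))) = scl (of_nat (en n S)) (ev S)"
    if K: "K \<ge> 2 * L" for K
  proof -
    define I where "I = {- L..L + int n * K}"
    define t where "t k c d = hop d (d - int n * k) (hop c (c + int n * k) (ev S))" for k c d
    have nk: "int n * k \<ge> k" "int n * k > 0" if "k \<ge> 1" for k
      using n that by (simp_all add: mult_le_cancel_right1)
    have inS: "p \<notin> S \<Longrightarrow> p > - L" "p \<in> S \<Longrightarrow> p \<le> L" for p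
      using L by (auto simp: subset_iff not_le[symmetric])
    have hop1: "c + int n * k \<in> S \<and> c \<notin> S" if "hop c (c + int n * k) (ev S) \<noteq> 0" "k \<ge> 1" for c k
      using that nk(2)[of k] hop_ev_zero[OF S, of c "c + int n * k"] by fastforce
    have tnz: "c + int n * k \<in> S \<and> c \<notin> S \<and> (d - int n * k \<in> S - {c + int n * k} \<or> d - int n * k = c)
        \<and> d \<notin> insert c (S - {c + int n * k})"
      if "t k c d \<noteq> 0" "k \<ge> 1" for k c d
    proof -
      have 1: "c + int n * k \<in> S \<and> c \<notin> S"
        using that hop1[of c k] unfolding t_def by (cases "hop c (c + int n * k) (ev S) = 0") auto
      let ?S' = "insert c (S - {c + int n * k})"
      have "t k c d = scl (sg S (c + int n * k) * sg (S - {c + int n * k}) c) (hop d (d - int n * k) (ev ?S'))"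
        unfolding t_def using 1 nk(2)[of k] that S
        by (subst hop_ev[OF S]) (auto simp: psi_plus_scl psi_minus_scl)
      moreover have "d \<noteq> d - int n * k" using nk(2)[of k] that by auto
      ultimately have "d - int n * k \<in> ?S' \<and> d \<notin> ?S'"
        using that S hop_ev[of ?S' d "d - int n * k"] by (auto split: if_splits)
      then show ?thesis using 1 by auto
    qed
    have range: "k \<le> K \<and> c \<in> I \<and> d \<in> I" if "t k c d \<noteq> 0" "k \<ge> 1" for k c d
    proof -
      note z = tnz[OF that]
      have c: "c + int n * k \<le> L" "c > - L" using z inS(2)[of "c + int n * k"] inS(1)[of c] by simp_all
      have "d > - L" using z inS(1)[of d] c nk[OF that(2)] by (cases "d = c + int n * k") auto
      moreover have "d - int n * k \<le> L" using z inS(2)[of "d - int n * k"] c nk[OF that(2)] by auto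
      moreover have kK: "k \<le> K" using c nk[OF that(2)] K by linarith
      moreover have "int n * k \<le> int n * K" using kK by (intro mult_left_mono) auto
      ultimately show ?thesis using c nk[OF that(2)] unfolding I_def by auto
    qed
    have A1: "alpha n j k (ev S) = (\<Sum>c\<in>{c\<in>I. colour n c = j}. hop c (c + int n * k) (ev S))"
      if "k \<in> {1..K}" "j \<in> {1..n}" for k j
    proof (rule alpha_sum[OF n that(2)])
      show "hops n j k (ev S) \<subseteq> I"
      proof
        fix c assume "c \<in> hops n j k (ev S)"
        then have c: "c + int n * k \<in> S" "c \<notin> S" using hop1[of c k] that by (auto simp: hops_def)
        then have "c > - L" "c + int n * k \<le> L" using inS(2)[of "c + int n * k"] inS(1)[of c] by simp_all
        moreover have "int n * k > 0" "int n * K > 0" using nk(2)[of k] nk(2)[of K] that by simp_all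
          ultimately show "c \<in> I" unfolding I_def atLeastAtMost_iff by linarith
      qed
    qed (simp add: I_def)
    have A2: "alpha n j (- k) (alpha n j k (ev S)) =
        (\<Sum>c\<in>{c\<in>I. colour n c = j}. \<Sum>d\<in>{d\<in>I. colour n d = j}. t k c d)"
      if k: "k \<in> {1..K}" "j \<in> {1..n}" for k j
    proof -
      have "- k \<noteq> 0" using k by auto
      then have "alpha n j (- k) (alpha n j k (ev S)) =
          (\<Sum>c\<in>{c\<in>I. colour n c = j}. alpha n j (- k) (hop c (c + int n * k) (ev S)))"
        unfolding A1[OF k] using S by (intro lin_sum[OF lin_alpha[OF n k(2)]]) auto
      also have "\<dots> = (\<Sum>c\<in>{c\<in>I. colour n c = j}. \<Sum>d\<in>{d\<in>I. colour n d = j}. t k c d)"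
      proof (rule sum.cong[OF refl])
        fix c
        have "alpha n j (- k) (hop c (c + int n * k) (ev S)) =
          (\<Sum>d\<in>{d\<in>I. colour n d = j}. hop d (d + int n * (- k)) (hop c (c + int n * k) (ev S)))"
        proof (rule alpha_sum[OF n k(2)])
          show "hops n j (- k) (hop c (c + int n * k) (ev S)) \<subseteq> I"
            using range[of k c] k unfolding hops_def t_def by auto
        qed (simp add: I_def)
        then show "alpha n j (- k) (hop c (c + int n * k) (ev S)) = (\<Sum>d\<in>{d\<in>I. colour n d = j}. t k c d)"
          unfolding t_def by simp
      qed
      finally show ?thesis .
    qed
    define \<Omega> where "\<Omega> = (SIGMA k:{1..K}. SIGMA c:I. {d\<in>I. colour n d = colour n c})"
    define T where "T = (\<lambda>(k, c, d). t k c d)"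
    have finI: "finite I" by (simp add: I_def)
    then have fin\<Omega>: "finite \<Omega>" unfolding \<Omega>_def by (intro finite_SigmaI) auto
    have "(\<Sum>k\<in>{1..K}. \<Sum>j\<in>{1..n}. alpha n j (- k) (alpha n j k (ev S))) =
      (\<Sum>k\<in>{1..K}. \<Sum>c\<in>I. \<Sum>d\<in>{d\<in>I. colour n d = colour n c}. t k c d)"
    proof (rule sum.cong[OF refl])
      fix k assume k: "k \<in> {1..K}"
      have "(\<Sum>j\<in>{1..n}. alpha n j (- k) (alpha n j k (ev S))) =
         (\<Sum>j\<in>{1..n}. \<Sum>c\<in>{c\<in>I. colour n c = j}. \<Sum>d\<in>{d\<in>I. colour n d = colour n c}. t k c d)"
        using A2[OF k] by (intro sum.cong) (auto intro!: sum.cong)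
      also have "\<dots> = (\<Sum>c\<in>I. \<Sum>d\<in>{d\<in>I. colour n d = colour n c}. t k c d)"
        using colour_range[OF n] by (intro sum.group) (auto simp: I_def)
      finally show "(\<Sum>j\<in>{1..n}. alpha n j (- k) (alpha n j k (ev S))) =
        (\<Sum>c\<in>I. \<Sum>d\<in>{d\<in>I. colour n d = colour n c}. t k c d)" .
    qed
    also have "\<dots> = sum T \<Omega>"
      unfolding \<Omega>_def T_def using finI by (simp add: sum.Sigma split_def)
    also have "\<dots> = scl (of_nat (en n S)) (ev S)"
    proof -
      \<comment> \<open>\<open>D\<close> collects the returning moves, \<open>R\<close> the
        remaining ones.\<close>
      define D where "D = {(k, c, d). (k, c, d) \<in> \<Omega> \<and> d = c + int n * k \<and> t k c d \<noteq> 0}"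
      define R where "R = {(k, c, d). (k, c, d) \<in> \<Omega> \<and> d \<noteq> c + int n * k \<and> t k c d \<noteq> 0}"
      have DR: "finite D" "finite R" "D \<inter> R = {}" "D \<union> R \<subseteq> \<Omega>"
        using fin\<Omega> by (auto simp: D_def R_def elim!: rev_finite_subset)
      have "sum T \<Omega> = sum T (D \<union> R)"
        by (rule sum.mono_neutral_right[OF fin\<Omega> DR(4)]) (auto simp: D_def R_def T_def)
      also have "\<dots> = sum T D + sum T R"
        using DR by (intro sum.union_disjoint)
      also have "sum T R = 0"
      proof -
        \<comment> \<open>The sign-reversing involution. With \<delta> the level difference of d and
          c, exchanging the targets gives again a term of the sum, with parameter k - \<delta>, if k
          > \<delta>; otherwise exchanging the sources does, with parameter \<delta> - k. The case k
          = \<delta> is a returning move and does not occur in \<open>R\<close>.\<close>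
        define \<phi> where "\<phi> = (\<lambda>(k, c, d). let \<delta> = lev n d - lev n c in
          if k > \<delta> then (k - \<delta>, d, c) else (\<delta> - k, c, d))"
        have \<phi>: "\<phi> z \<in> R \<and> \<phi> (\<phi> z) = z \<and> T (\<phi> z) = - T z" if "z \<in> R" for z
        proof -
          obtain k c d where z: "z = (k, c, d)" by (cases z)
          define \<delta> where "\<delta> = lev n d - lev n c"
          have r: "k \<ge> 1" "k \<le> K" "colour n d = colour n c" "d \<noteq> c + int n * k" "t k c d \<noteq> 0"
            using that by (auto simp: z R_def \<Omega>_def)
          have d: "d = c + int n * \<delta>"
            using colour_lev[OF n, of c] colour_lev[OF n, of d] r(3) by (simp add: \<delta>_def algebra_simps)
          have ne: "k \<noteq> \<delta>" using r d by auto
          have nz: "- f \<noteq> 0 \<longleftrightarrow> f \<noteq> (0 :: int set \<Rightarrow> complex)" for f by (simp add: neg_equal_0_iff_equal)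
          show ?thesis
          proof (cases "k > \<delta>")
            case True
            have e: "\<phi> z = (k - \<delta>, d, c)" using True by (simp add: \<phi>_def z \<delta>_def)
            have "\<phi> (\<phi> z) = (k - \<delta> + \<delta>, c, d)" using True r unfolding e by (simp add: \<phi>_def \<delta>_def)
            then have 1: "\<phi> (\<phi> z) = z" by (simp add: z)
            have "c \<noteq> d - int n * k" using r by auto
            moreover have "d - int n * k \<noteq> d" using nk[OF r(1)] by linarith
            ultimately have "hop c (d - int n * k) (hop d (c + int n * k) (ev S)) = - t k c d"
              unfolding t_def using S by (intro hop_hop_swap(1)) auto
            moreover have "t (k - \<delta>) d c = hop c (d - int n * k) (hop d (c + int n * k) (ev S))"
              unfolding t_def d by (simp add: algebra_simps)
            ultimately have 2: "t (k - \<delta>) d c = - t k c d" by simp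
            then have 3: "t (k - \<delta>) d c \<noteq> 0" using r nz by metis
            have "(k - \<delta>, d, c) \<in> \<Omega>" using range[OF 3] True r by (auto simp: \<Omega>_def)
            moreover have "c \<noteq> d + int n * (k - \<delta>)"
            proof -
              have "d + int n * (k - \<delta>) = c + int n * k" unfolding d by (simp add: algebra_simps)
              then show ?thesis using nk[OF r(1)] by linarith
            qed
            ultimately have "\<phi> z \<in> R" unfolding e R_def using 3 by simp
            moreover have "T (\<phi> z) = - T z" using 2 unfolding e by (simp add: T_def z)
            ultimately show ?thesis using 1 by blast
          next
            case False
            have e: "\<phi> z = (\<delta> - k, c, d)" using False by (simp add: \<phi>_def z \<delta>_def)
            have "\<phi> (\<phi> z) = (\<delta> - (\<delta> - k), c, d)" using False r unfolding e by (simp add: \<phi>_def flip: \<delta>_def)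
            then have 1: "\<phi> (\<phi> z) = z" by (simp add: z)
            have "d - int n * k \<noteq> c" using r by auto
            moreover have "c + int n * k \<noteq> c" using nk[OF r(1)] by linarith
            ultimately have "hop d (c + int n * k) (hop c (d - int n * k) (ev S)) = - t k c d"
              unfolding t_def using S by (intro hop_hop_swap(2)) auto
            moreover have "t (\<delta> - k) c d = hop d (c + int n * k) (hop c (d - int n * k) (ev S))"
              unfolding t_def d by (simp add: algebra_simps)
            ultimately have 2: "t (\<delta> - k) c d = - t k c d" by simp
            then have 3: "t (\<delta> - k) c d \<noteq> 0" using r nz by metis
            have "(\<delta> - k, c, d) \<in> \<Omega>" using range[OF 3] False r ne by (auto simp: \<Omega>_def)
            moreover have "d \<noteq> c + int n * (\<delta> - k)"
            proof -
              have "c + int n * (\<delta> - k) = d - int n * k" unfolding d by (simp add: algebra_simps)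
              then show ?thesis using nk[OF r(1)] by linarith
            qed
            ultimately have "\<phi> z \<in> R" unfolding e R_def using 3 by simp
            moreover have "T (\<phi> z) = - T z" using 2 unfolding e by (simp add: T_def z)
            ultimately show ?thesis using 1 by blast
          qed
        qed
        have "sum T R = (\<Sum>z\<in>R. - T z)"
          by (rule sum.reindex_bij_witness[where i = \<phi> and j = \<phi>]) (use \<phi> in auto)
        then have eq: "sum T R = - sum T R" unfolding sum_negf .
        have "sum T R x = 0" for x using fun_cong[OF eq, of x] by (simp add: eq_neg_iff_add_eq_0)
        then show "sum T R = 0" by (simp add: fun_eq_iff)
      qed
      also have "sum T D = scl (of_nat (card D)) (ev S)"
      proof -
        have "T z = ev S" if "z \<in> D" for z
        proof -
          obtain k c d where z: "z = (k, c, d)" by (cases z)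
          have r: "k \<ge> 1" "d = c + int n * k" "t k c d \<noteq> 0"
            using that by (auto simp: z D_def \<Omega>_def)
          have "c + int n * k \<in> S" "c \<notin> S" using tnz[OF r(3,1)] by auto
          then show ?thesis using nk[OF r(1)] unfolding z T_def t_def r(2) by (simp add: hop_back S)
        qed
        then show ?thesis by (simp add: sum_scl_of_nat[symmetric] del: sum_constant)
      qed
      also have "card D = en n S"
        unfolding en_def
      proof (rule bij_betw_same_card[of "\<lambda>(k, c, d). (d, c)"], rule bij_betw_byWitness[where f' = "\<lambda>(s, h). (lev n s - lev n h, h, s)"])
        show "\<forall>z\<in>D. (\<lambda>(s, h). (lev n s - lev n h, h, s)) ((\<lambda>(k, c, d). (d, c)) z) = z"
          using lev_add[OF n] by (auto simp: D_def)
        show "\<forall>z\<in>boxes n S. (\<lambda>(k, c, d). (d, c)) ((\<lambda>(s, h). (lev n s - lev n h, h, s)) z) = z" by auto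
        show "(\<lambda>(k, c, d). (d, c)) ` D \<subseteq> boxes n S"
        proof -
          have "(d, c) \<in> boxes n S" if "(k, c, d) \<in> D" for k c d
          proof -
            have r: "k \<ge> 1" "d = c + int n * k" "t k c d \<noteq> 0" "colour n d = colour n c"
              using that by (auto simp: D_def \<Omega>_def)
            have "c + int n * k \<in> S" "c \<notin> S" using tnz[OF r(3,1)] by auto
            then show ?thesis using nk[OF r(1)] r by (auto simp: boxes_def)
          qed
          then show ?thesis by auto
        qed
        show "(\<lambda>(s, h). (lev n s - lev n h, h, s)) ` boxes n S \<subseteq> D"
        proof -
          have "(lev n s - lev n h, h, s) \<in> D" if b: "(s, h) \<in> boxes n S" for s h
          proof -
            define k where "k = lev n s - lev n h"
            have b': "s \<in> S" "h \<notin> S" "h < s" "colour n s = colour n h" using b by (auto simp: boxes_def)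
            have s: "s = h + int n * k"
              using colour_lev[OF n, of s] colour_lev[OF n, of h] b' by (simp add: k_def algebra_simps)
            then have "int n * k > 0" using b' by simp
            then have k: "k \<ge> 1" by (simp add: zero_less_mult_iff)
            have "t k h s \<noteq> 0"
            proof -
              have "t k h s = ev S" using S b' unfolding t_def s by (simp add: hop_back)
              then show ?thesis by (metis ev_def zero_fun_apply zero_neq_one)
            qed
            then have "(k, h, s) \<in> D" using range[of k h s] k s b' by (auto simp: D_def \<Omega>_def)
            then show ?thesis by (simp add: k_def)
          qed
          then show ?thesis by auto
        qed
      qed
      finally show ?thesis by (simp only: add_0_right)
    qed
    finally show ?thesis .
  qed
  then show ?thesis using that[of "2 * L"] L by auto
qed

section \<open>Energy and charge under colour-preserving moves\<close>

lemma le_div_iff: "n \<ge> 1 \<Longrightarrow> k \<le> x div int n \<longleftrightarrow> int n * k \<le> x"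
proof
  assume n: "n \<ge> 1" and "k \<le> x div int n"
  then have "int n * k \<le> int n * (x div int n)" by (intro mult_left_mono) auto
  also have "\<dots> \<le> x" using n by (simp add: mult_div_mod_eq[symmetric] minus_mod_eq_mult_div[symmetric])
  finally show "int n * k \<le> x" .
next
  assume n: "n \<ge> 1" and "int n * k \<le> x"
  then have "(int n * k) div int n \<le> x div int n" by (intro zdiv_mono1) auto
  then show "k \<le> x div int n" using n by simp
qed

lemma card_lower_residues:
  assumes n: "n \<ge> 1" and "c < s"
  shows "finite {h. c < h \<and> h < s \<and> colour n s = colour n h}"
    and "int (card {h. c < h \<and> h < s \<and> colour n s = colour n h}) = (s - c - 1) div int n"
proof -
  let ?m = "(s - c - 1) div int n"
  have m: "?m \<ge> 0" using assms by (simp add: pos_imp_zdiv_nonneg_iff)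
  have eq: "{h. c < h \<and> h < s \<and> colour n s = colour n h} = (\<lambda>k. s - int n * k) ` {1..?m}"
  proof (intro Set.set_eqI iffI)
    fix h assume h: "h \<in> {h. c < h \<and> h < s \<and> colour n s = colour n h}"
    then obtain k where k: "s = h + int n * k" using same_colour[OF n, of h s] by auto
    then have "int n * k > 0" using h by auto
    then have "k \<ge> 1" by (simp add: zero_less_mult_iff)
    moreover have "int n * k \<le> s - c - 1" using h k by auto
    then have "k \<le> ?m" using n by (simp add: le_div_iff)
    ultimately show "h \<in> (\<lambda>k. s - int n * k) ` {1..?m}" using k by force
  next
    fix h assume "h \<in> (\<lambda>k. s - int n * k) ` {1..?m}"
    then obtain k where k: "1 \<le> k" "k \<le> ?m" "h = s - int n * k" by auto
    have "int n * k \<le> s - c - 1" using k n by (simp add: le_div_iff)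
    moreover have "int n * k > 0" using n k by simp
    ultimately show "h \<in> {h. c < h \<and> h < s \<and> colour n s = colour n h}" using k by auto
  qed
  moreover have "inj_on (\<lambda>k. s - int n * k) {1..?m}" using n by (auto simp: inj_on_def)
  ultimately show "finite {h. c < h \<and> h < s \<and> colour n s = colour n h}"
    "int (card {h. c < h \<and> h < s \<and> colour n s = colour n h}) = ?m"
    using m by (simp_all add: card_image)
qed

text \<open>A particle s above c has (s - c - 1) div n labels of its colour strictly between c and
  s. Each of these is a hole, giving a box, or a particle, giving a pair; the right-hand side
  depends on the particles one at a time.\<close>

lemma en_plus_pairs:
  assumes n: "n \<ge> 1" and S: "maya S" "{..c} \<subseteq> S"
  defines "A \<equiv> S \<inter> {c<..}"
  shows "int (en n S) + int (card {(s, h). s \<in> A \<and> h \<in> A \<and> h < s \<and> colour n s = colour n h})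
    = (\<Sum>s\<in>A. (s - c - 1) div int n)"
proof -
  have fA: "finite A" using maya_finite_above[OF S(1), of c] unfolding A_def
    by (rule rev_finite_subset) auto
  let ?B = "\<lambda>s. {h. c < h \<and> h < s \<and> colour n s = colour n h}"
  let ?K = "{(s, h). s \<in> A \<and> h \<in> A \<and> h < s \<and> colour n s = colour n h}"
  have "boxes n S \<union> ?K = Sigma A ?B"
  proof -
    have hc: "c < h" if "h \<notin> S" for h using S(2) that by (meson atMost_iff not_le subsetD)
    have "(s, h) \<in> boxes n S \<union> ?K \<longleftrightarrow> (s, h) \<in> Sigma A ?B" for s h
      using hc[of h] unfolding boxes_def A_def by (cases "h \<in> S") auto
    then show ?thesis unfolding set_eq_iff split_paired_All by blast
  qed
  moreover have "boxes n S \<inter> ?K = {}" by (auto simp: boxes_def A_def)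
  moreover have "finite ?K" by (rule finite_subset[of _ "A \<times> A"]) (use fA in auto)
  ultimately have "en n S + card ?K = card (Sigma A ?B)"
    using finite_boxes[OF S(1), of n] card_Un_disjoint[of "boxes n S" ?K] unfolding en_def by simp
  also have "\<dots> = (\<Sum>s\<in>A. card (?B s))"
    using fA card_lower_residues[OF n, of c] by (intro card_SigmaI) (auto simp: A_def)
  finally have "int (en n S) + int (card ?K) = (\<Sum>s\<in>A. int (card (?B s)))"
    by (simp flip: of_nat_add of_nat_sum)
  also have "\<dots> = (\<Sum>s\<in>A. (s - c - 1) div int n)"
    using card_lower_residues[OF n, of c] by (intro sum.cong) (auto simp: A_def)
  finally show ?thesis .
qed

text \<open>A colour-preserving bijection need not be monotone; the number of pairs taken without
  regard to order is a quantity that it does preserve.\<close>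

lemma card_ordered_pairs:
  fixes A :: "int set"
  assumes "finite A"
  shows "card {(s, h). s \<in> A \<and> h \<in> A \<and> colour n s = colour n h} =
    2 * card {(s, h). s \<in> A \<and> h \<in> A \<and> h < s \<and> colour n s = colour n h} + card A"
proof -
  let ?K = "{(s, h). s \<in> A \<and> h \<in> A \<and> h < s \<and> colour n s = colour n h}"
  let ?K' = "prod.swap ` ?K"
  let ?D = "(\<lambda>s. (s, s)) ` A"
  have fin: "finite ?K" by (rule finite_subset[of _ "A \<times> A"]) (use assms in auto)
  have "{(s, h). s \<in> A \<and> h \<in> A \<and> colour n s = colour n h} = (?K \<union> ?K') \<union> ?D"
  proof (intro Set.set_eqI iffI)
    fix z assume "z \<in> {(s, h). s \<in> A \<and> h \<in> A \<and> colour n s = colour n h}"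
    then obtain s h where z: "z = (s, h)" "s \<in> A" "h \<in> A" "colour n s = colour n h" by auto
    consider "h < s" | "s < h" | "s = h" by linarith
    then show "z \<in> (?K \<union> ?K') \<union> ?D"
    proof cases
      case 2
      then have "prod.swap (h, s) \<in> ?K'" using z by (intro imageI) auto
      then show ?thesis using z by simp
    qed (use z in auto)
  qed auto
  moreover have "card ?K' = card ?K" by (intro card_image) (auto simp: inj_on_def)
  moreover have "card ?D = card A" by (intro card_image) (auto simp: inj_on_def)
  moreover have "card ((?K \<union> ?K') \<union> ?D) = card (?K \<union> ?K') + card ?D"
    using fin assms by (intro card_Un_disjoint) auto
  moreover have "card (?K \<union> ?K') = card ?K + card ?K'"
    using fin by (intro card_Un_disjoint) auto
  ultimately show ?thesis by simp
qed

text \<open>The matching is colour by colour, so the pair counts of the previous two lemmas cancel.\<close>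
lemma en_bij:
  assumes n: "n \<ge> 1" and S: "maya S" "{..c} \<subseteq> S" and S': "maya S'" "{..c} \<subseteq> S'"
    and \<phi>: "bij_betw \<phi> (S \<inter> {c<..}) (S' \<inter> {c<..})"
    and col: "\<And>s. s \<in> S \<inter> {c<..} \<Longrightarrow> colour n (\<phi> s) = colour n s"
  shows "int (en n S') - int (en n S) = (\<Sum>s\<in>S \<inter> {c<..}. lev n (\<phi> s) - lev n s)"
proof -
  let ?A = "S \<inter> {c<..}" and ?A' = "S' \<inter> {c<..}"
  have fin: "finite ?A" "finite ?A'"
    using maya_finite_above[OF S(1), of c] maya_finite_above[OF S'(1), of c]
    by (simp_all add: Int_def)
  let ?P = "\<lambda>A. {(s, h). s \<in> A \<and> h \<in> A \<and> colour n s = colour n h}"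
  let ?K = "\<lambda>A. {(s, h). s \<in> A \<and> h \<in> A \<and> h < s \<and> colour n s = colour n h}"
  have "bij_betw (map_prod \<phi> \<phi>) (?P ?A) (?P ?A')"
  proof (rule bij_betw_imageI)
    have inj: "inj_on \<phi> ?A" using \<phi> by (simp add: bij_betw_def)
    show "inj_on (map_prod \<phi> \<phi>) (?P ?A)"
      by (rule inj_on_subset[OF map_prod_inj_on[OF inj inj]]) auto
    have im: "\<phi> ` ?A = ?A'" using \<phi> by (simp add: bij_betw_def)
    show "map_prod \<phi> \<phi> ` ?P ?A = ?P ?A'"
    proof (intro Set.set_eqI iffI)
      fix z assume "z \<in> map_prod \<phi> \<phi> ` ?P ?A"
      then show "z \<in> ?P ?A'" using col im by auto
    next
      fix z assume "z \<in> ?P ?A'"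
      then obtain s h where z: "z = (s, h)" "s \<in> ?A'" "h \<in> ?A'" "colour n s = colour n h" by auto
      then obtain a b where ab: "s = \<phi> a" "h = \<phi> b" "a \<in> ?A" "b \<in> ?A" unfolding im[symmetric] by blast
      then have "(a, b) \<in> ?P ?A" using z(4) col[of a] col[of b] by auto
      then have "map_prod \<phi> \<phi> (a, b) \<in> map_prod \<phi> \<phi> ` ?P ?A" by (rule imageI)
      then show "z \<in> map_prod \<phi> \<phi> ` ?P ?A" using z ab by simp
    qed
  qed
  then have "card (?P ?A) = card (?P ?A')" by (rule bij_betw_same_card)
  moreover have "card ?A = card ?A'" using \<phi> by (rule bij_betw_same_card)
  ultimately have K: "card (?K ?A) = card (?K ?A')"
    using card_ordered_pairs[OF fin(1), of n] card_ordered_pairs[OF fin(2), of n] by linarith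
  have "(\<Sum>s\<in>?A'. (s - c - 1) div int n) = (\<Sum>s\<in>?A. (\<phi> s - c - 1) div int n)"
    by (rule sum.reindex_bij_betw[OF \<phi>, symmetric])
  also have "\<dots> = (\<Sum>s\<in>?A. (s - c - 1) div int n + (lev n (\<phi> s) - lev n s))"
  proof (rule sum.cong[OF refl])
    fix s assume s: "s \<in> ?A"
    then obtain k where k: "\<phi> s = s + int n * k" using same_colour[OF n, of s "\<phi> s"] col[OF s] by auto
    have "(s - c - 1 + int n * k) div int n = (s - c - 1) div int n + k" using n by simp
    then show "(\<phi> s - c - 1) div int n = (s - c - 1) div int n + (lev n (\<phi> s) - lev n s)"
      using k lev_add[OF n, of s k] by (simp add: algebra_simps)
  qed
  finally have "(\<Sum>s\<in>?A'. (s - c - 1) div int n) = (\<Sum>s\<in>?A. (s - c - 1) div int n) +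
      (\<Sum>s\<in>?A. lev n (\<phi> s) - lev n s)" by (simp add: sum.distrib)
  then show ?thesis using en_plus_pairs[OF n S] en_plus_pairs[OF n S'] K by linarith
qed

lemma top_move_bij:
  assumes "p \<in> S" "q \<notin> S" "c < p" "c < q"
  shows "bij_betw (\<lambda>s. if s = p then q else s) (S \<inter> {c<..}) (insert q (S - {p}) \<inter> {c<..})"
  by (rule bij_betw_byWitness[where f' = "\<lambda>s. if s = q then p else s"]) (use assms in auto)

lemma maya_common_bound:
  assumes "maya S" "maya S'"
  obtains c where "{..c} \<subseteq> S" "{..c} \<subseteq> S'" "c < a" "c < b" "c < 0"
proof -
  obtain d d' where d: "{..d} \<subseteq> S" "{..d'} \<subseteq> S'" using assms by (auto simp: maya_def)
  show ?thesis
    by (rule that[of "min (min d d') (min (min a b) 0 - 1)"]) (use d in \<open>auto simp: subset_iff\<close>)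
qed

lemma en_move:
  assumes n: "n \<ge> 1" and S: "maya S" "p \<in> S" "q \<notin> S" and pq: "p = q + int n * k"
  shows "int (en n (insert q (S - {p}))) = int (en n S) - k"
proof -
  let ?S' = "insert q (S - {p})"
  have m: "maya ?S'" using S by simp
  obtain c where c: "{..c} \<subseteq> S" "{..c} \<subseteq> ?S'" "c < p" "c < q" using maya_common_bound[OF S(1) m] .
  let ?\<phi> = "\<lambda>s. if s = p then q else s"
  have "int (en n ?S') - int (en n S) = (\<Sum>s\<in>S \<inter> {c<..}. lev n (?\<phi> s) - lev n s)"
    by (rule en_bij[OF n S(1) c(1) m c(2) top_move_bij[OF S(2,3) c(3,4)]]) (auto simp: pq)
  also have "\<dots> = (\<Sum>s\<in>S \<inter> {c<..}. if s = p then lev n q - lev n p else 0)"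
    by (rule sum.cong) auto
  also have "\<dots> = lev n q - lev n p"
  proof -
    have "finite (S \<inter> {c<..})" using maya_finite_above[OF S(1), of c] by (rule rev_finite_subset) auto
    then show ?thesis using S c by simp
  qed
  also have "\<dots> = - k" using lev_add[OF n, of q k] pq by simp
  finally show ?thesis by simp
qed

text \<open>Lowering the reference level from 0 to c below all holes turns the difference of two
  counts into one. In particular, a diagram containing \<open>{..- int M}\<close> has charge 0
  exactly when it has M further labels, the number of rows of a wedge.\<close>

lemma charge_top:
  assumes "maya S" "{..c} \<subseteq> S" "c \<le> 0"
  shows "charge S = int (card (S \<inter> {c<..})) + c"
proof -
  have f: "finite {s\<in>S. s > 0}" "finite {s. s \<le> 0 \<and> s \<notin> S}"
    using maya_finite_above[OF assms(1), of 0] maya_finite_holes[OF assms(1), of 0]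
    by (auto simp: conj_commute)
  have g: "finite {s\<in>S. c < s \<and> s \<le> 0}" by (rule finite_subset[of _ "{c<..0}"]) auto
  have "S \<inter> {c<..} = {s\<in>S. s > 0} \<union> {s\<in>S. c < s \<and> s \<le> 0}" using assms(3) by auto
  then have 1: "card (S \<inter> {c<..}) = card {s\<in>S. s > 0} + card {s\<in>S. c < s \<and> s \<le> 0}"
    using f g by (simp add: card_Un_disjoint disjoint_iff)
  have "{c<..0} = {s. s \<le> 0 \<and> s \<notin> S} \<union> {s\<in>S. c < s \<and> s \<le> 0}"
    using assms(2) by (force simp: subset_iff not_le)
  then have "card {c<..0} = card {s. s \<le> 0 \<and> s \<notin> S} + card {s\<in>S. c < s \<and> s \<le> 0}"
    using f g by (simp add: card_Un_disjoint disjoint_iff)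
  then have "nat (- c) = card {s. s \<le> 0 \<and> s \<notin> S} + card {s\<in>S. c < s \<and> s \<le> 0}" by simp
  then show ?thesis using 1 assms(3) unfolding charge_def by linarith
qed

lemma charge_move:
  assumes "maya S" "p \<in> S" "q \<notin> S"
  shows "charge (insert q (S - {p})) = charge S"
proof -
  let ?S' = "insert q (S - {p})"
  have m: "maya ?S'" using assms by simp
  obtain c where c: "{..c} \<subseteq> S" "{..c} \<subseteq> ?S'" "c < p" "c < q" "c < 0"
    using maya_common_bound[OF assms(1) m] .
  have "card (S \<inter> {c<..}) = card (?S' \<inter> {c<..})"
    using top_move_bij[OF assms(2,3) c(3,4)] by (rule bij_betw_same_card)
  then show ?thesis using charge_top[OF assms(1) c(1)] charge_top[OF m c(2)] c(5) by simp
qed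

lemma alpha_support:
  assumes n: "n \<ge> 1" "j \<in> {1..n}" "k \<noteq> 0" and S: "maya S" and T: "alpha n j k (ev S) T \<noteq> 0"
  obtains p where "p + int n * k \<in> S" "p \<notin> S" "T = insert p (S - {p + int n * k})" "colour n p = j"
proof -
  have "alpha n j k (ev S) T = (\<Sum>p\<in>{p\<in>hops n j k (ev S). colour n p = j}. hop p (p + int n * k) (ev S) T)"
    using alpha_sum[OF n(1,2) finite_hops[OF n(1,3) fockv_ev[OF S], of j] subset_refl]
    by (simp add: sum_fun_apply)
  then obtain p where p: "colour n p = j" "hop p (p + int n * k) (ev S) T \<noteq> 0"
    using T by (metis (mono_tags, lifting) mem_Collect_eq sum.not_neutral_contains_not_neutral)
  have "p \<noteq> p + int n * k" using n by simp
  then have "p + int n * k \<in> S \<and> p \<notin> S \<and> T = insert p (S - {p + int n * k})"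
    using p(2) hop_ev[OF S, of p "p + int n * k"] by (auto simp: ev_def split: if_splits)
  then show ?thesis using that p by blast
qed

lemma alpha_support_en:
  assumes n: "n \<ge> 1" "j \<in> {1..n}" "k \<noteq> 0" and S: "maya S" and T: "alpha n j k (ev S) T \<noteq> 0"
  shows "maya T" "int (en n T) = int (en n S) - k" "charge T = charge S"
proof -
  obtain p where p: "p + int n * k \<in> S" "p \<notin> S" "T = insert p (S - {p + int n * k})"
    using alpha_support[OF assms] .
  show "maya T" "int (en n T) = int (en n S) - k" "charge T = charge S"
    using en_move[OF n(1) S p(1,2) refl] charge_move[OF S p(1,2)] S p(3) by auto
qed

lemma alpha_zero:
  assumes n: "n \<ge> 1" "j \<in> {1..n}" "k > int (en n S)" and S: "maya S"
  shows "alpha n j k (ev S) = 0"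
proof
  fix T show "alpha n j k (ev S) T = 0 T"
    using alpha_support_en(2)[OF n(1,2) _ S, of k T] n(3) by fastforce
qed

lemma F0_alpha:
  assumes n: "n \<ge> 1" "j \<in> {1..n}" "k \<noteq> 0" and f: "F0 f"
  shows "F0 (alpha n j k f)"
proof -
  have fv: "fockv f" using f by (simp add: F0_def)
  have m: "maya S \<and> charge S = 0" if "f S \<noteq> 0" for S using that f by (auto simp: F0_def fockv_def)
  have "alpha n j k f = (\<Sum>S\<in>{S. f S \<noteq> 0}. scl (f S) (alpha n j k (ev S)))"
  proof -
    have "alpha n j k f = alpha n j k (\<Sum>S\<in>{S. f S \<noteq> 0}. scl (f S) (ev S))"
      using fockv_expand[OF fv] by simp
    also have "\<dots> = (\<Sum>S\<in>{S. f S \<noteq> 0}. alpha n j k (scl (f S) (ev S)))"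
      using m by (intro lin_sum[OF lin_alpha[OF n]]) auto
    also have "\<dots> = (\<Sum>S\<in>{S. f S \<noteq> 0}. scl (f S) (alpha n j k (ev S)))"
      using m by (intro sum.cong refl lin_scl[OF lin_alpha[OF n]]) auto
    finally show ?thesis .
  qed
  then have "charge T = 0" if T: "alpha n j k f T \<noteq> 0" for T
  proof -
    have "(\<Sum>S\<in>{S. f S \<noteq> 0}. f S * alpha n j k (ev S) T) \<noteq> 0"
      using T \<open>alpha n j k f = _\<close> by (simp add: sum_fun_apply)
    then obtain S where "f S \<noteq> 0" "alpha n j k (ev S) T \<noteq> 0"
      by (metis (mono_tags, lifting) mem_Collect_eq mult_eq_0_iff sum.not_neutral_contains_not_neutral)
    then show ?thesis using alpha_support_en(3)[OF n, of S T] m by auto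
  qed
  then show ?thesis using fockv_alpha[OF n fv] by (simp add: F0_def)
qed

section \<open>The charge operators\<close>

text \<open>The relation between Q_i and the fermions of colour i replaces e_i t^k by e_i t^(k - 1)
  and fixes the other components; on labels this adds n in colour i.\<close>

definition up :: "nat \<Rightarrow> nat \<Rightarrow> int \<Rightarrow> int" where
  "up n i p = (if colour n p = i then p + int n else p)"

definition dn :: "nat \<Rightarrow> nat \<Rightarrow> int \<Rightarrow> int" where
  "dn n i p = (if colour n p = i then p - int n else p)"

lemma up_dn [simp]: "up n i (dn n i p) = p" "dn n i (up n i p) = p"
  by (auto simp: up_def dn_def)

lemma up_dn_image [simp]: "up n i ` dn n i ` S = S" "dn n i ` up n i ` S = S"
  by (simp_all add: image_image)

lemma inj_up: "inj (up n i)"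
  by (rule inj_on_inverseI[where g = "dn n i"]) simp

lemma up_mem [simp]: "up n i p \<in> up n i ` S \<longleftrightarrow> p \<in> S"
  using inj_up by (simp add: inj_image_mem_iff)

lemma maya_up: assumes "maya S" shows "maya (up n i ` S)" and "maya (dn n i ` S)"
proof -
  obtain a b where ab: "{..a} \<subseteq> S" "S \<subseteq> {..b}" using assms by (auto simp: maya_def)
  have "x \<in> up n i ` S" if "x \<le> a" for x
  proof -
    have "dn n i x \<in> S" using that ab(1) by (auto simp: dn_def subset_iff)
    then have "up n i (dn n i x) \<in> up n i ` S" by (rule imageI)
    then show ?thesis by simp
  qed
  moreover have "up n i ` S \<subseteq> {..b + int n}" using ab(2) by (auto simp: up_def)
  ultimately show "maya (up n i ` S)" unfolding maya_def by blast
  have "x \<in> dn n i ` S" if "x \<le> a - int n" for x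
  proof -
    have "up n i x \<in> S" using that ab(1) by (auto simp: up_def subset_iff)
    then have "dn n i (up n i x) \<in> dn n i ` S" by (rule imageI)
    then show ?thesis by simp
  qed
  moreover have "dn n i ` S \<subseteq> {..b}" using ab(2) by (auto simp: dn_def)
  ultimately show "maya (dn n i ` S)" unfolding maya_def by blast
qed

text \<open>The unique label of colour \<open>i\<close> in \<open>{q - n..<q}\<close>.\<close>
definition pre :: "nat \<Rightarrow> nat \<Rightarrow> int \<Rightarrow> int" where
  "pre n i q = q - 1 - (q - 1 - int i) mod int n"

lemma pre_props:
  assumes n: "n \<ge> 1" "i \<in> {1..n}"
  shows "colour n (pre n i q) = i" "pre n i q < q" "q - int n \<le> pre n i q"
proof -
  have "pre n i q = int i + int n * ((q - 1 - int i) div int n)"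
    unfolding pre_def using mult_div_mod_eq[of "int n" "q - 1 - int i"] by linarith
  then show "colour n (pre n i q) = i" by (rule colour_lev_unique(1)[OF n])
  have "0 \<le> (q - 1 - int i) mod int n" "(q - 1 - int i) mod int n < int n" using n by auto
  then show "pre n i q < q" "q - int n \<le> pre n i q" unfolding pre_def by linarith+
qed

lemma pre_eq:
  assumes n: "n \<ge> 1" "i \<in> {1..n}"
  shows "pre n i q = p \<longleftrightarrow> colour n p = i \<and> p < q \<and> q - int n \<le> p"
proof
  assume *: "colour n p = i \<and> p < q \<and> q - int n \<le> p"
  then obtain k where k: "p = pre n i q + int n * k"
    using same_colour[OF n(1), of "pre n i q" p] pre_props[OF n, of q] by auto
  have "\<not> k \<ge> 1"
  proof
    assume "k \<ge> 1"
    then have "int n * 1 \<le> int n * k" by (intro mult_left_mono) auto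
    then show False using * k pre_props[OF n, of q] by linarith
  qed
  moreover have "\<not> k \<le> - 1"
  proof
    assume "k \<le> - 1"
    then have "int n * k \<le> int n * (- 1)" by (intro mult_left_mono) auto
    then show False using * k pre_props[OF n, of q] by linarith
  qed
  ultimately have "k = 0" by linarith
  then show "pre n i q = p" using k by simp
qed (use pre_props[OF n] in auto)

text \<open>Formally, Q_i picks up -1 from each factor q of a colour other than i, infinitely often,
  and raising a label p of colour i by n costs another -1 for each q overtaken, that is, with
  \<open>pre n i q = p\<close>. The two signs cancel whenever the predecessor of q is occupied; the
  finitely many q left over are the jumps.\<close>

definition jumps :: "nat \<Rightarrow> nat \<Rightarrow> int set \<Rightarrow> int set" where
  "jumps n i S = {q \<in> S. colour n q \<noteq> i \<and> pre n i q \<notin> S}"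

text \<open>The sign of the action of \<open>Q i\<close> on a basis wedge.\<close>
definition qsgn :: "nat \<Rightarrow> nat \<Rightarrow> int set \<Rightarrow> complex" where
  "qsgn n i S = (-1) ^ card (jumps n i S)"

lemma qsgn_sq [simp]: "qsgn n i S * qsgn n i S = 1" "qsgn n i S * (qsgn n i S * z) = z"
proof -
  show *: "qsgn n i S * qsgn n i S = 1" by (simp add: qsgn_def flip: power_mult_distrib)
  show "qsgn n i S * (qsgn n i S * z) = z" by (simp add: * flip: mult.assoc)
qed

lemma finite_jumps:
  assumes n: "n \<ge> 1" "i \<in> {1..n}" and S: "maya S"
  shows "finite (jumps n i S)"
proof -
  obtain a b where ab: "{..a} \<subseteq> S" "S \<subseteq> {..b}" using S by (auto simp: maya_def)
  have "jumps n i S \<subseteq> {a..b}"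
  proof
    fix q assume "q \<in> jumps n i S"
    then have "q \<le> b" "\<not> pre n i q \<le> a" using ab by (auto simp: jumps_def)
    then show "q \<in> {a..b}" using pre_props(2)[OF n, of q] by auto
  qed
  then show ?thesis by (rule finite_subset) simp
qed

text \<open>This is the equation that the sign must satisfy for \<open>QQ\<close> to intertwine
  creation operators. If p has colour i, occupying it removes from the jumps exactly the labels that
  p overtakes. If p has another colour, it becomes a jump unless its predecessor is occupied, and
  that predecessor is the one label which is carried from below p to above it.\<close>

lemma qsgn_insert:
  assumes n: "n \<ge> 1" "i \<in> {1..n}" and R: "maya R" "p \<notin> R"
  shows "sg R p * qsgn n i (insert p R) = (if colour n p = i then 1 else - 1) * qsgn n i R * sg (up n i ` R) (up n i p)"
proof -
  have fj: "finite (jumps n i R)" using finite_jumps[OF n R(1)] .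
  have fR: "finite {s\<in>R. s > p}" by (rule maya_finite_above[OF R(1)])
  have im: "{t \<in> up n i ` R. t > up n i p} = up n i ` {s\<in>R. up n i s > up n i p}" by auto
  have card_up: "card {t \<in> up n i ` R. t > up n i p} = card {s\<in>R. up n i s > up n i p}"
    unfolding im by (rule card_image) (rule inj_on_subset[OF inj_up], simp)
  show ?thesis
  proof (cases "colour n p = i")
    case True
    \<comment> \<open>The labels overtaken by p on its way to p + n; they lie above p but not above
      its image.\<close>
    define B where "B = {q\<in>R. colour n q \<noteq> i \<and> pre n i q = p}"
    define X where "X = {s\<in>R. up n i s > up n i p}"
    have upp: "up n i p = p + int n" using True by (simp add: up_def)
    have *: "(s > p \<longleftrightarrow> up n i s > up n i p \<or> (colour n s \<noteq> i \<and> pre n i s = p)) \<and>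
      \<not> (up n i s > up n i p \<and> colour n s \<noteq> i \<and> pre n i s = p)" for s
    proof (cases "colour n s = i")
      case c: True
      then have "up n i s = s + int n" by (simp add: up_def)
      then show ?thesis using c upp by simp
    next
      case c: False
      then have "up n i s = s" by (simp add: up_def)
      moreover have "pre n i s = p \<longleftrightarrow> p < s \<and> s - int n \<le> p" using pre_eq[OF n, of s p] True by blast
      ultimately show ?thesis using c upp by linarith
    qed
    have "{s\<in>R. s > p} = X \<union> B" "X \<inter> B = {}"
      unfolding X_def B_def using * by blast+
    then have 1: "card {s\<in>R. s > p} = card X + card B" using fR by (simp add: card_Un_disjoint)
    have "jumps n i R = jumps n i (insert p R) \<union> B" "jumps n i (insert p R) \<inter> B = {}"
      using True R(2) by (auto simp: jumps_def B_def)
    then have 2: "card (jumps n i R) = card (jumps n i (insert p R)) + card B"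
      using fj by (simp add: card_Un_disjoint)
    show ?thesis using True unfolding sg_def qsgn_def card_up 1 2 X_def[symmetric] by (simp add: power_add)
  next
    case False
    have j: "jumps n i (insert p R) = (if pre n i p \<notin> R then insert p (jumps n i R) else jumps n i R)"
      using False R(2) pre_props(1)[OF n] pre_props(2)[OF n, of p] by (auto simp: jumps_def)
    have "p \<notin> jumps n i R" using R(2) by (auto simp: jumps_def)
    then have 1: "card (jumps n i (insert p R)) = card (jumps n i R) + (if pre n i p \<notin> R then 1 else 0)"
      unfolding j using fj by simp
    have "up n i s > up n i p \<longleftrightarrow> s > p \<or> s = pre n i p" if "s \<in> R" for s
    proof (cases "colour n s = i")
      case True
      have "p \<noteq> s" "p \<noteq> s + int n" using True False by auto
      then have "s + int n > p \<longleftrightarrow> s > p \<or> pre n i p = s" unfolding pre_eq[OF n] using True by auto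
      then show ?thesis using True False by (auto simp: up_def)
    next
      case c: False
      then show ?thesis using False pre_props(1)[OF n, of p] by (auto simp: up_def)
    qed
    then have "{s\<in>R. up n i s > up n i p} = {s\<in>R. s > p} \<union> (if pre n i p \<in> R then {pre n i p} else {})"
      by auto
    then have 2: "card {s\<in>R. up n i s > up n i p} = card {s\<in>R. s > p} + (if pre n i p \<in> R then 1 else 0)"
      using fR pre_props(2)[OF n, of p] by auto
    show ?thesis using False unfolding sg_def qsgn_def card_up 1 2 by auto
  qed
qed

text \<open>Operators act here on coefficient functions, so moving diagrams by \<open>up\<close>
  means evaluating at the image under \<open>dn\<close>. The value 0 off Fock space is the one
  prescribed in \<open>Qop\<close>.\<close>

definition QQ :: "nat \<Rightarrow> nat \<Rightarrow> (int set \<Rightarrow> complex) \<Rightarrow> int set \<Rightarrow> complex" where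
  "QQ n i f = (if fockv f then (\<lambda>T. qsgn n i (dn n i ` T) * f (dn n i ` T)) else 0)"

definition RR :: "nat \<Rightarrow> nat \<Rightarrow> (int set \<Rightarrow> complex) \<Rightarrow> int set \<Rightarrow> complex" where
  "RR n i f = (if fockv f then (\<lambda>T. qsgn n i T * f (up n i ` T)) else 0)"

lemma fockv_QQ: "fockv f \<Longrightarrow> fockv (QQ n i f)"
proof -
  assume f: "fockv f"
  have "{S. QQ n i f S \<noteq> 0} \<subseteq> (`) (up n i) ` {S. f S \<noteq> 0}"
  proof
    fix S assume "S \<in> {S. QQ n i f S \<noteq> 0}"
    then have "dn n i ` S \<in> {S. f S \<noteq> 0}" using f by (auto simp: QQ_def)
    then have "up n i ` dn n i ` S \<in> (`) (up n i) ` {S. f S \<noteq> 0}" by (rule imageI)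
    then show "S \<in> (`) (up n i) ` {S. f S \<noteq> 0}" by simp
  qed
  moreover have "finite ((`) (up n i) ` {S. f S \<noteq> 0})" using f by (simp add: fockv_def)
  moreover have "maya S" if "S \<in> (`) (up n i) ` {S. f S \<noteq> 0}" for S
    using that f maya_up(1) by (auto simp: fockv_def)
  ultimately show ?thesis unfolding fockv_def by (auto intro: finite_subset)
qed

lemma fockv_RR: "fockv f \<Longrightarrow> fockv (RR n i f)"
proof -
  assume f: "fockv f"
  have "{S. RR n i f S \<noteq> 0} \<subseteq> (`) (dn n i) ` {S. f S \<noteq> 0}"
  proof
    fix S assume "S \<in> {S. RR n i f S \<noteq> 0}"
    then have "up n i ` S \<in> {S. f S \<noteq> 0}" using f by (auto simp: RR_def)
    then have "dn n i ` up n i ` S \<in> (`) (dn n i) ` {S. f S \<noteq> 0}" by (rule imageI)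
    then show "S \<in> (`) (dn n i) ` {S. f S \<noteq> 0}" by simp
  qed
  moreover have "finite ((`) (dn n i) ` {S. f S \<noteq> 0})" using f by (simp add: fockv_def)
  moreover have "maya S" if "S \<in> (`) (dn n i) ` {S. f S \<noteq> 0}" for S
    using that f maya_up(2) by (auto simp: fockv_def)
  ultimately show ?thesis unfolding fockv_def by (auto intro: finite_subset)
qed

lemma lin_QQ: "lin (QQ n i)"
proof -
  have "QQ n i (f + g) = QQ n i f + QQ n i g" if "fockv f" "fockv g" for f g
    using that by (simp add: QQ_def fun_eq_iff algebra_simps)
  moreover have "QQ n i (scl c f) = scl c (QQ n i f)" if "fockv f" for c f
    using that by (simp add: QQ_def fun_eq_iff algebra_simps)
  ultimately show ?thesis unfolding lin_def using fockv_QQ by blast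
qed

lemma QQ_ev: "maya S \<Longrightarrow> QQ n i (ev S) = scl (qsgn n i S) (ev (up n i ` S))"
proof
  fix T assume S: "maya S"
  have "dn n i ` T = S \<longleftrightarrow> T = up n i ` S" by (metis up_dn_image)
  then show "QQ n i (ev S) T = scl (qsgn n i S) (ev (up n i ` S)) T"
    using S by (simp add: QQ_def) (simp add: ev_def)
qed

lemma RR_ev: "maya S \<Longrightarrow> RR n i (ev S) = scl (qsgn n i (dn n i ` S)) (ev (dn n i ` S))"
proof
  fix T assume S: "maya S"
  have "up n i ` T = S \<longleftrightarrow> T = dn n i ` S" by (metis up_dn_image)
  then show "RR n i (ev S) T = scl (qsgn n i (dn n i ` S)) (ev (dn n i ` S)) T"
    using S by (simp add: RR_def) (simp add: ev_def)
qed

lemma QQ_RR: "fockv f \<Longrightarrow> QQ n i (RR n i f) = f"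
  using fockv_RR[of f n i] by (simp add: QQ_def RR_def fun_eq_iff)

lemma RR_QQ: "fockv f \<Longrightarrow> RR n i (QQ n i f) = f"
  using fockv_QQ[of f n i] by (simp add: QQ_def RR_def fun_eq_iff)

lemma QQ_psi_plus:
  assumes n: "n \<ge> 1" "i \<in> {1..n}" and f: "fockv f"
  shows "QQ n i (psi_plus p f) = scl (if colour n p = i then 1 else - 1) (psi_plus (up n i p) (QQ n i f))"
proof (rule lin_eqI[where A = "\<lambda>f. QQ n i (psi_plus p f)"
      and B = "\<lambda>f. scl (if colour n p = i then 1 else - 1) (psi_plus (up n i p) (QQ n i f))", OF _ _ _ f])
  fix S assume S: "maya S"
  show "QQ n i (psi_plus p (ev S)) = scl (if colour n p = i then 1 else - 1) (psi_plus (up n i p) (QQ n i (ev S)))"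
  proof (cases "p \<in> S")
    case True
    then show ?thesis using S
      by (simp only: psi_plus_ev QQ_ev psi_plus_scl up_mem if_True lin_0[OF lin_QQ] scl_simps)
  next
    case False
    then have "QQ n i (psi_plus p (ev S)) = scl (sg S p * qsgn n i (insert p S)) (ev (insert (up n i p) (up n i ` S)))"
      using S by (simp only: psi_plus_ev if_False lin_scl[OF lin_QQ] fockv_ev maya_insert QQ_ev scl_simps image_insert)
    also have "\<dots> = scl (if colour n p = i then 1 else - 1) (psi_plus (up n i p) (QQ n i (ev S)))"
      using False S by (simp only: qsgn_insert[OF n S False] QQ_ev psi_plus_scl psi_plus_ev up_mem if_False scl_simps mult.assoc)
    finally show ?thesis .
  qed
qed (intro lin_intros lin_compose[OF lin_QQ] lin_QQ)+

text \<open>The sign identity is the one for creation at the diagram without p, read backwards: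
  every sign involved is its own inverse.\<close>

lemma QQ_psi_minus:
  assumes n: "n \<ge> 1" "i \<in> {1..n}" and f: "fockv f"
  shows "QQ n i (psi_minus p f) = scl (if colour n p = i then 1 else - 1) (psi_minus (up n i p) (QQ n i f))"
proof (rule lin_eqI[where A = "\<lambda>f. QQ n i (psi_minus p f)"
      and B = "\<lambda>f. scl (if colour n p = i then 1 else - 1) (psi_minus (up n i p) (QQ n i f))", OF _ _ _ f])
  fix S assume S: "maya S"
  show "QQ n i (psi_minus p (ev S)) = scl (if colour n p = i then 1 else - 1) (psi_minus (up n i p) (QQ n i (ev S)))"
  proof (cases "p \<in> S")
    case False
    then show ?thesis using S
      by (simp only: psi_minus_ev QQ_ev psi_minus_scl up_mem if_False lin_0[OF lin_QQ] scl_simps)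
  next
    case True
    define R where "R = S - {p}"
    have R: "maya R" "p \<notin> R" "S = insert p R" using S True by (auto simp: R_def)
    have im: "up n i ` S - {up n i p} = up n i ` R" unfolding R(3) using R(2) inj_up[of n i]
      by (auto simp: inj_def)
    have 1: "sg S p = sg R p" using sg_insert[OF R(1,2), of p] R(3) by simp
    have 2: "sg (up n i ` S) (up n i p) = sg (up n i ` R) (up n i p)"
      using sg_insert[OF maya_up(1)[OF R(1)], of "up n i p" n i "up n i p"] R by simp
    define \<epsilon> :: complex where "\<epsilon> = (if colour n p = i then 1 else - 1)"
    have e: "\<epsilon> * \<epsilon> = 1" by (simp add: \<epsilon>_def)
    have key: "sg R p * qsgn n i S = \<epsilon> * qsgn n i R * sg (up n i ` R) (up n i p)"
      using qsgn_insert[OF n R(1,2)] unfolding \<epsilon>_def R(3) .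
    have "sg R p * qsgn n i R = \<epsilon> * qsgn n i S * sg (up n i ` R) (up n i p)"
    proof -
      have "\<epsilon> * qsgn n i S * sg (up n i ` R) (up n i p) =
        \<epsilon> * sg R p * sg (up n i ` R) (up n i p) * (sg R p * qsgn n i S)"
        by (simp add: mult_ac)
      also have "\<dots> = (\<epsilon> * \<epsilon>) * sg R p * qsgn n i R * (sg (up n i ` R) (up n i p) * sg (up n i ` R) (up n i p))"
        unfolding key by (simp only: mult_ac)
      finally show ?thesis by (simp add: e)
    qed
    moreover have "QQ n i (psi_minus p (ev S)) = scl (sg R p * qsgn n i R) (ev (up n i ` R))"
      using True R(1) by (simp only: psi_minus_ev if_True lin_scl[OF lin_QQ] fockv_ev QQ_ev scl_simps 1 R_def[symmetric])
    moreover have "scl \<epsilon> (psi_minus (up n i p) (QQ n i (ev S))) =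
       scl (\<epsilon> * qsgn n i S * sg (up n i ` R) (up n i p)) (ev (up n i ` R))"
      using True S by (simp only: QQ_ev psi_minus_scl psi_minus_ev up_mem if_True scl_simps mult.assoc im 2)
    ultimately show ?thesis unfolding \<epsilon>_def by simp
  qed
qed (intro lin_intros lin_compose[OF lin_QQ] lin_QQ)+

text \<open>Operators that carry the fermions along in the same way and agree on a cyclic vector
  agree everywhere. This is the uniqueness required by the definite description of
  \<open>Qop\<close>.\<close>

lemma intertwiner_unique:
  assumes A: "lin A" and B: "lin B" and v: "A (ev {..c}) = B (ev {..c})"
    and Ap: "\<And>r f. fockv f \<Longrightarrow> A (psi_plus r f) = scl (s r) (psi_plus (u r) (A f))"
    and Bp: "\<And>r f. fockv f \<Longrightarrow> B (psi_plus r f) = scl (s r) (psi_plus (u r) (B f))"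
    and Am: "\<And>r f. fockv f \<Longrightarrow> A (psi_minus r f) = scl (s r) (psi_minus (u r) (A f))"
    and Bm: "\<And>r f. fockv f \<Longrightarrow> B (psi_minus r f) = scl (s r) (psi_minus (u r) (B f))"
    and f: "fockv f"
  shows "A f = B f"
proof (rule lin_eqI[OF A B _ f])
  fix S assume "maya S"
  then show "A (ev S) = B (ev S)"
  proof (induction rule: maya_induct[where c = c])
    case vac show ?case by (rule v)
  next
    case (insert S r)
    then have e: "ev (insert r S) = scl (sg S r) (psi_plus r (ev S))" by (simp add: psi_plus_ev)
    have IH: "A (ev S) = B (ev S)" by (rule insert.IH)
    have "A (ev (insert r S)) = B (ev (insert r S))"
      unfolding e using insert(1) by (simp only: lin_scl[OF A] lin_scl[OF B] fockv_psi fockv_ev Ap Bp IH)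
    then show ?case .
  next
    case (remove S r)
    then have e: "ev (S - {r}) = scl (sg S r) (psi_minus r (ev S))" by (simp add: psi_minus_ev)
    have IH: "A (ev S) = B (ev S)" by (rule remove.IH)
    have "A (ev (S - {r})) = B (ev (S - {r}))"
      unfolding e using remove(1) by (simp only: lin_scl[OF A] lin_scl[OF B] fockv_psi fockv_ev Am Bm IH)
    then show ?case .
  qed
qed

lemma lab_add_n: "lab n j (k - 1) = lab n j k + int n"
  by (simp add: lab_def algebra_simps)

lemma lab_eq: "n \<ge> 1 \<Longrightarrow> \<exists>k. lab n (colour n p) k = p"
  using lab_surj[of n p "colour n p"] by metis

lemma QQ_vac:
  assumes n: "n \<ge> 1" "i \<in> {1..n}"
  shows "QQ n i vac = psip n i (- 1) vac"
proof -
  have "pre n i q \<le> 0" if "q \<le> 0" for q using pre_props(2)[OF n, of q] that by simp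
  then have "jumps n i {..0} = {}" by (auto simp: jumps_def)
  then have "qsgn n i {..0} = 1" by (simp add: qsgn_def)
  moreover have "up n i ` {..0} = insert (int i) {..0}"
  proof (intro Set.set_eqI iffI)
    fix x assume "x \<in> up n i ` {..0}"
    then obtain p where p: "p \<le> 0" "x = up n i p" by auto
    show "x \<in> insert (int i) {..0}"
    proof (cases "colour n p = i \<and> x > 0")
      case True
      then have e: "x = p + int n" using p by (simp add: up_def)
      \<comment> \<open>The only label of colour i in \<open>{1 - n..<1}\<close> is i - n, so it is
        the only one that the shift carries out of the sea, and it lands on i.\<close>
      then have "p = pre n i 1" using True pre_eq[OF n, of 1 p] p by auto
      moreover have "int i - int n = pre n i 1"
        using pre_eq[OF n, of 1 "int i - int n"] n colour_lev_unique(1)[OF n, of "int i - int n" "- 1"] by auto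
      ultimately show ?thesis using e by auto
    next
      case False
      then show ?thesis using p by (auto simp: up_def split: if_splits)
    qed
  next
    fix x assume x: "x \<in> insert (int i) {..0}"
    have "dn n i x \<le> 0"
    proof (cases "x = int i")
      case True
      then show ?thesis using n colour_lev_unique(1)[OF n, of x 0] by (auto simp: dn_def)
    qed (use x in \<open>auto simp: dn_def\<close>)
    then have "up n i (dn n i x) \<in> up n i ` {..0}" by (intro imageI) simp
    then show "x \<in> up n i ` {..0}" by simp
  qed
  moreover have "sg {..0} (int i) = 1"
  proof -
    have "{s \<in> {..0}. s > int i} = {}" by auto
    then show ?thesis by (simp only: sg_def card.empty power_0)
  qed
  moreover have "lab n i (- 1) = int i" "int i \<notin> {..0::int}" using n by (auto simp: lab_def)
  ultimately show ?thesis unfolding vac_ev psip_def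
    by (simp only: QQ_ev maya_atMost psi_plus_ev if_False)
qed

lemma Qop_eq:
  assumes n: "n \<ge> 1" "i \<in> {1..n}"
  shows "Qop n i = QQ n i"
  unfolding Qop_def
proof (rule the_equality, goal_cases)
  case 1
  have p: "QQ n i (psip n j \<kappa> f) = (\<lambda>T. (if i = j then 1 else -1) *
              psip n j (\<kappa> - (if i = j then 1 else 0)) (QQ n i f) T)" if "j \<in> {1..n}" "fockv f" for j \<kappa> f
    using QQ_psi_plus[OF n that(2), of "lab n j \<kappa>"] colour_lab[OF n(1) that(1), of \<kappa>]
    by (auto simp: psip_def up_def lab_add_n scl_def)
  have m: "QQ n i (psim n j \<kappa> f) = (\<lambda>T. (if i = j then 1 else -1) *
              psim n j (\<kappa> + (if i = j then 1 else 0)) (QQ n i f) T)" if "j \<in> {1..n}" "fockv f" for j \<kappa> f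
  proof -
    have "lab n j (- (\<kappa> + 1) - 1) = lab n j (- \<kappa> - 1) + int n"
      using lab_add_n[of n j "- \<kappa> - 1"] by (simp add: algebra_simps)
    then show ?thesis using QQ_psi_minus[OF n that(2), of "lab n j (- \<kappa> - 1)"] colour_lab[OF n(1) that(1), of "- \<kappa> - 1"]
      by (auto simp: psim_def up_def scl_def)
  qed
  have a: "QQ n i (\<lambda>T. f T + g T) = (\<lambda>T. QQ n i f T + QQ n i g T)" if "fockv f" "fockv g" for f g
    using lin_add[OF lin_QQ that] by (simp add: plus_fun_def)
  have s: "QQ n i (\<lambda>T. c * f T) = (\<lambda>T. c * QQ n i f T)" if "fockv f" for c f
    using lin_scl[OF lin_QQ that, where c = c] by (simp add: scl_def)
  have z: "QQ n i f = (\<lambda>_. 0)" if "\<not> fockv f" for f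
    using that by (simp add: QQ_def zero_fun_def)
  show ?case using p m a s z fockv_QQ QQ_vac[OF n] by blast
next
  case (2 Q)
  then have fv: "\<And>f. fockv f \<Longrightarrow> fockv (Q f)" "\<And>f. \<not> fockv f \<Longrightarrow> Q f = (\<lambda>_. 0)"
    and a: "\<And>f g. fockv f \<Longrightarrow> fockv g \<Longrightarrow> Q (f + g) = Q f + Q g"
    and s: "\<And>c f. fockv f \<Longrightarrow> Q (scl c f) = scl c (Q f)"
    and v: "Q vac = psip n i (- 1) vac"
    and p: "\<And>j \<kappa> f. j \<in> {1..n} \<Longrightarrow> fockv f \<Longrightarrow> Q (psip n j \<kappa> f) = (\<lambda>T. (if i = j then 1 else -1) *
              psip n j (\<kappa> - (if i = j then 1 else 0)) (Q f) T)"
    and m: "\<And>j \<kappa> f. j \<in> {1..n} \<Longrightarrow> fockv f \<Longrightarrow> Q (psim n j \<kappa> f) = (\<lambda>T. (if i = j then 1 else -1) *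
              psim n j (\<kappa> + (if i = j then 1 else 0)) (Q f) T)"
    unfolding plus_fun_def scl_def by auto
  have L: "lin Q" unfolding lin_def using fv a s by blast
  have "Q f = QQ n i f" for f
  proof (cases "fockv f")
    case True
    show ?thesis
    proof (rule intertwiner_unique[OF L lin_QQ, where c = 0 and u = "up n i" and s = "\<lambda>p. if colour n p = i then 1 else - 1"])
      show "Q (ev {..0}) = QQ n i (ev {..0})" using v QQ_vac[OF n] unfolding vac_ev by simp
    next
      fix r and f :: "int set \<Rightarrow> complex" assume f: "fockv f"
      obtain \<kappa> where k: "r = lab n (colour n r) \<kappa>" using lab_eq[OF n(1), of r] by metis
      have j: "colour n r \<in> {1..n}" by (rule colour_range[OF n(1)])
      have u: "lab n (colour n r) (\<kappa> - (if i = colour n r then 1 else 0)) = up n i r"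
        using lab_add_n[of n "colour n r" \<kappa>] k by (auto simp: up_def)
      show "Q (psi_plus r f) = scl (if colour n r = i then 1 else - 1) (psi_plus (up n i r) (Q f))"
        using p[OF j f, of \<kappa>] unfolding psip_def u k[symmetric] scl_def by (simp add: eq_commute)
      have k': "lab n (colour n r) (- (- \<kappa> - 1) - 1) = r" using k by simp
      have u': "lab n (colour n r) (- (- \<kappa> - 1 + (if i = colour n r then 1 else 0)) - 1) = up n i r"
        using u by (simp add: algebra_simps split: if_splits)
      show "Q (psi_minus r f) = scl (if colour n r = i then 1 else - 1) (psi_minus (up n i r) (Q f))"
        using m[OF j f, of "- \<kappa> - 1"] unfolding psim_def u' k' scl_def by (simp add: eq_commute)
    qed (use QQ_psi_plus[OF n] QQ_psi_minus[OF n] True in auto)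
  next
    case False
    then show ?thesis using fv(2) by (simp add: QQ_def zero_fun_def)
  qed
  then show ?case by blast
qed

lemma Qinv_eq:
  assumes n: "n \<ge> 1" "i \<in> {1..n}"
  shows "Qinv n i = RR n i"
  unfolding Qinv_def Qop_eq[OF n]
proof (rule the_equality)
  show "(\<forall>f. fockv f \<longrightarrow> fockv (RR n i f) \<and> QQ n i (RR n i f) = f) \<and> (\<forall>f. \<not> fockv f \<longrightarrow> RR n i f = (\<lambda>_. 0))"
    using fockv_RR QQ_RR by (auto simp: RR_def zero_fun_def)
  fix R assume R: "(\<forall>f. fockv f \<longrightarrow> fockv (R f) \<and> QQ n i (R f) = f) \<and> (\<forall>f. \<not> fockv f \<longrightarrow> R f = (\<lambda>_. 0))"
  have "R f = RR n i f" for f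
  proof (cases "fockv f")
    case True
    then have "R f = RR n i (QQ n i (R f))" using R RR_QQ by metis
    then show ?thesis using R True by simp
  qed (use R in \<open>auto simp: RR_def zero_fun_def\<close>)
  then show "R = RR n i" by blast
qed

text \<open>The diagram of the ground state with charge vector \<open>\<gamma>\<close>.\<close>
definition gnd :: "nat \<Rightarrow> (nat \<Rightarrow> int) \<Rightarrow> int set" where
  "gnd n \<gamma> = {s. lev n s < \<gamma> (colour n s)}"

lemma lev_add1: "n \<ge> 1 \<Longrightarrow> lev n (p + int n) = lev n p + 1" "n \<ge> 1 \<Longrightarrow> lev n (p - int n) = lev n p - 1"
  using lev_add[of n p 1] lev_add[of n p "- 1"] by simp_all

lemma up_gnd: "n \<ge> 1 \<Longrightarrow> up n i ` gnd n \<gamma> = gnd n (\<gamma>(i := \<gamma> i + 1))"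
proof (intro Set.set_eqI iffI)
  fix x assume n: "n \<ge> 1" and "x \<in> gnd n (\<gamma>(i := \<gamma> i + 1))"
  then have "dn n i x \<in> gnd n \<gamma>" by (auto simp: gnd_def dn_def lev_add1 split: if_splits)
  then have "up n i (dn n i x) \<in> up n i ` gnd n \<gamma>" by (rule imageI)
  then show "x \<in> up n i ` gnd n \<gamma>" by simp
qed (auto simp: gnd_def up_def lev_add1)

lemma dn_gnd: "n \<ge> 1 \<Longrightarrow> dn n i ` gnd n \<gamma> = gnd n (\<gamma>(i := \<gamma> i - 1))"
  using up_gnd[of n i "\<gamma>(i := \<gamma> i - 1)"] up_dn_image(2)[of n i "gnd n (\<gamma>(i := \<gamma> i - 1))"] by simp

lemma lev_nonpos: "n \<ge> 1 \<Longrightarrow> lev n s < 0 \<longleftrightarrow> s \<le> 0"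
  unfolding lev_def by (subst pos_imp_zdiv_neg_iff) auto

lemma gnd_0: "n \<ge> 1 \<Longrightarrow> gnd n (\<lambda>_. 0) = {..0}"
  by (auto simp: gnd_def lev_nonpos)

lemma maya_gnd:
  assumes n: "n \<ge> 1" shows "maya (gnd n \<gamma>)"
proof -
  define L where "L = Max ((\<lambda>j. \<bar>\<gamma> j\<bar>) ` {1..n})"
  have L: "\<bar>\<gamma> (colour n s)\<bar> \<le> L" for s unfolding L_def using colour_range[OF n, of s] by (intro Max_ge) auto
  have s: "s = int (colour n s) + int n * lev n s" "1 \<le> colour n s" "colour n s \<le> n" for s
    using colour_lev[OF n, of s] colour_range[OF n, of s] by auto
  have "x \<in> gnd n \<gamma>" if "x \<le> - int n * (L + 1)" for x
  proof -
    have "int n * lev n x < int n * (- (L + 1))" using that s[of x] by (simp add: algebra_simps)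
    then have "lev n x < - (L + 1)" by (simp only: mult_less_cancel_left)
    then show ?thesis using L[of x] by (auto simp: gnd_def)
  qed
  moreover have "x \<le> int n + int n * L" if "x \<in> gnd n \<gamma>" for x
  proof -
    have "lev n x \<le> L" using that L[of x] by (auto simp: gnd_def)
    then have "int n * lev n x \<le> int n * L" by (intro mult_left_mono) auto
    then show ?thesis using s[of x] by linarith
  qed
  ultimately show ?thesis unfolding maya_def by blast
qed

lemma gnd_inj:
  assumes n: "n \<ge> 1" and "gnd n \<gamma> = gnd n \<gamma>'" "\<And>l. l \<notin> {1..n} \<Longrightarrow> \<gamma> l = \<gamma>' l"
  shows "\<gamma> = \<gamma>'"
proof
  fix l
  show "\<gamma> l = \<gamma>' l"
  proof (cases "l \<in> {1..n}")
    case True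
    have "k < \<gamma> l \<longleftrightarrow> k < \<gamma>' l" for k
    proof -
      have "int l + int n * k \<in> gnd n \<gamma> \<longleftrightarrow> int l + int n * k \<in> gnd n \<gamma>'" using assms(2) by simp
      then show ?thesis using colour_lev_unique[OF n True refl, of k] by (simp add: gnd_def)
    qed
    then show ?thesis by (metis less_irrefl linorder_neqE)
  qed (use assms(3) in blast)
qed

text \<open>Each application multiplies by a sign. Only the square of the coefficient is tracked,
  which suffices to identify ground vectors up to sign; the one sign that enters the theorem is
  computed in \<open>qprod_ddelta\<close>.\<close>

lemma Qpow_gnd:
  assumes n: "n \<ge> 1" "i \<in> {1..n}"
  shows "\<exists>c'. c' * c' = c * c \<and> Qpow n i k (scl c (ev (gnd n \<gamma>))) = scl c' (ev (gnd n (\<gamma>(i := \<gamma> i + k))))"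
proof -
  have 1: "\<exists>c'. c' * c' = c * c \<and> (QQ n i ^^ m) (scl c (ev (gnd n \<gamma>))) = scl c' (ev (gnd n (\<gamma>(i := \<gamma> i + int m))))" for m
  proof (induction m)
    case (Suc m)
    then obtain c' where c': "c' * c' = c * c"
      "(QQ n i ^^ m) (scl c (ev (gnd n \<gamma>))) = scl c' (ev (gnd n (\<gamma>(i := \<gamma> i + int m))))" by blast
    let ?g = "\<gamma>(i := \<gamma> i + int m)"
    have "(QQ n i ^^ Suc m) (scl c (ev (gnd n \<gamma>))) = scl (c' * qsgn n i (gnd n ?g)) (ev (up n i ` gnd n ?g))"
      by (simp only: funpow.simps o_apply c'(2) lin_scl[OF lin_QQ] fockv_ev maya_gnd[OF n(1)] QQ_ev scl_simps)
    also have "up n i ` gnd n ?g = gnd n (\<gamma>(i := \<gamma> i + int (Suc m)))"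
      unfolding up_gnd[OF n(1)] by (simp add: algebra_simps)
    finally have e: "(QQ n i ^^ Suc m) (scl c (ev (gnd n \<gamma>))) = scl (c' * qsgn n i (gnd n ?g)) (ev (gnd n (\<gamma>(i := \<gamma> i + int (Suc m)))))" .
    have "(c' * qsgn n i (gnd n ?g)) * (c' * qsgn n i (gnd n ?g)) = c * c"
      using c'(1) by (simp add: mult_ac)
    with e show ?case by blast
  qed auto
  have 2: "\<exists>c'. c' * c' = c * c \<and> (RR n i ^^ m) (scl c (ev (gnd n \<gamma>))) = scl c' (ev (gnd n (\<gamma>(i := \<gamma> i - int m))))" for m
  proof (induction m)
    case (Suc m)
    then obtain c' where c': "c' * c' = c * c"
      "(RR n i ^^ m) (scl c (ev (gnd n \<gamma>))) = scl c' (ev (gnd n (\<gamma>(i := \<gamma> i - int m))))" by blast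
    let ?g = "\<gamma>(i := \<gamma> i - int m)"
    have r: "RR n i (scl c' f) = scl c' (RR n i f)" if "fockv f" for f
      using that by (simp add: RR_def fun_eq_iff)
    have "(RR n i ^^ Suc m) (scl c (ev (gnd n \<gamma>))) = scl (c' * qsgn n i (dn n i ` gnd n ?g)) (ev (dn n i ` gnd n ?g))"
      by (simp only: funpow.simps o_apply c'(2) r fockv_ev maya_gnd[OF n(1)] RR_ev scl_simps)
    also have "ev (dn n i ` gnd n ?g) = ev (gnd n (\<gamma>(i := \<gamma> i - int (Suc m))))"
      unfolding dn_gnd[OF n(1)] by (simp add: algebra_simps)
    finally have e: "(RR n i ^^ Suc m) (scl c (ev (gnd n \<gamma>))) = scl (c' * qsgn n i (dn n i ` gnd n ?g)) (ev (gnd n (\<gamma>(i := \<gamma> i - int (Suc m)))))" .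
    have "(c' * qsgn n i (dn n i ` gnd n ?g)) * (c' * qsgn n i (dn n i ` gnd n ?g)) = c * c"
      using c'(1) by (simp add: mult_ac)
    with e show ?case by blast
  qed auto
  show ?thesis
    using 1[of "nat k"] 2[of "nat (- k)"] unfolding Qpow_def Qop_eq[OF n] Qinv_eq[OF n] by (cases "0 \<le> k") auto
qed

lemma qprod_gnd:
  assumes n: "n \<ge> 1" and ks: "\<And>l. l \<notin> {1..n} \<Longrightarrow> ks l = 0"
  obtains c where "c * c = 1" "qprod n ks = scl c (ev (gnd n ks))"
proof -
  have "\<exists>c. c * c = 1 \<and> foldr (\<lambda>i g. Qpow n i (ks i) g) xs vac =
      scl c (ev (gnd n (\<lambda>l. if l \<in> set xs then ks l else 0)))" if "set xs \<subseteq> {1..n}" "distinct xs" for xs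
    using that
  proof (induction xs)
    case Nil
    have "foldr (\<lambda>i g. Qpow n i (ks i) g) [] vac = scl 1 (ev (gnd n (\<lambda>l. if l \<in> set [] then ks l else 0)))"
      by (simp add: gnd_0[OF n] vac_ev)
    then show ?case by (intro exI[of _ 1] conjI) simp_all
  next
    case (Cons i xs)
    let ?g = "\<lambda>l. if l \<in> set xs then ks l else 0"
    obtain c where c: "c * c = 1" "foldr (\<lambda>i g. Qpow n i (ks i) g) xs vac = scl c (ev (gnd n ?g))"
    proof -
      have "set xs \<subseteq> {1..n}" "distinct xs" using Cons.prems by auto
      then show ?thesis using Cons.IH that by blast
    qed
    obtain c' where c': "c' * c' = c * c"
      "Qpow n i (ks i) (scl c (ev (gnd n ?g))) = scl c' (ev (gnd n (?g(i := ?g i + ks i))))"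
      using Qpow_gnd[OF n, of i c "ks i" ?g] Cons.prems by auto
    have "?g(i := ?g i + ks i) = (\<lambda>l. if l \<in> set (i # xs) then ks l else 0)"
      using Cons.prems by auto
    then have "foldr (\<lambda>i g. Qpow n i (ks i) g) (i # xs) vac =
        scl c' (ev (gnd n (\<lambda>l. if l \<in> set (i # xs) then ks l else 0)))"
      using c(2) c'(2) by simp
    moreover have "c' * c' = 1" using c c' by simp
    ultimately show ?case by blast
  qed
  moreover have "set [1..<n+1] \<subseteq> {1..n}" "distinct [1..<n+1]" by auto
  ultimately have "\<exists>c. c * c = 1 \<and> qprod n ks =
    scl c (ev (gnd n (\<lambda>l. if l \<in> set [1..<n+1] then ks l else 0)))" unfolding qprod_def by blast
  then obtain c where c: "c * c = 1" "qprod n ks =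
    scl c (ev (gnd n (\<lambda>l. if l \<in> set [1..<n+1] then ks l else 0)))" by blast
  moreover have "(\<lambda>l. if l \<in> set [1..<n+1] then ks l else 0) = ks" using ks by force
  ultimately show ?thesis using that by simp
qed

lemma foldr_Qpow_0:
  assumes "\<And>l. l \<in> set xs \<Longrightarrow> ks l = 0"
  shows "foldr (\<lambda>i g. Qpow n i (ks i) g) xs f = f"
  using assms by (induction xs) (auto simp: Qpow_def)

lemma qprod_0: "qprod n (\<lambda>_. 0) = vac"
  unfolding qprod_def by (rule foldr_Qpow_0) simp

lemma foldr_upt_single:
  assumes "1 \<le> a" "a \<le> b" "\<And>l. l \<noteq> a \<Longrightarrow> m \<le> l \<Longrightarrow> l < b \<Longrightarrow> ks l = 0" "m \<le> a" "a < b"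
  shows "foldr (\<lambda>i g. Qpow n i (ks i) g) [m..<b] f = Qpow n a (ks a) f"
proof -
  have "[m..<b] = [m..<a] @ a # [Suc a..<b]"
    using assms by (metis le_Suc_ex less_imp_le_nat upt_add_eq_append upt_conv_Cons)
  then show ?thesis
    using assms foldr_Qpow_0[of "[m..<a]" ks n] foldr_Qpow_0[of "[Suc a..<b]" ks n] by simp
qed

lemma foldr_upt_two:
  assumes "1 \<le> a" "a < b" "b \<le> n" "\<And>l. l \<noteq> a \<Longrightarrow> l \<noteq> b \<Longrightarrow> ks l = 0"
  shows "qprod n ks = Qpow n a (ks a) (Qpow n b (ks b) vac)"
proof -
  have "[1..<n+1] = [1..<b] @ [b..<n+1]"
    using assms by (metis add.commute le_Suc_ex le_add1 less_imp_le_nat order_trans upt_add_eq_append add.assoc)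
  then have "qprod n ks = foldr (\<lambda>i g. Qpow n i (ks i) g) [1..<b] (foldr (\<lambda>i g. Qpow n i (ks i) g) [b..<n+1] vac)"
    by (simp add: qprod_def)
  also have "foldr (\<lambda>i g. Qpow n i (ks i) g) [b..<n+1] vac = Qpow n b (ks b) vac"
    using assms by (intro foldr_upt_single) auto
  also have "foldr (\<lambda>i g. Qpow n i (ks i) g) [1..<b] (Qpow n b (ks b) vac) = Qpow n a (ks a) (Qpow n b (ks b) vac)"
    using assms by (intro foldr_upt_single) auto
  finally show ?thesis .
qed

lemma lev_colour_eq:
  assumes n: "n \<ge> 1" and "l \<in> {1..n}"
  shows "colour n s = l \<and> lev n s = k \<longleftrightarrow> s = int l + int n * k"
  using colour_lev[OF n, of s] colour_lev_unique[OF assms] by metis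

lemma gnd_ddelta:
  assumes n: "n \<ge> 1" "i \<in> {1..n}" "j \<in> {1..n}" "i \<noteq> j"
  shows "gnd n (ddelta i j) = insert (int i) ({..0} - {int j - int n})"
proof (rule Set.set_eqI)
  fix s
  have i: "colour n s = i \<and> lev n s = 0 \<longleftrightarrow> s = int i" using lev_colour_eq[OF n(1,2), of s 0] by simp
  have j: "colour n s = j \<and> lev n s = - 1 \<longleftrightarrow> s = int j - int n" using lev_colour_eq[OF n(1,3), of s "- 1"] by simp
  show "s \<in> gnd n (ddelta i j) \<longleftrightarrow> s \<in> insert (int i) ({..0} - {int j - int n})"
    using i j lev_nonpos[OF n(1), of s] n(4) unfolding gnd_def ddelta_def by auto
qed

lemma gnd_upd:
  assumes n: "n \<ge> 1" "i \<in> {1..n}"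
  shows "gnd n ((\<lambda>_. 0)(i := 1)) = insert (int i) {..0}"
    "gnd n ((\<lambda>_. 0)(i := - 1)) = {..0} - {int i - int n}"
proof (rule_tac [!] Set.set_eqI)
  fix s
  have i: "colour n s = i \<and> lev n s = 0 \<longleftrightarrow> s = int i" using lev_colour_eq[OF n, of s 0] by simp
  have j: "colour n s = i \<and> lev n s = - 1 \<longleftrightarrow> s = int i - int n" using lev_colour_eq[OF n, of s "- 1"] by simp
  show "s \<in> gnd n ((\<lambda>_. 0)(i := 1)) \<longleftrightarrow> s \<in> insert (int i) {..0}"
    using i lev_nonpos[OF n(1), of s] unfolding gnd_def by auto
  show "s \<in> gnd n ((\<lambda>_. 0)(i := - 1)) \<longleftrightarrow> s \<in> {..0} - {int i - int n}"
    using j lev_nonpos[OF n(1), of s] unfolding gnd_def by auto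
qed

text \<open>These are the labels of the sea whose predecessor of colour j is the hole at j - n.
  Their number n - j becomes the exponent in \<open>qprod_ddelta\<close>.\<close>

lemma pre_low:
  assumes n: "n \<ge> 1" "j \<in> {1..n}" and "q \<le> 0"
  shows "colour n q \<noteq> j \<and> pre n j q = int j - int n \<longleftrightarrow> q \<in> {int j - int n <.. 0}"
proof -
  have c: "colour n (int j - int n) = j" using colour_lev_unique(1)[OF n, of "int j - int n" "- 1"] by simp
  have "colour n q \<noteq> j" if "int j - int n < q"
  proof
    assume "colour n q = j"
    then have "pre n j (q + 1) = q" using pre_eq[OF n, of "q + 1" q] n by simp
    moreover have "pre n j (q + 1) = int j - int n"
      using c that assms(3) n(2) pre_eq[OF n, of "q + 1" "int j - int n"] by auto
    ultimately show False using that by simp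
  qed
  then show ?thesis using c pre_eq[OF n, of q "int j - int n"] assms(3) n(2) by auto
qed

text \<open>The hole at j - n turns the n - j sea labels above it into jumps for the inverse of Q_j,
  whence (-1)^(n - j). The factor \<open>eps i j\<close> records the order of the product, where the
  larger index acts first: for i < j, Q_i acts last and finds no jumps; for j < i it acts first, and
  the particle at i is one more jump for colour j.\<close>

lemma qprod_ddelta:
  assumes n: "n \<ge> 1" "i \<in> {1..n}" "j \<in> {1..n}" "i \<noteq> j"
  shows "qprod n (ddelta i j) = scl ((-1) ^ (n - j) * eps i j) (ev (gnd n (ddelta i j)))"
proof -
  have k: "ddelta i j i = 1" "ddelta i j j = - 1" "\<And>l. l \<noteq> i \<Longrightarrow> l \<noteq> j \<Longrightarrow> ddelta i j l = 0"
    using n by (auto simp: ddelta_def)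
  have Q1: "Qpow n i 1 f = QQ n i f" "Qpow n j (- 1) f = RR n j f" for f
    using Qop_eq[OF n(1,2)] Qinv_eq[OF n(1,3)] by (simp_all add: Qpow_def)
  define S0 where "S0 = {..0} - {int j - int n}"
  define S2 where "S2 = insert (int i) S0"
  have S2: "gnd n (ddelta i j) = S2" unfolding gnd_ddelta[OF n] S2_def S0_def ..
  have m: "maya S0" "maya S2" by (simp_all add: S0_def S2_def)
  have dn0: "dn n j ` {..0} = S0"
    using dn_gnd[OF n(1), of j "\<lambda>_. 0"] unfolding gnd_0[OF n(1)] S0_def by (simp add: gnd_upd[OF n(1,3)])
  have up0: "up n i ` S0 = S2"
  proof -
    have "S0 = gnd n ((\<lambda>_. 0)(j := - 1))" unfolding S0_def gnd_upd(2)[OF n(1,3)] ..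
    then have "up n i ` S0 = gnd n (((\<lambda>_. 0)(j := - 1))(i := ((\<lambda>_. 0)(j := - 1)) i + 1))" by (simp only: up_gnd[OF n(1)])
    also have "((\<lambda>_. 0)(j := - 1))(i := ((\<lambda>_. 0)(j := - 1)) i + 1) = ddelta i j"
      using n(4) by (auto simp: ddelta_def)
    finally show ?thesis using S2 by simp
  qed
  have low: "{q \<in> {..0}. colour n q \<noteq> j \<and> pre n j q = int j - int n} = {int j - int n <.. 0}"
  proof (rule Set.set_eqI)
    fix q show "q \<in> {q \<in> {..0}. colour n q \<noteq> j \<and> pre n j q = int j - int n} \<longleftrightarrow> q \<in> {int j - int n <.. 0}"
      using pre_low[OF n(1,3), of q] by (cases "q \<le> 0") simp_all
  qed
  have out: "pre n j q \<notin> S0 \<longleftrightarrow> pre n j q = int j - int n" if "q \<le> 0" for q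
    using pre_props(2)[OF n(1,3), of q] that by (auto simp: S0_def)
  have cj: "colour n (int j - int n) = j" using colour_lev_unique(1)[OF n(1,3), of "int j - int n" "- 1"] by simp
  have ci: "colour n (int i) = i" using colour_lev_unique(1)[OF n(1,2), of "int i" 0] by simp
  have j0: "jumps n j S0 = {int j - int n <.. 0}"
  proof -
    have "jumps n j S0 = {q \<in> {..0}. colour n q \<noteq> j \<and> pre n j q = int j - int n}"
      unfolding jumps_def using out cj by (auto simp: S0_def)
    then show ?thesis using low by simp
  qed
  show ?thesis
  proof (cases "i < j")
    case True
    have "jumps n i S0 = {}"
    proof -
      have "pre n i q \<in> S0" if "q \<le> 0" for q
        using pre_props(1,2)[OF n(1,2), of q] that cj n(4) by (auto simp: S0_def)
      then show ?thesis by (auto simp: jumps_def S0_def)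
    qed
    then have q: "qsgn n i S0 = 1" by (simp add: qsgn_def)
    have "qprod n (ddelta i j) = QQ n i (RR n j (ev {..0}))"
      using foldr_upt_two[of i j n "ddelta i j"] k n True by (simp add: Q1 vac_ev)
    also have "\<dots> = scl (qsgn n j S0) (ev S2)"
      by (simp only: RR_ev maya_atMost dn0 lin_scl[OF lin_QQ] fockv_ev m QQ_ev q up0 scl_simps mult_1_right)
    also have "qsgn n j S0 = (-1) ^ (n - j) * eps i j"
      using True n(3) unfolding qsgn_def j0 eps_def by (simp add: nat_diff_distrib)
    finally show ?thesis unfolding S2 .
  next
    case False
    then have ij: "j < i" using n(4) by simp
    have "qprod n (ddelta i j) = RR n j (QQ n i vac)"
      using foldr_upt_two[of j i n "ddelta i j"] k n ij by (simp add: Q1)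
    also have "QQ n i vac = ev (insert (int i) {..0})"
    proof -
      have "{s \<in> {..0}. s > int i} = {}" by auto
      then have "sg {..0} (int i) = 1" by (simp only: sg_def card.empty power_0)
      moreover have "lab n i (- 1) = int i" "int i \<notin> {..0::int}" using n by (auto simp: lab_def)
      ultimately show ?thesis using QQ_vac[OF n(1,2)] by (simp add: vac_ev psip_def psi_plus_ev)
    qed
    also have "RR n j (ev (insert (int i) {..0})) = scl (qsgn n j S2) (ev S2)"
    proof -
      have "dn n j ` insert (int i) {..0} = S2"
        using dn0 ci n(4) unfolding S2_def by (simp add: dn_def[of n j "int i"])
      then show ?thesis by (simp only: RR_ev maya_insert maya_atMost)
    qed
    also have "qsgn n j S2 = (-1) ^ (n - j) * eps i j"
    proof -
      \<comment> \<open>As j < i, the predecessor of i in colour j is the label j itself, which is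
        empty.\<close>
      have p: "pre n j (int i) = int j" using pre_eq[OF n(1,3), of "int i" "int j"]
          colour_lev_unique(1)[OF n(1,3), of "int j" 0] ij n by auto
      have "pre n j q \<in> S2 \<longleftrightarrow> pre n j q \<in> S0" if "q \<le> 0" for q
        using pre_props(2)[OF n(1,3), of q] that by (auto simp: S2_def)
      then have "jumps n j S2 = insert (int i) (jumps n j S0)"
        using p ci n ij unfolding jumps_def S2_def by (auto simp: S0_def)
      moreover have "int i \<notin> jumps n j S0" using n unfolding j0 by auto
      ultimately have "card (jumps n j S2) = Suc (n - j)" using n(3) unfolding j0 by (simp add: nat_diff_distrib)
      then show ?thesis using ij by (simp add: qsgn_def eps_def)
    qed
    finally show ?thesis unfolding S2 .
  qed
qed

section \<open>The boson-fermion correspondence\<close>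

lemma lev_mono: "n \<ge> 1 \<Longrightarrow> h \<le> s \<Longrightarrow> lev n h \<le> lev n s"
  unfolding lev_def by (intro zdiv_mono1) auto

lemma en_gnd: "n \<ge> 1 \<Longrightarrow> en n (gnd n \<gamma>) = 0"
proof -
  assume n: "n \<ge> 1"
  have "boxes n (gnd n \<gamma>) = {}"
  proof -
    have "lev n h \<le> lev n s" if "h < s" for h s using lev_mono[OF n, of h s] that by simp
    then show ?thesis by (fastforce simp: boxes_def gnd_def)
  qed
  then show ?thesis by (simp add: en_def)
qed

lemma down_closed_int:
  fixes K :: "int set"
  assumes "\<And>k k'. k \<in> K \<Longrightarrow> k' < k \<Longrightarrow> k' \<in> K" "a \<in> K" "K \<subseteq> {..b}"
  obtains c where "K = {..<c}"
proof -
  define m where "m = Max (K \<inter> {a..b})"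
  have m: "m \<in> K \<inter> {a..b}" unfolding m_def
  proof (rule Max_in)
    have "a \<in> K \<inter> {a..b}" using assms(2,3) by auto
    then show "K \<inter> {a..b} \<noteq> {}" by blast
  qed simp
  have "k \<le> m" if "k \<in> K" for k
  proof (cases "k < a")
    case False
    then show ?thesis unfolding m_def using that assms(3) by (intro Max_ge) auto
  qed (use m in auto)
  then have "K = {..<m + 1}" using m assms(1) by (force simp: set_eq_iff zless_add1_eq)
  then show ?thesis using that by blast
qed

text \<open>Without boxes no hole lies below a particle of its colour, so the occupied levels of
  each colour form an initial ray, whose end is the charge in that colour.\<close>

lemma gnd_exists:
  assumes n: "n \<ge> 1" and S: "maya S" "en n S = 0"
  shows "\<exists>\<gamma>. (\<forall>l. l \<notin> {1..n} \<longrightarrow> \<gamma> l = 0) \<and> S = gnd n \<gamma>"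
proof -
  have b: "boxes n S = {}" using S(2) finite_boxes[OF S(1), of n] by (simp add: en_def)
  obtain L where L: "L > 0" "{..- L} \<subseteq> S" "S \<subseteq> {..L}" using maya_bounds[OF S(1)] .
  have "\<exists>c. {k. int l + int n * k \<in> S} = {..<c}" if l: "l \<in> {1..n}" for l
  proof -
    have "\<exists>c. {k. int l + int n * k \<in> S} = {..<c}"
    proof (rule down_closed_int[of "{k. int l + int n * k \<in> S}" "- L - 1" L])
      fix k k' assume k: "k \<in> {k. int l + int n * k \<in> S}" "k' < k"
      show "k' \<in> {k. int l + int n * k \<in> S}"
      proof (rule ccontr)
        assume "k' \<notin> {k. int l + int n * k \<in> S}"
        then have "(int l + int n * k, int l + int n * k') \<in> boxes n S"
          using k n by (auto simp: boxes_def)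
        then show False using b by simp
      qed
    next
      have "int n * (L + 1) \<ge> int n + L" using n L mult_right_mono[of 1 "int n" L] by (simp add: algebra_simps)
      then have "int l + int n * (- L - 1) \<le> - L" using l by (simp add: algebra_simps)
      then show "- L - 1 \<in> {k. int l + int n * k \<in> S}" using L(2) by auto
    next
      show "{k. int l + int n * k \<in> S} \<subseteq> {..L}"
      proof
        fix k assume "k \<in> {k. int l + int n * k \<in> S}"
        then have k: "int l + int n * k \<le> L" using L(3) by auto
        show "k \<in> {..L}"
        proof (cases "k > 0")
          case True
          then have "int n * k \<ge> 1 * k" using n by (intro mult_right_mono) auto
          then show ?thesis using k by auto
        qed (use L in auto)
      qed
    qed blast
    then show ?thesis .
  qed
  then obtain c where c: "\<And>l. l \<in> {1..n} \<Longrightarrow> {k. int l + int n * k \<in> S} = {..<c l}" by metis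
  define \<gamma> where "\<gamma> l = (if l \<in> {1..n} then c l else 0)" for l
  have "s \<in> S \<longleftrightarrow> s \<in> gnd n \<gamma>" for s
  proof -
    have cr: "colour n s \<in> {1..n}" by (rule colour_range[OF n])
    have "lev n s \<in> {k. int (colour n s) + int n * k \<in> S} \<longleftrightarrow> lev n s \<in> {..<c (colour n s)}"
      using c[OF cr] by simp
    then show ?thesis using colour_lev[OF n, of s] cr by (simp add: gnd_def \<gamma>_def)
  qed
  then have "S = gnd n \<gamma>" by blast
  moreover have "\<forall>l. l \<notin> {1..n} \<longrightarrow> \<gamma> l = 0" by (simp add: \<gamma>_def)
  ultimately show ?thesis by blast
qed

lemma card_level_range:
  assumes n: "n \<ge> 1"
  shows "card {s. a (colour n s) \<le> lev n s \<and> lev n s < b (colour n s)} = (\<Sum>l\<in>{1..n}. nat (b l - a l))"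
proof -
  have "bij_betw (\<lambda>s. (colour n s, lev n s)) {s. a (colour n s) \<le> lev n s \<and> lev n s < b (colour n s)}
    (SIGMA l:{1..n}. {a l..<b l})"
  proof (rule bij_betw_byWitness[where f' = "\<lambda>(l, k). int l + int n * k"])
    show "\<forall>s\<in>{s. a (colour n s) \<le> lev n s \<and> lev n s < b (colour n s)}.
       (case (colour n s, lev n s) of (l, k) \<Rightarrow> int l + int n * k) = s" using colour_lev[OF n] by simp
    show "\<forall>z\<in>SIGMA l:{1..n}. {a l..<b l}.
       (\<lambda>s. (colour n s, lev n s)) (case z of (l, k) \<Rightarrow> int l + int n * k) = z"
      using colour_lev_unique[OF n] by auto
    show "(\<lambda>s. (colour n s, lev n s)) ` {s. a (colour n s) \<le> lev n s \<and> lev n s < b (colour n s)} \<subseteq> (SIGMA l:{1..n}. {a l..<b l})"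
      using colour_range[OF n] by auto
    show "(\<lambda>(l, k). int l + int n * k) ` (SIGMA l:{1..n}. {a l..<b l}) \<subseteq>
        {s. a (colour n s) \<le> lev n s \<and> lev n s < b (colour n s)}"
      using colour_lev_unique[OF n] by auto
  qed
  then have "card {s. a (colour n s) \<le> lev n s \<and> lev n s < b (colour n s)} = card (SIGMA l:{1..n}. {a l..<b l})"
    by (rule bij_betw_same_card)
  also have "\<dots> = (\<Sum>l\<in>{1..n}. nat (b l - a l))" by (subst card_SigmaI) auto
  finally show ?thesis .
qed

lemma charge_gnd:
  assumes n: "n \<ge> 1" shows "charge (gnd n \<gamma>) = (\<Sum>l\<in>{1..n}. \<gamma> l)"
proof -
  have p: "s > 0 \<longleftrightarrow> 0 \<le> lev n s" for s using lev_nonpos[OF n, of s] by auto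
  have "{s \<in> gnd n \<gamma>. s > 0} = {s. 0 \<le> lev n s \<and> lev n s < \<gamma> (colour n s)}"
    unfolding p gnd_def by auto
  moreover have "{s. s \<le> 0 \<and> s \<notin> gnd n \<gamma>} = {s. \<gamma> (colour n s) \<le> lev n s \<and> lev n s < 0}"
    unfolding lev_nonpos[OF n, symmetric] gnd_def by auto
  ultimately have "charge (gnd n \<gamma>) = (\<Sum>l\<in>{1..n}. int (nat (\<gamma> l)) - int (nat (- \<gamma> l)))"
    using card_level_range[OF n, of "\<lambda>_. 0" \<gamma>] card_level_range[OF n, of \<gamma> "\<lambda>_. 0"]
    unfolding charge_def by (simp add: sum_subtractf)
  also have "\<dots> = (\<Sum>l\<in>{1..n}. \<gamma> l)" by (rule sum.cong) auto
  finally show ?thesis .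
qed

section \<open>Bosonization by Euler's identity\<close>

lemma F0_0 [simp]: "F0 0" by (simp add: F0_def)

lemma F0_add [simp]: "F0 f \<Longrightarrow> F0 g \<Longrightarrow> F0 (f + g)"
  unfolding F0_def by (metis add_0 fockv_add plus_fun_apply)

lemma F0_scl [simp]: "F0 f \<Longrightarrow> F0 (scl c f)"
  unfolding F0_def by (metis fockv_scl mult_zero_right scl_apply)

lemma F0_sum [simp]: "(\<And>i. i \<in> A \<Longrightarrow> F0 (f i)) \<Longrightarrow> F0 (sum f A)"
  by (induction A rule: infinite_finite_induct) auto

lemma F0_ev: "maya S \<Longrightarrow> charge S = 0 \<Longrightarrow> F0 (ev S)"
  by (simp add: F0_def ev_def fockv_ev[unfolded ev_def])

lemma F0_qprod: "n \<ge> 1 \<Longrightarrow> ks \<in> Mlat n \<Longrightarrow> F0 (qprod n ks)"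
proof -
  assume n: "n \<ge> 1" and ks: "ks \<in> Mlat n"
  then obtain c where "qprod n ks = scl c (ev (gnd n ks))" using qprod_gnd[OF n, of ks] by (auto simp: Mlat_def)
  then show ?thesis using F0_ev[OF maya_gnd[OF n, of ks]] charge_gnd[OF n, of ks] ks by (simp add: Mlat_def)
qed

text \<open>The bosonization of a basis wedge of energy \<open>e\<close>, by Euler's identity
  \<open>e \<sigma>(v) = \<Sum> k x\<^sub>k \<sigma>(\<alpha>\<^sub>k v)\<close>.\<close>
fun sgm :: "nat \<Rightarrow> (nat \<times> nat \<Rightarrow> complex) \<Rightarrow> (nat \<Rightarrow> int) \<Rightarrow> nat \<Rightarrow> int set \<Rightarrow> complex" where
  "sgm n x \<beta> 0 S = (if \<beta> \<in> Mlat n \<and> S = gnd n \<beta> then qprod n \<beta> S else 0)"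
| "sgm n x \<beta> (Suc e) S = (\<Sum>k\<in>{1..Suc e}. \<Sum>j\<in>{1..n}. of_nat k * x (j, k) *
     (\<Sum>T\<in>{T. alpha n j (int k) (ev S) T \<noteq> 0}. alpha n j (int k) (ev S) T * sgm n x \<beta> (Suc e - k) T)) / of_nat (Suc e)"

text \<open>The point x and the charge \<beta> are parameters, so that each coefficient of the
  bosonization is a linear functional on Fock space.\<close>

definition Sig :: "nat \<Rightarrow> (nat \<times> nat \<Rightarrow> complex) \<Rightarrow> (nat \<Rightarrow> int) \<Rightarrow> (int set \<Rightarrow> complex) \<Rightarrow> complex" where
  "Sig n x \<beta> f = (\<Sum>T\<in>{T. f T \<noteq> 0}. f T * sgm n x \<beta> (en n T) T)"

lemma Sig_superset: "finite A \<Longrightarrow> {T. f T \<noteq> 0} \<subseteq> A \<Longrightarrow> Sig n x \<beta> f = (\<Sum>T\<in>A. f T * sgm n x \<beta> (en n T) T)"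
  unfolding Sig_def by (rule sum.mono_neutral_left) auto

lemma Sig_0 [simp]: "Sig n x \<beta> 0 = 0" by (simp add: Sig_def)

lemma Sig_add:
  assumes "fockv f" "fockv g" shows "Sig n x \<beta> (f + g) = Sig n x \<beta> f + Sig n x \<beta> g"
proof -
  let ?A = "{T. f T \<noteq> 0} \<union> {T. g T \<noteq> 0}"
  have A: "finite ?A" using assms by (simp add: fockv_def)
  have "{T. (f + g) T \<noteq> 0} \<subseteq> ?A" by auto
  then show ?thesis using Sig_superset[OF A, of f] Sig_superset[OF A, of g] Sig_superset[OF A, of "f + g"]
    by (simp add: sum.distrib algebra_simps)
qed

lemma Sig_scl: assumes "fockv f" shows "Sig n x \<beta> (scl c f) = c * Sig n x \<beta> f"
proof -
  let ?A = "{T. f T \<noteq> 0}"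
  have A: "finite ?A" using assms by (simp add: fockv_def)
  have "{T. scl c f T \<noteq> 0} \<subseteq> ?A" by auto
  then show ?thesis using Sig_superset[OF A, of f] Sig_superset[OF A, of "scl c f"]
    by (simp add: sum_distrib_left mult.assoc)
qed

lemma Sig_sum: "(\<And>i. i \<in> A \<Longrightarrow> fockv (f i)) \<Longrightarrow> Sig n x \<beta> (sum f A) = (\<Sum>i\<in>A. Sig n x \<beta> (f i))"
proof (induction A rule: infinite_finite_induct)
  case (insert a A)
  have "Sig n x \<beta> (sum f (insert a A)) = Sig n x \<beta> (f a + sum f A)" using insert.hyps by (simp only: sum.insert not_False_eq_True)
  also have "\<dots> = Sig n x \<beta> (f a) + Sig n x \<beta> (sum f A)" using insert.prems by (intro Sig_add) auto
  also have "Sig n x \<beta> (sum f A) = (\<Sum>i\<in>A. Sig n x \<beta> (f i))" using insert by blast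
  finally show ?case using insert.hyps by (simp only: sum.insert not_False_eq_True)
qed simp_all

lemma Sig_ev: "maya S \<Longrightarrow> Sig n x \<beta> (ev S) = sgm n x \<beta> (en n S) S"
  by (subst Sig_superset[of "{S}"]) (auto simp: ev_def)

lemma Sig_expand:
  assumes "lin A" "fockv f"
  shows "Sig n x \<beta> (A f) = (\<Sum>S\<in>{S. f S \<noteq> 0}. f S * Sig n x \<beta> (A (ev S)))"
proof -
  have m: "maya S" if "f S \<noteq> 0" for S using assms(2) that by (simp add: fockv_def)
  have "A f = A (\<Sum>S\<in>{S. f S \<noteq> 0}. scl (f S) (ev S))" using fockv_expand[OF assms(2)] by simp
  also have "\<dots> = (\<Sum>S\<in>{S. f S \<noteq> 0}. A (scl (f S) (ev S)))" using m by (intro lin_sum[OF assms(1)]) auto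
  also have "\<dots> = (\<Sum>S\<in>{S. f S \<noteq> 0}. scl (f S) (A (ev S)))"
    using m by (intro sum.cong refl lin_scl[OF assms(1)]) auto
  finally have "Sig n x \<beta> (A f) = Sig n x \<beta> (\<Sum>S\<in>{S. f S \<noteq> 0}. scl (f S) (A (ev S)))" by simp
  also have "\<dots> = (\<Sum>S\<in>{S. f S \<noteq> 0}. Sig n x \<beta> (scl (f S) (A (ev S))))"
    using m lin_fockv[OF assms(1)] by (intro Sig_sum) auto
  also have "\<dots> = (\<Sum>S\<in>{S. f S \<noteq> 0}. f S * Sig n x \<beta> (A (ev S)))"
    using m lin_fockv[OF assms(1)] by (intro sum.cong refl Sig_scl) auto
  finally show ?thesis .
qed

text \<open>Modes above the energy annihilate the wedge, so any cutoff K beyond it gives the same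
  sum. Vectors of different energies can then share one cutoff.\<close>

lemma Sig_euler:
  assumes n: "n \<ge> 1" and S: "maya S" and K: "K \<ge> en n S"
  shows "of_nat (en n S) * Sig n x \<beta> (ev S) =
    (\<Sum>k\<in>{1..K}. \<Sum>j\<in>{1..n}. of_nat k * x (j, k) * Sig n x \<beta> (alpha n j (int k) (ev S)))"
proof -
  have "(\<Sum>k\<in>{1..K}. \<Sum>j\<in>{1..n}. of_nat k * x (j, k) * Sig n x \<beta> (alpha n j (int k) (ev S))) =
    (\<Sum>k\<in>{1..en n S}. \<Sum>j\<in>{1..n}. of_nat k * x (j, k) * Sig n x \<beta> (alpha n j (int k) (ev S)))"
    using K alpha_zero[OF n _ _ S] by (intro sum.mono_neutral_right) (auto intro!: sum.neutral)
  also have "\<dots> = of_nat (en n S) * Sig n x \<beta> (ev S)"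
  proof (cases "en n S")
    case (Suc e)
    have "Sig n x \<beta> (alpha n j (int k) (ev S)) = (\<Sum>T\<in>{T. alpha n j (int k) (ev S) T \<noteq> 0}.
        alpha n j (int k) (ev S) T * sgm n x \<beta> (Suc e - k) T)" if "k \<in> {1..Suc e}" "j \<in> {1..n}" for k j
      unfolding Sig_def
    proof (rule sum.cong[OF refl])
      fix T assume "T \<in> {T. alpha n j (int k) (ev S) T \<noteq> 0}"
      then have "int (en n T) = int (Suc e) - int k"
        using alpha_support_en(2)[OF n that(2) _ S, of "int k" T] that(1) Suc by auto
      then have "en n T = Suc e - k" using that by auto
      then show "alpha n j (int k) (ev S) T * sgm n x \<beta> (en n T) T =
         alpha n j (int k) (ev S) T * sgm n x \<beta> (Suc e - k) T" by simp
    qed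
    then have "(\<Sum>k\<in>{1..Suc e}. \<Sum>j\<in>{1..n}. of_nat k * x (j, k) * Sig n x \<beta> (alpha n j (int k) (ev S))) =
      (\<Sum>k\<in>{1..Suc e}. \<Sum>j\<in>{1..n}. of_nat k * x (j, k) * (\<Sum>T\<in>{T. alpha n j (int k) (ev S) T \<noteq> 0}.
        alpha n j (int k) (ev S) T * sgm n x \<beta> (Suc e - k) T))"
      by (intro sum.cong refl) auto
    also have "\<dots> = of_nat (Suc e) * sgm n x \<beta> (Suc e) S"
      by (simp del: of_nat_Suc)
    finally show ?thesis using Suc S by (simp add: Sig_ev)
  qed simp
  finally show ?thesis by simp
qed

lemma Sig_euler_homogeneous:
  assumes n: "n \<ge> 1" and f: "fockv f" "\<And>T. f T \<noteq> 0 \<Longrightarrow> en n T = e" and K: "K \<ge> e"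
  shows "of_nat e * Sig n x \<beta> f =
    (\<Sum>k\<in>{1..K}. \<Sum>j\<in>{1..n}. of_nat k * x (j, k) * Sig n x \<beta> (alpha n j (int k) f))"
proof -
  have m: "maya T" if "f T \<noteq> 0" for T using f(1) that by (simp add: fockv_def)
  have "of_nat e * Sig n x \<beta> f = (\<Sum>T\<in>{T. f T \<noteq> 0}. f T * (of_nat (en n T) * Sig n x \<beta> (ev T)))"
    using Sig_expand[OF lin_id f(1), of n x \<beta>] f(2) by (simp add: sum_distrib_left mult_ac)
  also have "\<dots> = (\<Sum>T\<in>{T. f T \<noteq> 0}. f T * (\<Sum>k\<in>{1..K}. \<Sum>j\<in>{1..n}. of_nat k * x (j, k) * Sig n x \<beta> (alpha n j (int k) (ev T))))"
    using Sig_euler[OF n m, of _ K x \<beta>] f(2) K by (intro sum.cong) auto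
  also have "\<dots> = (\<Sum>k\<in>{1..K}. \<Sum>j\<in>{1..n}. of_nat k * x (j, k) * (\<Sum>T\<in>{T. f T \<noteq> 0}. f T * Sig n x \<beta> (alpha n j (int k) (ev T))))"
    unfolding sum_distrib_left
    by (subst sum.swap, intro sum.cong refl, subst sum.swap) (simp add: mult_ac)
  also have "\<dots> = (\<Sum>k\<in>{1..K}. \<Sum>j\<in>{1..n}. of_nat k * x (j, k) * Sig n x \<beta> (alpha n j (int k) f))"
    using Sig_expand[OF lin_alpha[OF n] f(1), of _ _ n x \<beta>] by (intro sum.cong refl) auto
  finally show ?thesis .
qed

text \<open>Euler's identity is applied to \<alpha>_(-m) v, which has energy e + m when v has energy
  e. Commuting \<alpha>_k to the right leaves \<alpha>_(-m) applied to \<alpha>_k v, of smaller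
  energy, where the induction extracts m x_m; these terms add up to e m x_m \<sigma>(v) by Euler's
  identity for v. The central term adds m times m x_m \<sigma>(v), and e + m cancels.\<close>

lemma Sig_alpha_neg_ev:
  assumes n: "n \<ge> 1" "j \<in> {1..n}" "m \<ge> 1" and S: "maya S"
  shows "Sig n x \<beta> (alpha n j (- int m) (ev S)) = of_nat m * x (j, m) * Sig n x \<beta> (ev S)"
  using S
proof (induction "en n S" arbitrary: S rule: less_induct)
  case less
  note S = less.prems
  define e where "e = en n S"
  let ?c = "of_nat m * x (j, m)"
  let ?\<alpha> = "alpha n j (- int m)"
  let ?K = "e + m"
  have m0: "- int m \<noteq> 0" using n by simp
  have L: "lin ?\<alpha>" by (rule lin_alpha[OF n(1,2) m0])
  have fv: "fockv (?\<alpha> (ev S))" using lin_fockv[OF L] S by simp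
  have enT: "en n T = e + m" if "?\<alpha> (ev S) T \<noteq> 0" for T
    using alpha_support_en(2)[OF n(1,2) m0 S that] unfolding e_def by linarith
  have trm: "Sig n x \<beta> (alpha n i (int k) (?\<alpha> (ev S))) =
      ?c * Sig n x \<beta> (alpha n i (int k) (ev S)) + (if i = j \<and> k = m then of_nat m * Sig n x \<beta> (ev S) else 0)"
    if k: "k \<in> {1..?K}" and i: "i \<in> {1..n}" for k i
  proof -
    have k0: "int k > 0" "int k \<noteq> 0" "int m > 0" using k n by auto
    let ?f = "alpha n i (int k) (ev S)"
    have ff: "fockv ?f" using lin_fockv[OF lin_alpha[OF n(1) i k0(2)]] S by simp
    have "alpha n i (int k) (?\<alpha> (ev S)) = ?\<alpha> ?f + scl (if i = j \<and> k = m then of_int (int k) else 0) (ev S)"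
      using alpha_commutator[OF n(1) i n(2) k0(1,3), of "ev S"] S by simp
    then have e1: "Sig n x \<beta> (alpha n i (int k) (?\<alpha> (ev S))) = Sig n x \<beta> (?\<alpha> ?f) +
       Sig n x \<beta> (scl (if i = j \<and> k = m then of_int (int k) else 0) (ev S))"
      using lin_fockv[OF L ff] S by (simp only: Sig_add fockv_scl fockv_ev)
    have e2: "Sig n x \<beta> (?\<alpha> ?f) = ?c * Sig n x \<beta> ?f"
    proof -
      have "Sig n x \<beta> (?\<alpha> (ev T)) = ?c * Sig n x \<beta> (ev T)" if "?f T \<noteq> 0" for T
        using less.hyps[of T] alpha_support_en(1,2)[OF n(1) i k0(2) S that] k0(1) by simp
      then have "Sig n x \<beta> (?\<alpha> ?f) = (\<Sum>T\<in>{T. ?f T \<noteq> 0}. ?f T * (?c * Sig n x \<beta> (ev T)))"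
        unfolding Sig_expand[OF L ff] by (intro sum.cong refl) simp
      also have "\<dots> = ?c * Sig n x \<beta> ?f"
        using Sig_expand[OF lin_id ff, of n x \<beta>] by (simp add: sum_distrib_left mult_ac)
      finally show ?thesis .
    qed
    have e3: "Sig n x \<beta> (scl (if i = j \<and> k = m then of_int (int k) else 0) (ev S)) =
       (if i = j \<and> k = m then of_nat m * Sig n x \<beta> (ev S) else 0)"
      using S by (simp only: Sig_scl fockv_ev) simp
    show ?thesis unfolding e1 e2 e3 ..
  qed
  have "of_nat (e + m) * Sig n x \<beta> (?\<alpha> (ev S)) =
    (\<Sum>k\<in>{1..?K}. \<Sum>i\<in>{1..n}. of_nat k * x (i, k) * Sig n x \<beta> (alpha n i (int k) (?\<alpha> (ev S))))"
    by (rule Sig_euler_homogeneous[OF n(1) fv enT order_refl])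
  also have "\<dots> = (\<Sum>k\<in>{1..?K}. \<Sum>i\<in>{1..n}. ?c * (of_nat k * x (i, k) * Sig n x \<beta> (alpha n i (int k) (ev S))) +
     (if i = j then if k = m then of_nat m * x (j, m) * (of_nat m * Sig n x \<beta> (ev S)) else 0 else 0))"
    using trm by (intro sum.cong refl) (auto simp: algebra_simps)
  also have "\<dots> = ?c * (of_nat e * Sig n x \<beta> (ev S)) + ?c * (of_nat m * Sig n x \<beta> (ev S))"
    using n Sig_euler[OF n(1) S, of ?K x \<beta>] unfolding e_def
    by (simp add: sum.distrib sum_distrib_left)
  finally have "of_nat (e + m) * Sig n x \<beta> (?\<alpha> (ev S)) = of_nat (e + m) * (?c * Sig n x \<beta> (ev S))"
    by (simp add: algebra_simps)
  moreover have "of_nat (e + m) \<noteq> (0::complex)" using n by (simp del: of_nat_add)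
  ultimately show ?case by (simp only: mult_cancel_left) simp
qed

lemma Sig_alpha_neg:
  assumes n: "n \<ge> 1" "j \<in> {1..n}" "m \<ge> 1" and f: "fockv f"
  shows "Sig n x \<beta> (alpha n j (- int m) f) = of_nat m * x (j, m) * Sig n x \<beta> f"
proof -
  have m0: "- int m \<noteq> 0" using n by simp
  have "Sig n x \<beta> (alpha n j (- int m) f) = (\<Sum>S\<in>{S. f S \<noteq> 0}. f S * (of_nat m * x (j, m) * Sig n x \<beta> (ev S)))"
    unfolding Sig_expand[OF lin_alpha[OF n(1,2) m0] f]
    using Sig_alpha_neg_ev[OF n] f by (intro sum.cong refl) (auto simp: fockv_def)
  also have "\<dots> = of_nat m * x (j, m) * Sig n x \<beta> f"
    using Sig_expand[OF lin_id f, of n x \<beta>] by (simp add: sum_distrib_left mult_ac)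
  finally show ?thesis .
qed

text \<open>The base case of \<open>sgm\<close> takes the coefficient of \<open>qprod\<close> at the
  ground diagram as its value. The unknown sign therefore occurs twice and squares to 1.\<close>

lemma Sig_qprod:
  assumes n: "n \<ge> 1" and ks: "ks \<in> Mlat n"
  shows "Sig n x \<beta> (qprod n ks) = (if \<beta> = ks then 1 else 0)"
proof -
  obtain c where c: "c * c = 1" "qprod n ks = scl c (ev (gnd n ks))"
    using qprod_gnd[OF n, of ks] ks by (auto simp: Mlat_def)
  have "Sig n x \<beta> (qprod n ks) = c * sgm n x \<beta> 0 (gnd n ks)"
    unfolding c(2) using maya_gnd[OF n, of ks] by (simp add: Sig_scl Sig_ev en_gnd[OF n])
  moreover have "\<beta> = ks" if "\<beta> \<in> Mlat n" "gnd n ks = gnd n \<beta>"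
    using gnd_inj[OF n, of ks \<beta>] that ks by (auto simp: Mlat_def)
  ultimately show ?thesis using ks c by (auto simp: ev_def)
qed

section \<open>Chains of creation modes and the identification of \<open>sigma\<close>\<close>

abbreviation valid_chain :: "nat \<Rightarrow> (nat \<times> nat) list \<Rightarrow> bool" where
  "valid_chain n ps \<equiv> \<forall>(i, m)\<in>set ps. i \<in> {1..n} \<and> m \<ge> 1"

lemma alpha_chain_Cons: "alpha_chain n ((i, m) # ps) f = alpha n i (- int m) (alpha_chain n ps f)"
  by (simp add: alpha_chain_def)

lemma alpha_chain_snoc: "alpha_chain n (ps @ [(i, m)]) f = alpha_chain n ps (alpha n i (- int m) f)"
  by (simp add: alpha_chain_def)

lemma alpha_chain_Nil: "alpha_chain n [] f = f"
  by (simp add: alpha_chain_def)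

lemma lin_alpha_chain: "n \<ge> 1 \<Longrightarrow> valid_chain n ps \<Longrightarrow> lin (alpha_chain n ps)"
proof (induction ps)
  case Nil
  then show ?case by (simp add: lin_def alpha_chain_Nil)
next
  case (Cons p ps)
  obtain i m where p: "p = (i, m)" by (cases p)
  have "lin (\<lambda>f. alpha n i (- int m) (alpha_chain n ps f))"
    using Cons p by (intro lin_alpha') auto
  then show ?case by (simp add: p alpha_chain_Cons[abs_def] lin_def)
qed

lemma F0_alpha_chain: "n \<ge> 1 \<Longrightarrow> valid_chain n ps \<Longrightarrow> F0 f \<Longrightarrow> F0 (alpha_chain n ps f)"
proof (induction ps)
  case (Cons p ps)
  obtain i m where p: "p = (i, m)" by (cases p)
  then show ?case using Cons F0_alpha[of n i "- int m"] by (simp add: alpha_chain_Cons)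
qed (simp add: alpha_chain_Nil)

lemma Sig_chain:
  assumes "n \<ge> 1" "valid_chain n ps" "ks \<in> Mlat n"
  shows "Sig n x \<beta> (alpha_chain n ps (qprod n ks)) = (if \<beta> = ks then \<Prod>(i, m)\<leftarrow>ps. of_nat m * x (i, m) else 0)"
  using assms(2)
proof (induction ps)
  case Nil
  then show ?case using assms by (simp add: Sig_qprod alpha_chain_Nil)
next
  case (Cons p ps)
  obtain i m where p: "p = (i, m)" by (cases p)
  have "fockv (alpha_chain n ps (qprod n ks))"
    using F0_alpha_chain[OF assms(1) _ F0_qprod[OF assms(1,3)], of ps] Cons.prems by (simp add: F0_def)
  then show ?case using Cons p assms(1) by (simp add: alpha_chain_Cons Sig_alpha_neg)
qed

definition SIG :: "nat \<Rightarrow> (int set \<Rightarrow> complex) \<Rightarrow> (nat \<Rightarrow> int) \<Rightarrow> (nat \<times> nat \<Rightarrow> complex) \<Rightarrow> complex" where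
  "SIG n f = (if F0 f then (\<lambda>\<beta> x. Sig n x \<beta> f) else (\<lambda>\<beta> x. 0))"

lemma sum_in_closed:
  assumes "0 \<in> V \<and> (\<forall>f\<in>V. \<forall>g\<in>V. f + g \<in> V)" "\<And>i. i \<in> A \<Longrightarrow> g i \<in> V"
  shows "sum g A \<in> V"
  using assms(2) by (induction A rule: infinite_finite_induct) (use assms(1) in auto)

text \<open>Induction on the energy shows that creation modes generate everything from the ground
  vectors: by \<open>energy_identity\<close>, a wedge of positive energy e is 1/e times a sum of
  vectors \<alpha>_(-k) u, where u has smaller energy.\<close>

lemma sigma_unique:
  fixes \<sigma> \<tau> :: "(int set \<Rightarrow> complex) \<Rightarrow> (nat \<Rightarrow> int) \<Rightarrow> (nat \<times> nat \<Rightarrow> complex) \<Rightarrow> complex"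
  assumes n: "n \<ge> 1"
    and a: "\<And>f g. F0 f \<Longrightarrow> F0 g \<Longrightarrow> \<sigma> (f + g) = (\<lambda>\<beta> x. \<sigma> f \<beta> x + \<sigma> g \<beta> x)"
      "\<And>f g. F0 f \<Longrightarrow> F0 g \<Longrightarrow> \<tau> (f + g) = (\<lambda>\<beta> x. \<tau> f \<beta> x + \<tau> g \<beta> x)"
    and s: "\<And>c f. F0 f \<Longrightarrow> \<sigma> (scl c f) = (\<lambda>\<beta> x. c * \<sigma> f \<beta> x)"
      "\<And>c f. F0 f \<Longrightarrow> \<tau> (scl c f) = (\<lambda>\<beta> x. c * \<tau> f \<beta> x)"
    and ch: "\<And>ps ks. valid_chain n ps \<Longrightarrow> ks \<in> Mlat n \<Longrightarrow>
        \<sigma> (alpha_chain n ps (qprod n ks)) = \<tau> (alpha_chain n ps (qprod n ks))"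
    and f: "F0 f"
  shows "\<sigma> f = \<tau> f"
proof -
  \<comment> \<open>Agreement is demanded after every chain of creation modes, not only on f itself;
    this makes \<open>V\<close> stable under these modes.\<close>
  define V where "V = {f. F0 f \<and> (\<forall>ps. valid_chain n ps \<longrightarrow> \<sigma> (alpha_chain n ps f) = \<tau> (alpha_chain n ps f))}"
  have fk: "fockv f" if "F0 f" for f using that by (simp add: F0_def)
  have V_scl: "scl c f \<in> V" if "f \<in> V" for c f
  proof -
    have "\<sigma> (alpha_chain n ps (scl c f)) = \<tau> (alpha_chain n ps (scl c f))" if ps: "valid_chain n ps" for ps
      using \<open>f \<in> V\<close> ps lin_scl[OF lin_alpha_chain[OF n ps], of f c] F0_alpha_chain[OF n ps, of f] s fk
      by (simp add: V_def)
    then show ?thesis using that by (simp add: V_def)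
  qed
  have V_add: "f + g \<in> V" if "f \<in> V" "g \<in> V" for f g
  proof -
    have "\<sigma> (alpha_chain n ps (f + g)) = \<tau> (alpha_chain n ps (f + g))" if ps: "valid_chain n ps" for ps
      using \<open>f \<in> V\<close> \<open>g \<in> V\<close> ps lin_add[OF lin_alpha_chain[OF n ps], of f g] F0_alpha_chain[OF n ps] a fk
      by (simp add: V_def)
    then show ?thesis using that by (simp add: V_def)
  qed
  have V_qprod: "qprod n ks \<in> V" if "ks \<in> Mlat n" for ks
    using ch that F0_qprod[OF n that] by (simp add: V_def)
  have V_0: "0 \<in> V"
  proof -
    have "(\<lambda>_. 0) \<in> Mlat n" by (simp add: Mlat_def)
    then show ?thesis using V_scl[OF V_qprod, of "\<lambda>_. 0" 0] by simp
  qed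
  have "0 \<in> V \<and> (\<forall>f\<in>V. \<forall>g\<in>V. f + g \<in> V)" using V_0 V_add by blast
  note V_sum = sum_in_closed[OF this]
  have V_alpha: "alpha n j (- k) f \<in> V" if "f \<in> V" "j \<in> {1..n}" "k \<ge> 1" for f j k
  proof -
    have F: "F0 (alpha n j (- k) f)" using that F0_alpha[OF n that(2), of "- k" f] by (simp add: V_def)
    have "\<sigma> (alpha_chain n ps (alpha n j (- k) f)) = \<tau> (alpha_chain n ps (alpha n j (- k) f))" if ps: "valid_chain n ps" for ps
    proof -
      have k: "int (nat k) = k" using \<open>k \<ge> 1\<close> by simp
      have "valid_chain n (ps @ [(j, nat k)])" using ps \<open>j \<in> {1..n}\<close> \<open>k \<ge> 1\<close> by auto
      then have "\<sigma> (alpha_chain n (ps @ [(j, nat k)]) f) = \<tau> (alpha_chain n (ps @ [(j, nat k)]) f)"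
        using \<open>f \<in> V\<close> unfolding V_def by blast
      then show ?thesis unfolding alpha_chain_snoc k .
    qed
    then show ?thesis using F by (simp add: V_def)
  qed
  have V_ev: "ev S \<in> V" if "maya S" "charge S = 0" for S
    using that
  proof (induction "en n S" arbitrary: S rule: less_induct)
    case less
    note S = less.prems
    show ?case
    proof (cases "en n S = 0")
      case True
      obtain \<gamma> where g: "\<And>l. l \<notin> {1..n} \<Longrightarrow> \<gamma> l = 0" "S = gnd n \<gamma>" using gnd_exists[OF n S(1) True] by blast
      then have M: "\<gamma> \<in> Mlat n" using S(2) charge_gnd[OF n, of \<gamma>] by (simp add: Mlat_def)
      obtain c where c: "c * c = 1" "qprod n \<gamma> = scl c (ev S)" using qprod_gnd[OF n, of \<gamma>] g by metis
      have "ev S = scl c (qprod n \<gamma>)" using c by simp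
      then show ?thesis using V_scl[OF V_qprod[OF M]] by simp
    next
      case False
      have low: "alpha n j k (ev S) \<in> V" if "k \<ge> 1" "j \<in> {1..n}" for k j
      proof -
        have k0: "k \<noteq> 0" using that by simp
        have "fockv (alpha n j k (ev S))" using S by (intro fockv_alpha[OF n that(2) k0]) simp
        then have "alpha n j k (ev S) = (\<Sum>T\<in>{T. alpha n j k (ev S) T \<noteq> 0}. scl (alpha n j k (ev S) T) (ev T))"
          by (rule fockv_expand)
        also have "\<dots> \<in> V"
        proof (rule V_sum)
          fix T assume "T \<in> {T. alpha n j k (ev S) T \<noteq> 0}"
          then have T: "maya T" "int (en n T) = int (en n S) - k" "charge T = charge S"
            using alpha_support_en[OF n that(2) k0 S(1)] by auto
          then have "ev T \<in> V" using S that(1) by (intro less.hyps) auto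
          then show "scl (alpha n j k (ev S) T) (ev T) \<in> V" by (rule V_scl)
        qed
        finally show ?thesis .
      qed
      obtain K where K: "(\<Sum>k\<in>{1..K}. \<Sum>j\<in>{1..n}. alpha n j (- k) (alpha n j k (ev S))) = scl (of_nat (en n S)) (ev S)"
        using energy_identity[OF n S(1)] by blast
      have "(\<Sum>k\<in>{1..K}. \<Sum>j\<in>{1..n}. alpha n j (- k) (alpha n j k (ev S))) \<in> V"
        using low V_alpha by (intro V_sum) auto
      then have "scl (1 / of_nat (en n S)) (scl (of_nat (en n S)) (ev S)) \<in> V" unfolding K by (rule V_scl)
      then show ?thesis using False by simp
    qed
  qed
  have "(\<Sum>S\<in>{S. f S \<noteq> 0}. scl (f S) (ev S)) \<in> V"
    using f by (intro V_sum V_scl V_ev) (auto simp: F0_def fockv_def)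
  then have "f \<in> V" using fockv_expand[OF fk[OF f]] by simp
  then have "\<sigma> (alpha_chain n [] f) = \<tau> (alpha_chain n [] f)" unfolding V_def by simp
  then show ?thesis by (simp add: alpha_chain_Nil)
qed

lemma sigma_eq:
  assumes n: "n \<ge> 1" shows "sigma n = SIG n"
  unfolding sigma_def
proof (rule the_equality, goal_cases)
  case 1
  have a: "SIG n (\<lambda>T. f T + g T) = (\<lambda>\<beta> x. SIG n f \<beta> x + SIG n g \<beta> x)" if "F0 f" "F0 g" for f g
    using that F0_add[OF that] Sig_add[of f g n] by (simp add: SIG_def plus_fun_def F0_def)
  have s: "SIG n (\<lambda>T. c * f T) = (\<lambda>\<beta> x. c * SIG n f \<beta> x)" if "F0 f" for c f
    using that F0_scl[OF that, of c] Sig_scl[of f n _ _ c] by (simp add: SIG_def scl_def F0_def)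
  have ch: "SIG n (alpha_chain n ps (qprod n ks)) = (\<lambda>\<beta> x. if \<beta> = ks then (\<Prod>(i, m)\<leftarrow>ps. of_nat m * x (i, m)) else 0)"
    if "valid_chain n ps" "ks \<in> Mlat n" for ps ks
    using F0_alpha_chain[OF n that(1) F0_qprod[OF n that(2)]] Sig_chain[OF n that]
    unfolding SIG_def by (simp add: fun_eq_iff)
  have z: "SIG n f = (\<lambda>\<beta> x. 0)" if "\<not> F0 f" for f using that by (simp add: SIG_def)
  show ?case using a s ch z by blast
  case (2 \<sigma>)
  then have A: "\<And>f g. F0 f \<Longrightarrow> F0 g \<Longrightarrow> \<sigma> (f + g) = (\<lambda>\<beta> x. \<sigma> f \<beta> x + \<sigma> g \<beta> x)"
    and S: "\<And>c f. F0 f \<Longrightarrow> \<sigma> (scl c f) = (\<lambda>\<beta> x. c * \<sigma> f \<beta> x)"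
    and Z: "\<And>f. \<not> F0 f \<Longrightarrow> \<sigma> f = (\<lambda>\<beta> x. 0)"
    and C: "\<And>ps ks. valid_chain n ps \<Longrightarrow> ks \<in> Mlat n \<Longrightarrow> \<sigma> (alpha_chain n ps (qprod n ks)) =
          (\<lambda>\<beta> x. if \<beta> = ks then (\<Prod>(i, m)\<leftarrow>ps. of_nat m * x (i, m)) else 0)"
    unfolding plus_fun_def scl_def by blast+
  have "\<sigma> f = SIG n f" for f
  proof (cases "F0 f")
    case True
    show ?thesis
    proof (rule sigma_unique[OF n A _ S _ _ True])
      show "SIG n (f + g) = (\<lambda>\<beta> x. SIG n f \<beta> x + SIG n g \<beta> x)" if "F0 f" "F0 g" for f g
        using a[OF that] unfolding plus_fun_def .
      show "SIG n (scl c f) = (\<lambda>\<beta> x. c * SIG n f \<beta> x)" if "F0 f" for c f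
        using s[OF that] unfolding scl_def .
    qed (use C ch in auto)
  qed (use Z z in auto)
  then show ?case by blast
qed

section \<open>Determinants and wedges\<close>

text \<open>Entries are a function of two indices, so deleting, moving or replacing rows and columns
  amounts to changing the function, while the matrix library still supplies the theorems.\<close>

definition dt :: "nat \<Rightarrow> (nat \<Rightarrow> nat \<Rightarrow> complex) \<Rightarrow> complex" where
  "dt m A = Determinant.det (Matrix.mat m m (\<lambda>(a, b). A a b))"

lemma dt_sum: "dt m A = (\<Sum>\<pi>\<in>{\<pi>. \<pi> permutes {..<m}}. of_int (sign \<pi>) * (\<Prod>a<m. A a (\<pi> a)))"
proof -
  have "dt m A = (\<Sum>\<pi>\<in>{\<pi>. \<pi> permutes {0..<m}}. of_int (sign \<pi>) * (\<Prod>a\<in>{0..<m}. Matrix.mat m m (\<lambda>(a, b). A a b) $$ (a, \<pi> a)))"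
    unfolding dt_def by (subst Determinant.det_def) simp
  also have "\<dots> = (\<Sum>\<pi>\<in>{\<pi>. \<pi> permutes {0..<m}}. of_int (sign \<pi>) * (\<Prod>a\<in>{0..<m}. A a (\<pi> a)))"
  proof (intro sum.cong refl arg_cong2[where f = "(*)"] prod.cong)
    fix \<pi> a assume "\<pi> \<in> {\<pi>. \<pi> permutes {0..<m}}" "a \<in> {0..<m}"
    moreover from this have "\<pi> a \<in> {0..<m}" using permutes_in_image by fastforce
    ultimately show "Matrix.mat m m (\<lambda>(a, b). A a b) $$ (a, \<pi> a) = A a (\<pi> a)" by simp
  qed
  finally show ?thesis by (simp add: atLeast0LessThan)
qed

lemma dt_cong: "(\<And>a b. a < m \<Longrightarrow> b < m \<Longrightarrow> A a b = B a b) \<Longrightarrow> dt m A = dt m B"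
  unfolding dt_def by (intro arg_cong[where f = Determinant.det] eq_matI) auto

lemma dt_zero_row: "a < m \<Longrightarrow> (\<And>b. b < m \<Longrightarrow> A a b = 0) \<Longrightarrow> dt m A = 0"
  unfolding dt_sum
proof (rule sum.neutral, intro ballI)
  fix \<pi> assume a: "a < m" "\<And>b. b < m \<Longrightarrow> A a b = 0" and p: "\<pi> \<in> {\<pi>. \<pi> permutes {..<m}}"
  then have "\<pi> a < m" using permutes_in_image[of \<pi> "{..<m}" a] by simp
  then have "(\<Prod>a<m. A a (\<pi> a)) = 0" using a by (intro prod_zero) auto
  then show "of_int (sign \<pi>) * (\<Prod>a<m. A a (\<pi> a)) = 0" by simp
qed

lemma dt_identical_rows:
  assumes "a < m" "a' < m" "a \<noteq> a'" "\<And>b. b < m \<Longrightarrow> A a b = A a' b"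
  shows "dt m A = 0"
  unfolding dt_def
  by (rule det_identical_rows[of _ m a a']) (use assms in \<open>auto intro!: eq_vecI\<close>)

lemma dt_mult: "dt m (\<lambda>a b. \<Sum>c<m. A a c * B c b) = dt m A * dt m B"
proof -
  let ?A = "Matrix.mat m m (\<lambda>(a, b). A a b)" and ?B = "Matrix.mat m m (\<lambda>(a, b). B a b)"
  have "Determinant.det (?A * ?B) = dt m A * dt m B"
    unfolding dt_def by (rule Determinant.det_mult) auto
  moreover have "?A * ?B = Matrix.mat m m (\<lambda>(a, b). \<Sum>c<m. A a c * B c b)"
    by (rule eq_matI) (auto simp: scalar_prod_def atLeast0LessThan)
  ultimately show ?thesis by (simp add: dt_def)
qed

lemma dt_unitriangular:
  assumes "\<And>a b. b < a \<Longrightarrow> a < m \<Longrightarrow> A a b = 0" "\<And>a. a < m \<Longrightarrow> A a a = 1"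
  shows "dt m A = 1"
proof -
  let ?A = "Matrix.mat m m (\<lambda>(a, b). A a b)"
  have "Determinant.det ?A = prod_list (diag_mat ?A)"
    using assms by (intro det_upper_triangular[of _ m]) (auto simp: upper_triangular_def)
  also have "diag_mat ?A = map (\<lambda>_. 1) [0..<m]" using assms(2) by (auto simp: diag_mat_def)
  finally show ?thesis by (simp add: dt_def prod_list_replicate map_replicate_const)
qed

lemma dt_laplace:
  assumes "i < Suc m"
  shows "dt (Suc m) A = (\<Sum>b<Suc m. A i b * ((-1) ^ (i + b) *
    dt m (\<lambda>a b'. A (if a < i then a else Suc a) (if b' < b then b' else Suc b'))))"
proof -
  let ?A = "Matrix.mat (Suc m) (Suc m) (\<lambda>(a, b). A a b)"
  have "dt (Suc m) A = (\<Sum>b<Suc m. ?A $$ (i, b) * cofactor ?A i b)"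
    unfolding dt_def by (rule laplace_expansion_row) (use assms in auto)
  also have "\<dots> = (\<Sum>b<Suc m. A i b * ((-1) ^ (i + b) *
    dt m (\<lambda>a b'. A (if a < i then a else Suc a) (if b' < b then b' else Suc b'))))"
  proof (intro sum.cong refl arg_cong2[where f = "(*)"])
    fix b assume b: "b \<in> {..<Suc m}"
    show "?A $$ (i, b) = A i b" using b assms by simp
    show "cofactor ?A i b = (-1) ^ (i + b) * dt m (\<lambda>a b'. A (if a < i then a else Suc a) (if b' < b then b' else Suc b'))"
      unfolding cofactor_def dt_def mat_delete_def
      by (intro arg_cong2[where f = "(*)"] refl arg_cong[where f = Determinant.det] eq_matI) auto
  qed
  finally show ?thesis .
qed

text \<open>Multilinearity in the rows, with one label chosen freely for each row. The choices are
  not grouped by their image, as they would be in the Cauchy-Binet formula; repeated labels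
  contribute zero by themselves.\<close>

lemma dt_expand_rows:
  assumes "finite Q"
  shows "dt m (\<lambda>a b. \<Sum>q\<in>Q. u a q * k q b) =
    (\<Sum>f\<in>PiE {..<m} (\<lambda>_. Q). (\<Prod>a<m. u a (f a)) * dt m (\<lambda>a b. k (f a) b))"
proof -
  have "dt m (\<lambda>a b. \<Sum>q\<in>Q. u a q * k q b) =
    (\<Sum>\<pi>\<in>{\<pi>. \<pi> permutes {..<m}}. of_int (sign \<pi>) * (\<Sum>f\<in>PiE {..<m} (\<lambda>_. Q). \<Prod>a<m. u a (f a) * k (f a) (\<pi> a)))"
    unfolding dt_sum using assms by (subst prod_sum_PiE) auto
  also have "\<dots> = (\<Sum>f\<in>PiE {..<m} (\<lambda>_. Q). (\<Prod>a<m. u a (f a)) * dt m (\<lambda>a b. k (f a) b))"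
    unfolding dt_sum sum_distrib_left prod.distrib
    by (subst sum.swap) (simp add: mult_ac)
  finally show ?thesis .
qed

section \<open>Decreasing lists and strings of labels\<close>

definition dl :: "int set \<Rightarrow> int list" where
  "dl A = rev (sorted_list_of_set A)"

lemma dl_props:
  assumes "finite A" shows "set (dl A) = A" "distinct (dl A)" "length (dl A) = card A" "sorted_wrt (>) (dl A)"
  using assms by (simp_all add: dl_def sorted_wrt_rev)

lemma dl_nth: "finite A \<Longrightarrow> b < card A \<Longrightarrow> dl A ! b \<in> A"
  using dl_props(1,3)[of A] nth_mem[of b "dl A"] by simp

lemma dl_eqI: assumes "sorted_wrt (>) xs" shows "dl (set xs) = xs"
proof -
  have "sorted_wrt (<) (rev xs)" using assms by (simp add: sorted_wrt_rev)
  then have "sorted_list_of_set (set (rev xs)) = rev xs"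
    by (intro sorted_list_of_set.idem_if_sorted_distinct) (auto simp: strict_sorted_iff)
  then show ?thesis by (simp add: dl_def)
qed

lemma dl_split:
  assumes "finite A" "q \<in> A"
  shows "dl A = dl {s\<in>A. s > q} @ q # dl {s\<in>A. s < q}" "dl (A - {q}) = dl {s\<in>A. s > q} @ dl {s\<in>A. s < q}"
proof -
  have f: "finite {s\<in>A. s > q}" "finite {s\<in>A. s < q}" using assms by auto
  have "sorted_wrt (>) (dl {s\<in>A. s > q} @ q # dl {s\<in>A. s < q})" "sorted_wrt (>) (dl {s\<in>A. s > q} @ dl {s\<in>A. s < q})"
    unfolding sorted_wrt_append sorted_wrt.simps set_simps dl_props(1)[OF f(1)] dl_props(1)[OF f(2)]
    using dl_props(4)[OF f(1)] dl_props(4)[OF f(2)] by auto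
  moreover have "set (dl {s\<in>A. s > q} @ q # dl {s\<in>A. s < q}) = A" "set (dl {s\<in>A. s > q} @ dl {s\<in>A. s < q}) = A - {q}"
    unfolding set_append set_simps dl_props(1)[OF f(1)] dl_props(1)[OF f(2)] using assms(2) by auto
  ultimately show "dl A = dl {s\<in>A. s > q} @ q # dl {s\<in>A. s < q}" "dl (A - {q}) = dl {s\<in>A. s > q} @ dl {s\<in>A. s < q}"
    using dl_eqI[of "dl {s\<in>A. s > q} @ q # dl {s\<in>A. s < q}"] dl_eqI[of "dl {s\<in>A. s > q} @ dl {s\<in>A. s < q}"] by simp_all
qed

definition wcond :: "int \<Rightarrow> nat \<Rightarrow> int set \<Rightarrow> bool" where
  "wcond c m T \<longleftrightarrow> {..c} \<subseteq> T \<and> finite (T - {..c}) \<and> card (T - {..c}) = m"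

lemma wedgeW_dt: "wedgeW N w T = (if wcond (- int N) N T then dt N (\<lambda>a b. w a (dl (T - {..- int N}) ! b)) else 0)"
  unfolding wedgeW_def wcond_def dl_def dt_sum Let_def by simp

text \<open>The wedge of the vectors labelled q 0, ..., q (m - 1) over the sea at c. The labels may
  be unsorted, repeated or inside the sea, so a current can change a single entry without any
  reordering.\<close>

definition strg :: "int \<Rightarrow> nat \<Rightarrow> (nat \<Rightarrow> int) \<Rightarrow> int set \<Rightarrow> complex" where
  "strg c m q = foldr psi_plus (map q [0..<m]) (ev {..c})"

lemma strg_0: "strg c 0 q = ev {..c}" by (simp add: strg_def)

lemma strg_Suc: "strg c (Suc m) q = psi_plus (q 0) (strg c m (q \<circ> Suc))"
proof -
  have "map q [0..<Suc m] = q 0 # map (q \<circ> Suc) [0..<m]"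
    by (metis list.simps(9) map_Suc_upt map_map upt_conv_Cons zero_less_Suc)
  then show ?thesis by (simp add: strg_def)
qed

lemma fockv_strg [simp]: "fockv (strg c m q)"
  by (induction m arbitrary: q) (simp_all add: strg_0 strg_Suc)

text \<open>The Laplace expansion along the first row mirrors the outermost creation operator: that
  row has at most one entry 1.\<close>

lemma strg_eval: "strg c m q T = (if wcond c m T then dt m (\<lambda>a b. if q a = dl (T - {..c}) ! b then 1 else 0) else 0)"
proof (induction m arbitrary: q T)
  case 0
  have "wcond c 0 T \<longleftrightarrow> T = {..c}" by (auto simp: wcond_def)
  then show ?case by (simp add: strg_0 ev_def dt_sum)
next
  case (Suc m)
  let ?q = "q 0"
  have lhs: "strg c (Suc m) q T = (if ?q \<in> T then (-1) ^ card {s \<in> T. s > ?q} * strg c m (q \<circ> Suc) (T - {?q}) else 0)"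
    unfolding strg_Suc psi_plus_def ..
  have wc: "wcond c m (T - {?q}) \<longleftrightarrow> wcond c (Suc m) T \<and> ?q > c" if "?q \<in> T"
  proof -
    have e: "T - {?q} - {..c} = T - {..c} - {?q}" by blast
    have sub: "{..c} \<subseteq> T - {?q} \<longleftrightarrow> {..c} \<subseteq> T \<and> ?q > c"
      unfolding subset_iff atMost_iff Diff_iff singleton_iff not_le[symmetric] by blast
    have "card (T - {..c} - {?q}) = m \<longleftrightarrow> card (T - {..c}) = Suc m" if "finite (T - {..c})" "?q > c"
    proof -
      have "?q \<in> T - {..c}" using that \<open>?q \<in> T\<close> by auto
      then show ?thesis using that(1) card_Suc_Diff1[of "T - {..c}" ?q] by linarith
    qed
    then show ?thesis unfolding wcond_def e sub finite_Diff_insert Diff_empty by blast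
  qed
  show ?case
  proof (cases "wcond c (Suc m) T")
    case False
    then show ?thesis unfolding lhs Suc.IH using wc by auto
  next
    case True
    define L where "L = dl (T - {..c})"
    have fin: "finite (T - {..c})" and card: "card (T - {..c}) = Suc m" using True by (auto simp: wcond_def)
    have setL: "set L = T - {..c}" and lenL: "length L = Suc m" and dL: "distinct L"
      unfolding L_def using dl_props(1-3)[OF fin] card by simp_all
    show ?thesis
    proof (cases "?q \<in> T - {..c}")
      case False
      have "?q \<noteq> L ! b" if "b < Suc m" for b using False dl_nth[OF fin, of b] card that unfolding L_def by metis
      then have "dt (Suc m) (\<lambda>a b. if q a = L ! b then 1 else 0) = 0" by (intro dt_zero_row[of 0]) auto
      moreover have "strg c (Suc m) q T = 0"
      proof (cases "?q \<in> T")
        case t: True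
        then have "?q \<le> c" using False by auto
        then have "\<not> wcond c m (T - {?q})" using wc[OF t] by auto
        then show ?thesis unfolding lhs Suc.IH by simp
      qed (simp add: lhs)
      ultimately show ?thesis using True unfolding L_def by simp
    next
      case q: True
      define X where "X = dl {s \<in> T - {..c}. s > ?q}"
      define Y where "Y = dl {s \<in> T - {..c}. s < ?q}"
      have L: "L = X @ ?q # Y" and L': "dl (T - {..c} - {?q}) = X @ Y"
        using dl_split[OF fin q] by (simp_all add: L_def X_def Y_def)
      have lenX: "length X = card {s \<in> T. s > ?q}"
      proof -
        have "{s \<in> T - {..c}. s > ?q} = {s \<in> T. s > ?q}" using q by auto
        moreover have "finite {s \<in> T - {..c}. s > ?q}" by (rule finite_subset[OF _ fin]) auto
        then have "length X = card {s \<in> T - {..c}. s > ?q}" unfolding X_def by (rule dl_props(3))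
        ultimately show ?thesis by simp
      qed
      \<comment> \<open>The column of this entry is the number of labels above \<open>q 0\<close>,
        which is the exponent of the sign in \<open>psi_plus\<close>.\<close>
      define B where "B = length X"
      have B: "B < Suc m" "L ! B = ?q" using L lenL by (auto simp: B_def)
      have "dt (Suc m) (\<lambda>a b. if q a = L ! b then 1 else 0) = (\<Sum>b<Suc m. (if ?q = L ! b then 1 else 0) * ((-1) ^ (0 + b) *
          dt m (\<lambda>a b'. if q (if a < 0 then a else Suc a) = L ! (if b' < b then b' else Suc b') then 1 else 0)))"
        by (rule dt_laplace) simp
      also have "\<dots> = (\<Sum>b<Suc m. if b = B then (-1) ^ B *
          dt m (\<lambda>a b'. if q (Suc a) = L ! (if b' < B then b' else Suc b') then 1 else 0) else 0)"
      proof (rule sum.cong[OF refl])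
        fix b assume b: "b \<in> {..<Suc m}"
        have "?q = L ! b \<longleftrightarrow> b = B" using B b lenL nth_eq_iff_index_eq[OF dL, of b B] by auto
        then show "(if ?q = L ! b then 1 else 0) * ((-1) ^ (0 + b) *
          dt m (\<lambda>a b'. if q (if a < 0 then a else Suc a) = L ! (if b' < b then b' else Suc b') then 1 else 0)) =
          (if b = B then (-1) ^ B * dt m (\<lambda>a b'. if q (Suc a) = L ! (if b' < B then b' else Suc b') then 1 else 0) else 0)"
          by simp
      qed
      also have "\<dots> = (-1) ^ B * dt m (\<lambda>a b'. if q (Suc a) = L ! (if b' < B then b' else Suc b') then 1 else 0)"
        using B by simp
      also have "dt m (\<lambda>a b'. if q (Suc a) = L ! (if b' < B then b' else Suc b') then 1 else 0) =
         dt m (\<lambda>a b'. if q (Suc a) = (X @ Y) ! b' then 1 else 0)"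
        unfolding L B_def by (intro dt_cong) (auto simp: nth_append)
      also have "(-1) ^ B * dt m (\<lambda>a b'. if q (Suc a) = (X @ Y) ! b' then 1 else 0) = strg c (Suc m) q T"
      proof -
        have "?q \<in> T" "wcond c m (T - {?q})" using q wc True by auto
        moreover have "T - {?q} - {..c} = T - {..c} - {?q}" by blast
        ultimately show ?thesis unfolding lhs Suc.IH by (simp add: B_def lenX L')
      qed
      finally show ?thesis using True unfolding L_def by simp
    qed
  qed
qed

text \<open>A positive mode is a derivation that annihilates the sea, so it lowers one label of the
  string at a time.\<close>

lemma alpha_strg:
  assumes n: "n \<ge> 1" "j \<in> {1..n}" "k > 0"
  shows "alpha n j k (strg c m q) = (\<Sum>a<m. if colour n (q a) = j then strg c m (q(a := q a - int n * k)) else 0)"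
proof (induction m arbitrary: q)
  case 0
  have "alpha n j k (strg c 0 q) = 0" unfolding strg_0 by (rule alpha_sea[OF n])
  then show ?case by (simp add: zero_fun_def)
next
  case (Suc m)
  have k0: "k \<noteq> 0" using n by simp
  let ?q = "q \<circ> Suc"
  have u: "(q(Suc a := y)) \<circ> Suc = ?q(a := y)" "(q(0 := y)) \<circ> Suc = ?q" for a y by (auto simp: fun_eq_iff)
  have IH: "alpha n j k (strg c m ?q) = (\<Sum>a<m. if colour n (?q a) = j then strg c m (?q(a := ?q a - int n * k)) else 0)"
    by (rule Suc.IH)
  have s1: "psi_plus (q 0) (\<Sum>a<m. if colour n (?q a) = j then strg c m (?q(a := ?q a - int n * k)) else 0) =
    (\<Sum>a<m. if colour n (q (Suc a)) = j then strg c (Suc m) (q(Suc a := q (Suc a) - int n * k)) else 0)"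
  proof -
    have "psi_plus (q 0) (\<Sum>a<m. if colour n (?q a) = j then strg c m (?q(a := ?q a - int n * k)) else 0) =
      (\<Sum>a<m. psi_plus (q 0) (if colour n (?q a) = j then strg c m (?q(a := ?q a - int n * k)) else 0))"
      by (rule lin_sum[OF lin_psi_plus]) simp
    also have "\<dots> = (\<Sum>a<m. if colour n (q (Suc a)) = j then strg c (Suc m) (q(Suc a := q (Suc a) - int n * k)) else 0)"
      by (rule sum.cong) (simp_all add: strg_Suc u)
    finally show ?thesis .
  qed
  have "alpha n j k (strg c (Suc m) q) = psi_plus (q 0) (alpha n j k (strg c m ?q)) +
     (if colour n (q 0) = j then psi_plus (q 0 - int n * k) (strg c m ?q) else 0)"
    unfolding strg_Suc by (rule alpha_psi_plus[OF n(1,2) k0 fockv_strg])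
  also have "psi_plus (q 0) (alpha n j k (strg c m ?q)) =
      (\<Sum>a<m. if colour n (q (Suc a)) = j then strg c (Suc m) (q(Suc a := q (Suc a) - int n * k)) else 0)"
    unfolding IH by (rule s1)
  also have "psi_plus (q 0 - int n * k) (strg c m ?q) = strg c (Suc m) (q(0 := q 0 - int n * k))"
    by (simp add: strg_Suc u)
  finally have "alpha n j k (strg c (Suc m) q) =
    (\<Sum>a<m. if colour n (q (Suc a)) = j then strg c (Suc m) (q(Suc a := q (Suc a) - int n * k)) else 0) +
    (if colour n (q 0) = j then strg c (Suc m) (q(0 := q 0 - int n * k)) else 0)" .
  then have "alpha n j k (strg c (Suc m) q) =
    (\<Sum>a<Suc m. if colour n (q a) = j then strg c (Suc m) (q(a := q a - int n * k)) else 0)"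
    unfolding sum.lessThan_Suc_shift by (simp only: add.commute)
  then show ?case .
qed

text \<open>Coefficients of H = exp(\<Sum> y_k t^k), by the recursion equivalent to t dH/dt =
  (\<Sum> k y_k t^k) H. Its shape is that of Euler's identity in \<open>sgm\<close>, which is what
  allows the two to be compared.\<close>

fun hh :: "(nat \<Rightarrow> complex) \<Rightarrow> nat \<Rightarrow> complex" where
  "hh y 0 = 1"
| "hh y (Suc m) = (\<Sum>k\<in>{1..Suc m}. of_nat k * y k * hh y (Suc m - k)) / of_nat (Suc m)"

lemma hh_rec: "of_nat m * hh y m = (\<Sum>k\<in>{1..m}. of_nat k * y k * hh y (m - k))"
  by (cases m) (simp_all del: of_nat_Suc)

text \<open>The matrix of \<open>exp (\<xi> x)\<close> in the basis of labels; the \<open>hh\<close> are the coefficients of the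
  exponential series.\<close>
definition gker :: "nat \<Rightarrow> (nat \<times> nat \<Rightarrow> complex) \<Rightarrow> int \<Rightarrow> int \<Rightarrow> complex" where
  "gker n x p q = (if p \<le> q \<and> colour n p = colour n q
     then hh (\<lambda>k. x (colour n p, k)) (nat (lev n q - lev n p)) else 0)"

text \<open>Euler's identity for one particle: the level difference of q and p takes the part of the
  energy, and lowering q by n k that of the current.\<close>

lemma gker_rec:
  assumes n: "n \<ge> 1" and K: "lev n q - lev n p \<le> int K"
  shows "(\<Sum>k\<in>{1..K}. of_nat k * x (colour n q, k) * gker n x p (q - int n * int k)) =
    of_int (lev n q - lev n p) * gker n x p q"
proof (cases "p \<le> q \<and> colour n p = colour n q")
  case True
  define m where "m = nat (lev n q - lev n p)"
  have m: "lev n q - lev n p = int m" using lev_mono[OF n, of p q] True by (simp add: m_def)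
  have q: "q = p + int n * int m"
    using colour_lev[OF n, of p] colour_lev[OF n, of q] True m by (simp add: algebra_simps flip: m)
  have g: "gker n x p (q - int n * int k) = (if k \<le> m then hh (\<lambda>k. x (colour n p, k)) (m - k) else 0)" for k
  proof -
    have "p \<le> q - int n * int k \<longleftrightarrow> int n * int k \<le> int n * int m" unfolding q by auto
    also have "\<dots> \<longleftrightarrow> k \<le> m" using n by simp
    finally have le: "p \<le> q - int n * int k \<longleftrightarrow> k \<le> m" .
    have "lev n (q - int n * int k) = lev n q - int k" using lev_add[OF n, of q "- int k"] by simp
    then have "nat (lev n (q - int n * int k) - lev n p) = m - k" using m by simp
    then show ?thesis using le True unfolding gker_def by simp
  qed
  have "(\<Sum>k\<in>{1..K}. of_nat k * x (colour n q, k) * gker n x p (q - int n * int k)) =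
    (\<Sum>k\<in>{1..m}. of_nat k * x (colour n p, k) * hh (\<lambda>k. x (colour n p, k)) (m - k))"
    using K m True by (intro sum.mono_neutral_cong_right) (auto simp: g)
  also have "\<dots> = of_nat m * gker n x p q"
    using True hh_rec[of m "\<lambda>k. x (colour n p, k)"] by (simp add: gker_def m)
  finally show ?thesis by (simp add: m)
next
  case False
  have "gker n x p (q - int n * int k) = 0" for k
  proof -
    have "int n * int k \<ge> 0" by simp
    then have "p \<le> q - int n * int k \<Longrightarrow> p \<le> q" by linarith
    then have "\<not> (p \<le> q - int n * int k \<and> colour n p = colour n (q - int n * int k))" using False by auto
    then show ?thesis unfolding gker_def by (rule if_not_P)
  qed
  moreover have "gker n x p q = 0" using False unfolding gker_def by (rule if_not_P)
  ultimately show ?thesis by simp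
qed

lemma gker_same: "gker n x p p = 1"
  by (simp add: gker_def)

lemma strg_zero:
  assumes "a < m" "q a \<le> c" shows "strg c m q = 0"
proof
  fix T
  have "dt m (\<lambda>a b. if q a = dl (T - {..c}) ! b then 1 else 0) = 0" if w: "wcond c m T"
  proof (rule dt_zero_row[OF assms(1)])
    fix b assume "b < m"
    then have "dl (T - {..c}) ! b \<in> T - {..c}"
      using w dl_nth[of "T - {..c}" b] by (simp add: wcond_def)
    then show "(if q a = dl (T - {..c}) ! b then 1 else 0) = (0::complex)" using assms(2) by auto
  qed
  then show "strg c m q T = 0 T" by (simp add: strg_eval)
qed

lemma strg_not_inj:
  assumes "\<not> inj_on q {..<m}" shows "strg c m q = 0"
proof
  fix T
  obtain a a' where "a < m" "a' < m" "a \<noteq> a'" "q a = q a'" using assms by (auto simp: inj_on_def)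
  then have "dt m (\<lambda>a b. if q a = dl (T - {..c}) ! b then 1 else 0) = 0"
    by (intro dt_identical_rows[of a m a']) auto
  then show "strg c m q T = 0 T" by (simp add: strg_eval)
qed

lemma strg_inj:
  assumes "inj_on q {..<m}" "\<And>a. a < m \<Longrightarrow> q a > c"
  shows "strg c m q = scl (dt m (\<lambda>a b. if q a = dl (q ` {..<m}) ! b then 1 else 0)) (ev ({..c} \<union> q ` {..<m}))"
proof
  fix T
  let ?S = "{..c} \<union> q ` {..<m}"
  have S: "?S - {..c} = q ` {..<m}" using assms(2) by force
  show "strg c m q T = scl (dt m (\<lambda>a b. if q a = dl (q ` {..<m}) ! b then 1 else 0)) (ev ?S) T"
  proof (cases "T = ?S")
    case True
    have "wcond c m ?S" unfolding wcond_def S using assms(1) by (auto simp: card_image)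
    then show ?thesis using True S by (simp add: strg_eval ev_def)
  next
    case False
    have "dt m (\<lambda>a b. if q a = dl (T - {..c}) ! b then 1 else 0) = 0" if w: "wcond c m T"
    proof -
      have f: "finite (T - {..c})" "card (T - {..c}) = m" "{..c} \<subseteq> T" using w by (auto simp: wcond_def)
      have "\<not> q ` {..<m} \<subseteq> T - {..c}"
      proof
        assume "q ` {..<m} \<subseteq> T - {..c}"
        moreover have "card (q ` {..<m}) = m" using assms(1) by (simp add: card_image)
        ultimately have "q ` {..<m} = T - {..c}" using f by (intro card_subset_eq) auto
        then show False using f(3) False by auto
      qed
      then obtain a where a: "a < m" "q a \<notin> T - {..c}" by auto
      have "q a \<noteq> dl (T - {..c}) ! b" if "b < m" for b
        using a(2) f(2) dl_nth[OF f(1), of b] that by metis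
      then show ?thesis by (intro dt_zero_row[OF a(1)]) auto
    qed
    then show ?thesis using False by (simp add: strg_eval ev_def)
  qed
qed

text \<open>Charge zero makes the number of ground labels above - M equal to M, so these labels can
  index the columns of a square matrix.\<close>

lemma gnd_list:
  assumes n: "n \<ge> 1" and \<gamma>: "\<gamma> \<in> Mlat n" and c: "{..- int M} \<subseteq> gnd n \<gamma>"
  defines "P \<equiv> dl (gnd n \<gamma> - {..- int M})"
  shows "length P = M" "set P = gnd n \<gamma> \<inter> {- int M<..}" "distinct P" "sorted_wrt (>) P"
proof -
  have e: "gnd n \<gamma> - {..- int M} = gnd n \<gamma> \<inter> {- int M<..}" by auto
  have f: "finite (gnd n \<gamma> - {..- int M})"
    using maya_finite_above[OF maya_gnd[OF n], of \<gamma> "- int M"] unfolding e by (simp add: Int_def)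
  have "int (card (gnd n \<gamma> \<inter> {- int M<..})) + (- int M) = 0"
    using charge_top[OF maya_gnd[OF n] c] charge_gnd[OF n, of \<gamma>] \<gamma> by (simp add: Mlat_def)
  then show "length P = M" using dl_props(3)[OF f] unfolding P_def e by simp
  show "set P = gnd n \<gamma> \<inter> {- int M<..}" "distinct P" "sorted_wrt (>) P"
    using dl_props[OF f] unfolding P_def by (simp_all add: e)
qed

section \<open>Minors of the exponential and Euler's identity\<close>

lemma dt_gker_upd:
  assumes a: "a < M"
  shows "dt M (\<lambda>a' b. gker n x (P ! b) ((q(a := y)) a')) =
   (\<Sum>\<pi>\<in>{\<pi>. \<pi> permutes {..<M}}. of_int (sign \<pi>) * (gker n x (P ! \<pi> a) y * (\<Prod>a'\<in>{..<M} - {a}. gker n x (P ! \<pi> a') (q a'))))"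
proof -
  have "(\<Prod>a'<M. gker n x (P ! \<pi> a') ((q(a := y)) a')) =
     gker n x (P ! \<pi> a) y * (\<Prod>a'\<in>{..<M} - {a}. gker n x (P ! \<pi> a') (q a'))" for \<pi>
  proof -
    have "(\<Prod>a'<M. gker n x (P ! \<pi> a') ((q(a := y)) a')) = gker n x (P ! \<pi> a) ((q(a := y)) a) *
      (\<Prod>a'\<in>{..<M} - {a}. gker n x (P ! \<pi> a') ((q(a := y)) a'))"
      using a by (intro prod.remove) auto
    then show ?thesis by simp
  qed
  then show ?thesis unfolding dt_sum by simp
qed

lemma sum_swap3: "(\<Sum>k\<in>A. \<Sum>a\<in>B. \<Sum>p\<in>C. f k a p) = (\<Sum>p\<in>C. \<Sum>a\<in>B. \<Sum>k\<in>A. f k a p)"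
  for f :: "_ \<Rightarrow> _ \<Rightarrow> _ \<Rightarrow> complex"
proof -
  have "(\<Sum>k\<in>A. \<Sum>a\<in>B. \<Sum>p\<in>C. f k a p) = (\<Sum>a\<in>B. \<Sum>k\<in>A. \<Sum>p\<in>C. f k a p)" by (rule sum.swap)
  also have "\<dots> = (\<Sum>a\<in>B. \<Sum>p\<in>C. \<Sum>k\<in>A. f k a p)" by (intro sum.cong refl sum.swap)
  also have "\<dots> = (\<Sum>p\<in>C. \<Sum>a\<in>B. \<Sum>k\<in>A. f k a p)" by (rule sum.swap)
  finally show ?thesis .
qed

text \<open>In the term of a permutation \<pi>, lowering the label of row a yields by
  \<open>gker_rec\<close> the factor lev (q a) - lev (P ! \<pi> a). Summed over a, these factors
  give the difference of the total levels, independent of \<pi>, which can be taken out of the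
  determinant.\<close>

lemma dt_gker_euler:
  assumes n: "n \<ge> 1" and K: "\<And>a b. a < M \<Longrightarrow> b < M \<Longrightarrow> lev n (q a) - lev n (P ! b) \<le> int K"
  shows "(\<Sum>k\<in>{1..K}. \<Sum>a<M. of_nat k * x (colour n (q a), k) *
      dt M (\<lambda>a' b. gker n x (P ! b) ((q(a := q a - int n * int k)) a'))) =
    of_int ((\<Sum>a<M. lev n (q a)) - (\<Sum>b<M. lev n (P ! b))) * dt M (\<lambda>a b. gker n x (P ! b) (q a))"
proof -
  let ?R = "\<lambda>\<pi> a. \<Prod>a'\<in>{..<M} - {a}. gker n x (P ! \<pi> a') (q a')"
  let ?per = "{\<pi>. \<pi> permutes {..<M}}"
  let ?g = "\<lambda>\<pi> a k. gker n x (P ! \<pi> a) (q a - int n * int k)"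
  have "(\<Sum>k\<in>{1..K}. \<Sum>a<M. of_nat k * x (colour n (q a), k) *
      dt M (\<lambda>a' b. gker n x (P ! b) ((q(a := q a - int n * int k)) a'))) =
    (\<Sum>k\<in>{1..K}. \<Sum>a<M. \<Sum>\<pi>\<in>?per. of_int (sign \<pi>) * ((of_nat k * x (colour n (q a), k) * ?g \<pi> a k) * ?R \<pi> a))"
  proof (intro sum.cong refl)
    fix k a assume "a \<in> {..<M}"
    then have a: "a < M" by simp
    show "of_nat k * x (colour n (q a), k) * dt M (\<lambda>a' b. gker n x (P ! b) ((q(a := q a - int n * int k)) a')) =
      (\<Sum>\<pi>\<in>?per. of_int (sign \<pi>) * ((of_nat k * x (colour n (q a), k) * ?g \<pi> a k) * ?R \<pi> a))"
      unfolding dt_gker_upd[OF a] sum_distrib_left by (intro sum.cong refl) (simp only: mult_ac)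
  qed
  also have "\<dots> = (\<Sum>\<pi>\<in>?per. \<Sum>a<M. \<Sum>k\<in>{1..K}. of_int (sign \<pi>) * ((of_nat k * x (colour n (q a), k) * ?g \<pi> a k) * ?R \<pi> a))"
    by (rule sum_swap3)
  also have "\<dots> = (\<Sum>\<pi>\<in>?per. of_int (sign \<pi>) * (\<Sum>a<M. (\<Sum>k\<in>{1..K}. of_nat k * x (colour n (q a), k) * ?g \<pi> a k) * ?R \<pi> a))"
    by (simp add: sum_distrib_left sum_distrib_right)
  also have "\<dots> = (\<Sum>\<pi>\<in>?per. of_int (sign \<pi>) * (of_int ((\<Sum>a<M. lev n (q a)) - (\<Sum>b<M. lev n (P ! b))) *
      (\<Prod>a<M. gker n x (P ! \<pi> a) (q a))))"
  proof (intro sum.cong refl arg_cong2[where f = "(*)"])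
    fix \<pi> assume "\<pi> \<in> ?per"
    then have \<pi>: "\<pi> permutes {..<M}" by simp
    have "(\<Sum>a<M. (\<Sum>k\<in>{1..K}. of_nat k * x (colour n (q a), k) * ?g \<pi> a k) * ?R \<pi> a) =
      (\<Sum>a<M. of_int (lev n (q a) - lev n (P ! \<pi> a)) * (\<Prod>a<M. gker n x (P ! \<pi> a) (q a)))"
    proof (intro sum.cong refl)
      fix a assume a: "a \<in> {..<M}"
      then have "\<pi> a < M" using permutes_in_image[OF \<pi>, of a] by simp
      then have "lev n (q a) - lev n (P ! \<pi> a) \<le> int K" using K a by simp
      then have "(\<Sum>k\<in>{1..K}. of_nat k * x (colour n (q a), k) * ?g \<pi> a k) =
         of_int (lev n (q a) - lev n (P ! \<pi> a)) * gker n x (P ! \<pi> a) (q a)" by (rule gker_rec[OF n])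
      moreover have "(\<Prod>a<M. gker n x (P ! \<pi> a) (q a)) = gker n x (P ! \<pi> a) (q a) * ?R \<pi> a"
        using a by (intro prod.remove) auto
      ultimately show "(\<Sum>k\<in>{1..K}. of_nat k * x (colour n (q a), k) * ?g \<pi> a k) * ?R \<pi> a =
         of_int (lev n (q a) - lev n (P ! \<pi> a)) * (\<Prod>a<M. gker n x (P ! \<pi> a) (q a))" by simp
    qed
    also have "\<dots> = of_int (\<Sum>a<M. lev n (q a) - lev n (P ! \<pi> a)) * (\<Prod>a<M. gker n x (P ! \<pi> a) (q a))"
      by (simp only: sum_distrib_right of_int_sum)
    also have "(\<Sum>a<M. lev n (q a) - lev n (P ! \<pi> a)) = (\<Sum>a<M. lev n (q a)) - (\<Sum>b<M. lev n (P ! b))"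
      using sum.permute[OF \<pi>, of "\<lambda>b. lev n (P ! b)"] by (simp add: sum_subtractf o_def)
    finally show "(\<Sum>a<M. (\<Sum>k\<in>{1..K}. of_nat k * x (colour n (q a), k) * ?g \<pi> a k) * ?R \<pi> a) =
      of_int ((\<Sum>a<M. lev n (q a)) - (\<Sum>b<M. lev n (P ! b))) * (\<Prod>a<M. gker n x (P ! \<pi> a) (q a))" .
  qed
  also have "\<dots> = of_int ((\<Sum>a<M. lev n (q a)) - (\<Sum>b<M. lev n (P ! b))) * dt M (\<lambda>a b. gker n x (P ! b) (q a))"
    unfolding dt_sum sum_distrib_left by (simp add: mult_ac)
  finally show ?thesis .
qed

lemma dt_nonzero_perm:
  assumes "dt M A \<noteq> 0"
  obtains \<pi> where "\<pi> permutes {..<M}" "\<And>a. a < M \<Longrightarrow> A a (\<pi> a) \<noteq> 0"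
proof -
  obtain \<pi> where p: "\<pi> permutes {..<M}" "(\<Prod>a<M. A a (\<pi> a)) \<noteq> 0"
    using assms unfolding dt_sum
    by (metis (mono_tags, lifting) mem_Collect_eq mult_zero_right sum.not_neutral_contains_not_neutral)
  then show ?thesis using that[of \<pi>] by auto
qed

text \<open>A nonzero term of the determinant matches each ground label with a label q a of the same
  colour and of at least the same level. Transporting along this matching with \<open>en_bij\<close>
  gives the energy as a sum of nonnegative level differences; if it is zero, every difference
  vanishes.\<close>

lemma en_match:
  assumes n: "n \<ge> 1" and \<gamma>: "\<gamma> \<in> Mlat n" and c: "{..- int M} \<subseteq> gnd n \<gamma>"
  defines "P \<equiv> dl (gnd n \<gamma> - {..- int M})"
  assumes q: "inj_on q {..<M}" "\<And>a. a < M \<Longrightarrow> q a > - int M"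
    and nz: "dt M (\<lambda>a b. gker n x (P ! b) (q a)) \<noteq> 0"
  shows "int (en n ({..- int M} \<union> q ` {..<M})) = (\<Sum>a<M. lev n (q a)) - (\<Sum>b<M. lev n (P ! b))"
    and "en n ({..- int M} \<union> q ` {..<M}) = 0 \<Longrightarrow> {..- int M} \<union> q ` {..<M} = gnd n \<gamma>"
proof -
  let ?c = "- int M"
  let ?S = "{..?c} \<union> q ` {..<M}"
  note P = gnd_list[OF n \<gamma> c, folded P_def]
  obtain \<pi> where \<pi>: "\<pi> permutes {..<M}" "\<And>a. a < M \<Longrightarrow> gker n x (P ! \<pi> a) (q a) \<noteq> 0"
    using dt_nonzero_perm[OF nz] by blast
  have \<pi>M: "\<pi> a < M" if "a < M" for a using permutes_in_image[OF \<pi>(1), of a] that by simp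
  have pq: "P ! \<pi> a \<le> q a" "colour n (P ! \<pi> a) = colour n (q a)" if "a < M" for a
    using \<pi>(2)[OF that] by (auto simp: gker_def split: if_splits)
  have f: "bij_betw (\<lambda>a. P ! \<pi> a) {..<M} (gnd n \<gamma> \<inter> {?c<..})"
  proof -
    have "bij_betw (\<lambda>b. P ! b) {..<M} (set P)" using P(1,3) by (intro bij_betw_nth) auto
    then have "bij_betw ((\<lambda>b. P ! b) \<circ> \<pi>) {..<M} (set P)"
      using permutes_imp_bij[OF \<pi>(1)] by (rule bij_betw_trans[rotated])
    then show ?thesis unfolding P(2) o_def .
  qed
  have mS: "maya ?S"
  proof -
    have "maya ({..?c} \<union> A)" if "finite A" for A
      using that by (induction A) auto
    then show ?thesis by simp
  qed
  have top: "?S \<inter> {?c<..} = q ` {..<M}" using q(2) by auto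
  have qb: "bij_betw q {..<M} (?S \<inter> {?c<..})" unfolding top using q(1) by (rule inj_on_imp_bij_betw)
  define \<phi> where "\<phi> s = q (inv_into {..<M} (\<lambda>a. P ! \<pi> a) s)" for s
  have \<phi>P: "\<phi> (P ! \<pi> a) = q a" if "a < M" for a
  proof -
    have "inv_into {..<M} (\<lambda>a. P ! \<pi> a) (P ! \<pi> a) = a"
      using f that by (intro inv_into_f_f) (auto simp: bij_betw_def)
    then show ?thesis by (simp add: \<phi>_def)
  qed
  have \<phi>b: "bij_betw \<phi> (gnd n \<gamma> \<inter> {?c<..}) (?S \<inter> {?c<..})"
  proof -
    have "bij_betw (q \<circ> inv_into {..<M} (\<lambda>a. P ! \<pi> a)) (gnd n \<gamma> \<inter> {?c<..}) (?S \<inter> {?c<..})"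
      using bij_betw_inv_into[OF f] qb by (rule bij_betw_trans)
    then show ?thesis unfolding \<phi>_def[abs_def] o_def .
  qed
  have "colour n (\<phi> s) = colour n s" if s: "s \<in> gnd n \<gamma> \<inter> {?c<..}" for s
  proof -
    have "s \<in> (\<lambda>a. P ! \<pi> a) ` {..<M}" using s bij_betw_imp_surj_on[OF f] by simp
    then obtain a where "a < M" "s = P ! \<pi> a" by auto
    then show ?thesis using \<phi>P pq by simp
  qed
  then have "int (en n ?S) - int (en n (gnd n \<gamma>)) = (\<Sum>s\<in>gnd n \<gamma> \<inter> {?c<..}. lev n (\<phi> s) - lev n s)"
    by (intro en_bij[OF n maya_gnd[OF n] c mS _ \<phi>b]) auto
  also have "\<dots> = (\<Sum>a<M. lev n (\<phi> (P ! \<pi> a)) - lev n (P ! \<pi> a))"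
    by (rule sum.reindex_bij_betw[OF f, symmetric])
  also have "\<dots> = (\<Sum>a<M. lev n (q a) - lev n (P ! \<pi> a))" using \<phi>P by (intro sum.cong) auto
  finally have e: "int (en n ?S) = (\<Sum>a<M. lev n (q a) - lev n (P ! \<pi> a))" by (simp add: en_gnd[OF n])
  also have "\<dots> = (\<Sum>a<M. lev n (q a)) - (\<Sum>b<M. lev n (P ! b))"
    using sum.permute[OF \<pi>(1), of "\<lambda>b. lev n (P ! b)"] by (simp add: sum_subtractf o_def)
  finally show "int (en n ?S) = (\<Sum>a<M. lev n (q a)) - (\<Sum>b<M. lev n (P ! b))" .
  assume "en n ?S = 0"
  then have "(\<Sum>a<M. lev n (q a) - lev n (P ! \<pi> a)) = 0" using e by simp
  moreover have "lev n (q a) - lev n (P ! \<pi> a) \<ge> 0" if "a < M" for a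
    using lev_mono[OF n pq(1)[OF that]] by simp
  ultimately have "lev n (q a) - lev n (P ! \<pi> a) = 0" if "a < M" for a
    using that sum_nonneg_eq_0_iff[of "{..<M}" "\<lambda>a. lev n (q a) - lev n (P ! \<pi> a)"] by auto
  then have "q a = P ! \<pi> a" if "a < M" for a
    using that pq(2)[OF that] colour_lev[OF n, of "q a"] colour_lev[OF n, of "P ! \<pi> a"] by simp
  then have "q ` {..<M} = (\<lambda>a. P ! \<pi> a) ` {..<M}" by auto
  also have "\<dots> = gnd n \<gamma> \<inter> {?c<..}" using f by (simp add: bij_betw_def)
  finally show "?S = gnd n \<gamma>" using c by auto
qed

text \<open>Both sides obey Euler's identity with the same weight, by \<open>alpha_strg\<close> on
  the left and \<open>dt_gker_euler\<close> on the right. Lowering a label decreases the measure,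
  unless it drops into the sea, where both sides vanish. At energy zero the values are compared
  directly.\<close>

lemma Sig_strg:
  assumes n: "n \<ge> 1" and \<gamma>: "\<gamma> \<in> Mlat n" and c: "{..- int M} \<subseteq> gnd n \<gamma>"
  defines "P \<equiv> dl (gnd n \<gamma> - {..- int M})"
  shows "Sig n x \<gamma> (strg (- int M) M q) = qprod n \<gamma> (gnd n \<gamma>) * dt M (\<lambda>a b. gker n x (P ! b) (q a))"
proof (induction "\<Sum>a<M. nat (q a + int M)" arbitrary: q rule: less_induct)
  case less
  note P = gnd_list[OF n \<gamma> c, folded P_def]
  let ?c = "- int M"
  let ?\<epsilon> = "qprod n \<gamma> (gnd n \<gamma>)"
  let ?dt = "\<lambda>q. dt M (\<lambda>a b. gker n x (P ! b) (q a))"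
  have low: "Sig n x \<gamma> (strg ?c M q) = ?\<epsilon> * ?dt q" if a: "a < M" "q a \<le> ?c" for a q
  proof -
    have "gker n x (P ! b) (q a) = 0" if "b < M" for b
    proof -
      have "P ! b > ?c" using P(1,2) nth_mem[of b P] that by auto
      then show ?thesis using a(2) by (simp add: gker_def)
    qed
    then have "?dt q = 0" by (intro dt_zero_row[OF a(1)]) auto
    then show ?thesis using strg_zero[of a M q ?c] a by simp
  qed
  show ?case
  proof (cases "(\<exists>a<M. q a \<le> ?c) \<or> \<not> inj_on q {..<M}")
    case True
    then show ?thesis
    proof
      assume "\<exists>a<M. q a \<le> ?c"
      then show ?thesis using low by blast
    next
      assume ni: "\<not> inj_on q {..<M}"
      then obtain a a' where "a < M" "a' < M" "a \<noteq> a'" "q a = q a'" by (auto simp: inj_on_def)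
      then have "?dt q = 0" by (intro dt_identical_rows[of a M a']) auto
      then show ?thesis using strg_not_inj[OF ni] by simp
    qed
  next
    case False
    then have inj: "inj_on q {..<M}" and pos: "\<And>a. a < M \<Longrightarrow> q a > ?c" by (auto simp: not_le)
    define S where "S = {..?c} \<union> q ` {..<M}"
    define v where "v = dt M (\<lambda>a b. if q a = dl (q ` {..<M}) ! b then 1 else 0)"
    have V: "strg ?c M q = scl v (ev S)" unfolding v_def S_def by (rule strg_inj[OF inj pos])
    have mS: "maya S"
    proof -
      have "maya ({..?c} \<union> A)" if "finite A" for A using that by (induction A) auto
      then show ?thesis by (simp add: S_def)
    qed
    have sigV: "Sig n x \<gamma> (strg ?c M q) = v * sgm n x \<gamma> (en n S) S"
      unfolding V using mS by (simp only: Sig_scl fockv_ev Sig_ev)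
    note match = en_match[OF n \<gamma> c inj pos, folded P_def S_def, of x]
    show ?thesis
    proof (cases "en n S = 0")
      case True
      show ?thesis
      proof (cases "S = gnd n \<gamma>")
        case S: True
        have qi: "q ` {..<M} = gnd n \<gamma> - {..?c}" using S pos unfolding S_def by force
        \<comment> \<open>Here q enumerates the ground labels in some order. The matrix factors into
          the permutation matrix of this order, with determinant v, and the kernel on the decreasing
          list P, which is unitriangular because the kernel never raises a label.\<close>
        have "?dt q = dt M (\<lambda>a b. \<Sum>c'<M. (if q a = P ! c' then 1 else 0) * gker n x (P ! b) (P ! c'))"
        proof (rule dt_cong)
          fix a b assume ab: "a < M" "b < M"
          then have "q a \<in> q ` {..<M}" by blast
          then have "q a \<in> set P" unfolding qi P(2) by auto
          then obtain d where d: "d < M" "q a = P ! d" using P(1) by (metis in_set_conv_nth)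
          have "(\<Sum>c'<M. (if q a = P ! c' then 1 else 0) * gker n x (P ! b) (P ! c')) =
            (\<Sum>c'<M. if c' = d then gker n x (P ! b) (q a) else 0)"
            using d P(1,3) by (intro sum.cong refl) (auto simp: nth_eq_iff_index_eq)
          then show "gker n x (P ! b) (q a) = (\<Sum>c'<M. (if q a = P ! c' then 1 else 0) * gker n x (P ! b) (P ! c'))"
            using d by simp
        qed
        also have "\<dots> = v * dt M (\<lambda>c' b. gker n x (P ! b) (P ! c'))"
          unfolding dt_mult v_def qi P_def ..
        also have "dt M (\<lambda>c' b. gker n x (P ! b) (P ! c')) = 1"
        proof (rule dt_unitriangular)
          fix a b assume "b < a" "a < M"
          then have "P ! b > P ! a" using P(1,4) sorted_wrt_nth_less by blast
          then show "gker n x (P ! b) (P ! a) = 0" by (simp add: gker_def)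
        qed (simp add: gker_same)
        finally have "?dt q = v" by simp
        then show ?thesis using True S \<gamma> unfolding sigV by simp
      next
        case S: False
        then have "?dt q = 0" using match(2) True by blast
        then show ?thesis using S True unfolding sigV by simp
      qed
    next
      case False
      \<comment> \<open>Large enough for both recursions: it exceeds the energy, as the
        correspondence requires, and all level differences, as \<open>gker_rec\<close>
        requires.\<close>
      define K where "K = max (en n S) (nat (Max ((\<lambda>(a, b). lev n (q a) - lev n (P ! b)) ` ({..<M} \<times> {..<M}))))"
      have K: "lev n (q a) - lev n (P ! b) \<le> int K" if "a < M" "b < M" for a b
      proof -
        have "lev n (q a) - lev n (P ! b) \<le> Max ((\<lambda>(a, b). lev n (q a) - lev n (P ! b)) ` ({..<M} \<times> {..<M}))"
          using that by (intro Max_ge) auto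
        then show ?thesis unfolding K_def by linarith
      qed
      have step: "Sig n x \<gamma> (strg ?c M (q(a := q a - int n * int k))) = ?\<epsilon> * ?dt (q(a := q a - int n * int k))"
        if a: "a < M" and k: "k \<ge> 1" for a k
      proof (cases "q a - int n * int k \<le> ?c")
        case True
        then show ?thesis using low[OF a, of "q(a := q a - int n * int k)"] by simp
      next
        case False
        have "int n * int k > 0" using n k by simp
        then have "nat (q a - int n * int k + int M) < nat (q a + int M)" using False by linarith
        then have "(\<Sum>a'<M. nat ((q(a := q a - int n * int k)) a' + int M)) < (\<Sum>a'<M. nat (q a' + int M))"
          using a \<open>int n * int k > 0\<close> by (intro sum_strict_mono_ex1) (auto intro!: nat_mono)
        then show ?thesis by (rule less.hyps)
      qed
      have al: "Sig n x \<gamma> (alpha n j (int k) (strg ?c M q)) =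
        (\<Sum>a<M. if colour n (q a) = j then ?\<epsilon> * ?dt (q(a := q a - int n * int k)) else 0)"
        if "j \<in> {1..n}" "k \<ge> 1" for j k
      proof -
        have "Sig n x \<gamma> (alpha n j (int k) (strg ?c M q)) =
          (\<Sum>a<M. Sig n x \<gamma> (if colour n (q a) = j then strg ?c M (q(a := q a - int n * int k)) else 0))"
          unfolding alpha_strg[OF n that(1), of "int k", simplified, OF that(2)[unfolded One_nat_def Suc_le_eq]]
          by (rule Sig_sum) simp
        also have "\<dots> = (\<Sum>a<M. if colour n (q a) = j then ?\<epsilon> * ?dt (q(a := q a - int n * int k)) else 0)"
          using step that(2) by (intro sum.cong refl) auto
        finally show ?thesis .
      qed
      have "of_nat (en n S) * Sig n x \<gamma> (strg ?c M q) =
        (\<Sum>k\<in>{1..K}. \<Sum>j\<in>{1..n}. of_nat k * x (j, k) * Sig n x \<gamma> (alpha n j (int k) (strg ?c M q)))"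
      proof (rule Sig_euler_homogeneous[OF n fockv_strg])
        fix T assume "strg ?c M q T \<noteq> 0"
        then show "en n T = en n S" unfolding V by (auto simp: ev_def split: if_splits)
      qed (simp add: K_def)
      also have "\<dots> = (\<Sum>k\<in>{1..K}. \<Sum>j\<in>{1..n}. \<Sum>a<M. if colour n (q a) = j
           then ?\<epsilon> * (of_nat k * x (colour n (q a), k) * ?dt (q(a := q a - int n * int k))) else 0)"
        using al by (intro sum.cong refl) (auto simp: sum_distrib_left mult_ac intro!: sum.cong)
      also have "\<dots> = (\<Sum>k\<in>{1..K}. \<Sum>a<M. ?\<epsilon> * (of_nat k * x (colour n (q a), k) * ?dt (q(a := q a - int n * int k))))"
      proof (rule sum.cong[OF refl])
        fix k
        have "(\<Sum>j\<in>{1..n}. \<Sum>a<M. if colour n (q a) = j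
           then ?\<epsilon> * (of_nat k * x (colour n (q a), k) * ?dt (q(a := q a - int n * int k))) else 0) =
          (\<Sum>a<M. \<Sum>j\<in>{1..n}. if colour n (q a) = j
           then ?\<epsilon> * (of_nat k * x (colour n (q a), k) * ?dt (q(a := q a - int n * int k))) else 0)"
          by (rule sum.swap)
        also have "\<dots> = (\<Sum>a<M. ?\<epsilon> * (of_nat k * x (colour n (q a), k) * ?dt (q(a := q a - int n * int k))))"
          using colour_range[OF n] by (intro sum.cong refl) (subst sum.delta', auto)
        finally show "(\<Sum>j\<in>{1..n}. \<Sum>a<M. if colour n (q a) = j
           then ?\<epsilon> * (of_nat k * x (colour n (q a), k) * ?dt (q(a := q a - int n * int k))) else 0) =
          (\<Sum>a<M. ?\<epsilon> * (of_nat k * x (colour n (q a), k) * ?dt (q(a := q a - int n * int k))))" .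
      qed
      also have "\<dots> = ?\<epsilon> * (of_int ((\<Sum>a<M. lev n (q a)) - (\<Sum>b<M. lev n (P ! b))) * ?dt q)"
        unfolding sum_distrib_left[symmetric] by (subst dt_gker_euler[OF n K]) auto
      also have "\<dots> = ?\<epsilon> * (of_nat (en n S) * ?dt q)"
      proof (cases "?dt q = 0")
        case False
        then have "int (en n S) = (\<Sum>a<M. lev n (q a)) - (\<Sum>b<M. lev n (P ! b))" using match(1) by blast
        then have "of_int ((\<Sum>a<M. lev n (q a)) - (\<Sum>b<M. lev n (P ! b))) = (of_int (int (en n S)) :: complex)" by simp
        then show ?thesis by simp
      qed simp
      finally have "of_nat (en n S) * Sig n x \<gamma> (strg ?c M q) = of_nat (en n S) * (?\<epsilon> * ?dt q)" by (simp add: mult_ac)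
      then show ?thesis using False by simp
    qed
  qed
qed

text \<open>Entries above B are zero, and entries at most - M never meet a column, so a finite
  window of labels carries the whole multilinear expansion.\<close>

lemma wedgeW_strg:
  assumes "\<And>a p. a < M \<Longrightarrow> p > B \<Longrightarrow> w a p = 0"
  shows "wedgeW M w = (\<Sum>f\<in>PiE {..<M} (\<lambda>_. {- int M<..B}). scl (\<Prod>a<M. w a (f a)) (strg (- int M) M f))"
proof
  fix T
  let ?Q = "{- int M<..B}"
  let ?L = "dl (T - {..- int M})"
  show "wedgeW M w T = (\<Sum>f\<in>PiE {..<M} (\<lambda>_. ?Q). scl (\<Prod>a<M. w a (f a)) (strg (- int M) M f)) T"
  proof (cases "wcond (- int M) M T")
    case True
    have L: "?L ! b \<in> T - {..- int M}" if "b < M" for b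
      using True dl_nth[of "T - {..- int M}" b] that by (simp add: wcond_def)
    have "dt M (\<lambda>a b. w a (?L ! b)) = dt M (\<lambda>a b. \<Sum>q\<in>?Q. w a q * (if q = ?L ! b then 1 else 0))"
    proof (rule dt_cong)
      fix a b assume ab: "a < M" "b < M"
      have "(\<Sum>q\<in>?Q. w a q * (if q = ?L ! b then 1 else 0)) = (\<Sum>q\<in>?Q. if q = ?L ! b then w a (?L ! b) else 0)"
        by (rule sum.cong) auto
      then show "w a (?L ! b) = (\<Sum>q\<in>?Q. w a q * (if q = ?L ! b then 1 else 0))"
        using assms[OF ab(1), of "?L ! b"] L[OF ab(2)] by (auto simp: sum.delta)
    qed
    also have "\<dots> = (\<Sum>f\<in>PiE {..<M} (\<lambda>_. ?Q). (\<Prod>a<M. w a (f a)) * dt M (\<lambda>a b. if f a = ?L ! b then 1 else 0))"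
      by (rule dt_expand_rows) simp
    finally show ?thesis using True by (simp add: wedgeW_dt strg_eval sum_fun_apply)
  qed (simp add: wedgeW_dt strg_eval sum_fun_apply)
qed

text \<open>The exponential applied to a vector that vanishes above B. The kernel sends a label only
  to labels not above it, so coefficients at p > c are not affected by cutting the vector off at
  c.\<close>

definition gact :: "nat \<Rightarrow> (nat \<times> nat \<Rightarrow> complex) \<Rightarrow> int \<Rightarrow> int \<Rightarrow> (int \<Rightarrow> complex) \<Rightarrow> int \<Rightarrow> complex" where
  "gact n x c B u p = (\<Sum>q\<in>{c<..B}. u q * gker n x p q)"

lemma F0_wedgeW:
  assumes "\<And>a p. a < M \<Longrightarrow> p > B \<Longrightarrow> w a p = 0"
  shows "F0 (wedgeW M w)"
proof -
  have e: "wedgeW M w = (\<Sum>f\<in>PiE {..<M} (\<lambda>_. {- int M<..B}). scl (\<Prod>a<M. w a (f a)) (strg (- int M) M f))"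
    by (rule wedgeW_strg) (rule assms)
  have "fockv (wedgeW M w)" unfolding e by (intro fockv_sum fockv_scl fockv_strg)
  moreover have "charge T = 0" if T: "wedgeW M w T \<noteq> 0" for T
  proof -
    have "wcond (- int M) M T" using T by (auto simp: wedgeW_dt split: if_splits)
    moreover have "maya T" using \<open>fockv _\<close> T by (simp add: fockv_def)
    moreover have "T - {..- int M} = T \<inter> {- int M<..}" by auto
    ultimately show ?thesis using charge_top[of T "- int M"] by (simp add: wcond_def)
  qed
  ultimately show ?thesis by (simp add: F0_def)
qed

text \<open>The wedge is expanded into strings, each string is evaluated by \<open>Sig_strg\<close>,
  and multilinearity reassembles the sum with the exponential now acting on the rows.\<close>

lemma tau_dt:
  assumes n: "n \<ge> 1" and \<gamma>: "\<gamma> \<in> Mlat n" and c: "{..- int M} \<subseteq> gnd n \<gamma>"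
    and w: "\<And>a p. a < M \<Longrightarrow> p > B \<Longrightarrow> w a p = 0"
  shows "tau n M w \<gamma> x = qprod n \<gamma> (gnd n \<gamma>) *
    dt M (\<lambda>a b. gact n x (- int M) B (w a) (dl (gnd n \<gamma> - {..- int M}) ! b))"
proof -
  let ?P = "dl (gnd n \<gamma> - {..- int M})"
  let ?F = "PiE {..<M} (\<lambda>_. {- int M<..B})"
  have e: "wedgeW M w = (\<Sum>f\<in>?F. scl (\<Prod>a<M. w a (f a)) (strg (- int M) M f))"
    by (rule wedgeW_strg) (rule w)
  have "tau n M w \<gamma> x = Sig n x \<gamma> (wedgeW M w)"
    unfolding tau_def sigma_eq[OF n] SIG_def using F0_wedgeW[of M B w] w by simp
  also have "\<dots> = (\<Sum>f\<in>?F. (\<Prod>a<M. w a (f a)) * Sig n x \<gamma> (strg (- int M) M f))"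
    unfolding e by (subst Sig_sum) (simp_all add: Sig_scl)
  also have "\<dots> = qprod n \<gamma> (gnd n \<gamma>) * (\<Sum>f\<in>?F. (\<Prod>a<M. w a (f a)) * dt M (\<lambda>a b. gker n x (?P ! b) (f a)))"
    unfolding Sig_strg[OF n \<gamma> c] by (simp add: sum_distrib_left mult_ac)
  also have "(\<Sum>f\<in>?F. (\<Prod>a<M. w a (f a)) * dt M (\<lambda>a b. gker n x (?P ! b) (f a))) =
     dt M (\<lambda>a b. gact n x (- int M) B (w a) (?P ! b))"
    unfolding gact_def by (rule dt_expand_rows[symmetric]) simp
  finally show ?thesis .
qed

text \<open>Listing the top vector of the sea as an extra row changes nothing: its label - N is the
  smallest one above the new sea, hence the last column, and the expansion along the last row leaves
  the cofactor with sign +1.\<close>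

lemma wedgeW_Suc:
  "wedgeW (Suc N) (w(N := (\<lambda>p. if p = - int N then 1 else 0))) = wedgeW N w"
proof
  fix T
  let ?w = "w(N := (\<lambda>p. if p = - int N then 1 else 0))"
  let ?L' = "dl (T - {..- int (Suc N)})" and ?L = "dl (T - {..- int N})"
  have at: "{..- int N} = insert (- int N) {..- int (Suc N)}" by auto
  have nin: "- int N \<notin> {..- int (Suc N)}" by simp
  have wc: "wcond (- int N) N T \<longleftrightarrow> wcond (- int (Suc N)) (Suc N) T \<and> - int N \<in> T"
  proof -
    define X where "X = T - {..- int (Suc N)}"
    have e: "T - {..- int N} = X - {- int N}" unfolding at X_def by blast
    have sub: "{..- int N} \<subseteq> T \<longleftrightarrow> {..- int (Suc N)} \<subseteq> T \<and> - int N \<in> T" unfolding at by blast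
    have "card (X - {- int N}) = N \<longleftrightarrow> card X = Suc N" if "finite X" "- int N \<in> T"
    proof -
      have "- int N \<in> X" using that(2) nin unfolding X_def by blast
      then show ?thesis using that(1) card_Suc_Diff1[of X "- int N"] by linarith
    qed
    then show ?thesis unfolding wcond_def e sub X_def[symmetric] finite_Diff_insert Diff_empty by blast
  qed
  show "wedgeW (Suc N) ?w T = wedgeW N w T"
  proof (cases "wcond (- int (Suc N)) (Suc N) T")
    case False
    then show ?thesis using wc by (simp add: wedgeW_dt del: of_nat_Suc)
  next
    case w: True
    have fin: "finite (T - {..- int (Suc N)})" "card (T - {..- int (Suc N)}) = Suc N" using w by (auto simp: wcond_def)
    show ?thesis
    proof (cases "- int N \<in> T")
      case False
      have "?L' ! b \<noteq> - int N" if "b < Suc N" for b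
        using False dl_nth[OF fin(1), of b] fin(2) that by auto
      then have "dt (Suc N) (\<lambda>a b. ?w a (?L' ! b)) = 0" by (intro dt_zero_row[of N]) auto
      then show ?thesis using False w wc by (simp add: wedgeW_dt del: of_nat_Suc)
    next
      case True
      have q: "- int N \<in> T - {..- int (Suc N)}" using True nin by blast
      have e1: "{s \<in> T - {..- int (Suc N)}. s > - int N} = T - {..- int N}" by auto
      have e2: "{s \<in> T - {..- int (Suc N)}. s < - int N} = {}" by auto
      have L': "?L' = ?L @ [- int N]"
        using dl_split(1)[OF fin(1) q] unfolding e1 e2 by (simp add: dl_def)
      have len: "length ?L = N" using dl_props(3)[OF fin(1)] fin(2) unfolding L' by simp
      have neq: "?L ! b \<noteq> - int N" if "b < N" for b
      proof -
        have "distinct ?L'" using dl_props(2)[OF fin(1)] by simp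
        then have "- int N \<notin> set ?L" unfolding L' by simp
        then show ?thesis using that len nth_mem[of b ?L] by metis
      qed
      have "dt (Suc N) (\<lambda>a b. ?w a (?L' ! b)) = (\<Sum>b<Suc N. ?w N (?L' ! b) * ((-1) ^ (N + b) *
         dt N (\<lambda>a b'. ?w (if a < N then a else Suc a) (?L' ! (if b' < b then b' else Suc b')))))"
        by (rule dt_laplace) simp
      also have "\<dots> = (\<Sum>b<Suc N. if b = N then dt N (\<lambda>a b'. w a (?L ! b')) else 0)"
      proof (rule sum.cong[OF refl])
        fix b assume b: "b \<in> {..<Suc N}"
        show "?w N (?L' ! b) * ((-1) ^ (N + b) * dt N (\<lambda>a b'. ?w (if a < N then a else Suc a) (?L' ! (if b' < b then b' else Suc b')))) =
          (if b = N then dt N (\<lambda>a b'. w a (?L ! b')) else 0)"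
        proof (cases "b = N")
          case True
          have "dt N (\<lambda>a b'. ?w (if a < N then a else Suc a) (?L' ! (if b' < N then b' else Suc b'))) = dt N (\<lambda>a b'. w a (?L ! b'))"
            unfolding L' using len by (intro dt_cong) (auto simp: nth_append)
          moreover have "?L' ! N = - int N" unfolding L' using len by (simp add: nth_append)
          ultimately show ?thesis using True by (simp flip: mult_2)
        next
          case False
          then have "?L' ! b = ?L ! b" "b < N" using b len unfolding L' by (auto simp: nth_append)
          then show ?thesis using neq False by simp
        qed
      qed
      also have "\<dots> = dt N (\<lambda>a b'. w a (?L ! b'))" by simp
      finally show ?thesis using w wc True by (simp add: wedgeW_dt del: of_nat_Suc)
    qed
  qed
qed

section \<open>Complete symmetric polynomials\<close>

text \<open>In generating form, the derivative of exp(\<Sum> y_k t^k) in y_1 is t times the series.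
  In the recursion for h_m, the explicit y_1 contributes h_(m - 1); the derivatives of the
  coefficients contribute (m - 1) h_(m - 1), by induction and the recursion one step lower. Division
  by m remains.\<close>

lemma hh_deriv:
  "((\<lambda>z. hh (y(1 := z)) m) has_field_derivative (if m = 0 then 0 else hh (y(1 := z)) (m - 1))) (at z)"
proof (induction m rule: less_induct)
  case (less m)
  show ?case
  proof (cases m)
    case 0
    have "(\<lambda>z. hh (y(1 := z)) 0) = (\<lambda>z. 1)" by simp
    then show ?thesis using 0 by simp
  next
    case (Suc m')
    let ?y = "y(1 := z)"
    let ?d = "\<lambda>m. if m = 0 then 0 else hh ?y (m - 1)"
    have y1: "((\<lambda>z. (y(1 := z)) k) has_field_derivative (if k = 1 then 1 else 0)) (at z)" for k
      by (cases "k = 1") (auto intro!: derivative_eq_intros)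
    have "((\<lambda>z. (\<Sum>k\<in>{1..Suc m'}. of_nat k * (y(1 := z)) k * hh (y(1 := z)) (Suc m' - k))) has_field_derivative
      (\<Sum>k\<in>{1..Suc m'}. of_nat k * (if k = 1 then 1 else 0) * hh ?y (Suc m' - k) + of_nat k * ?y k * ?d (Suc m' - k))) (at z)"
    proof (intro DERIV_sum)
      fix k assume k: "k \<in> {1..Suc m'}"
      then have "((\<lambda>z. hh (y(1 := z)) (Suc m' - k)) has_field_derivative ?d (Suc m' - k)) (at z)"
        using Suc by (intro less.IH) auto
      then have "((\<lambda>z. of_nat k * (y(1 := z)) k * hh (y(1 := z)) (Suc m' - k)) has_field_derivative
          of_nat k * (if k = 1 then 1 else 0) * hh ?y (Suc m' - k) + ?d (Suc m' - k) * (of_nat k * ?y k)) (at z)"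
        by (rule DERIV_mult[OF DERIV_cmult[OF y1]])
      then show "((\<lambda>z. of_nat k * (y(1 := z)) k * hh (y(1 := z)) (Suc m' - k)) has_field_derivative
          of_nat k * (if k = 1 then 1 else 0) * hh ?y (Suc m' - k) + of_nat k * ?y k * ?d (Suc m' - k)) (at z)"
        by (simp only: mult.commute[of "?d (Suc m' - k)"])
    qed
    then have D: "((\<lambda>z. hh (y(1 := z)) (Suc m')) has_field_derivative
      (\<Sum>k\<in>{1..Suc m'}. of_nat k * (if k = 1 then 1 else 0) * hh ?y (Suc m' - k) + of_nat k * ?y k * ?d (Suc m' - k))
        / of_nat (Suc m')) (at z)"
      unfolding hh.simps by (rule DERIV_cdivide)
    have "(\<Sum>k\<in>{1..Suc m'}. of_nat k * (if k = 1 then 1 else 0) * hh ?y (Suc m' - k)) =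
       (\<Sum>k\<in>{1..Suc m'}. if k = 1 then hh ?y m' else 0)"
      by (intro sum.cong) auto
    then have s1: "(\<Sum>k\<in>{1..Suc m'}. of_nat k * (if k = 1 then 1 else 0) * hh ?y (Suc m' - k)) = hh ?y m'"
      by (simp add: sum.delta)
    have s2: "(\<Sum>k\<in>{1..Suc m'}. of_nat k * ?y k * ?d (Suc m' - k)) = of_nat m' * hh ?y m'"
    proof -
      have "(\<Sum>k\<in>{1..Suc m'}. of_nat k * ?y k * ?d (Suc m' - k)) = (\<Sum>k\<in>{1..m'}. of_nat k * ?y k * hh ?y (m' - k))"
        by (simp del: fun_upd_apply cong: sum.cong) (auto intro!: sum.cong simp: Suc_diff_le simp del: fun_upd_apply)
      then show ?thesis by (simp only: hh_rec)
    qed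
    have val: "(\<Sum>k\<in>{1..Suc m'}. of_nat k * (if k = 1 then 1 else 0) * hh ?y (Suc m' - k) + of_nat k * ?y k * ?d (Suc m' - k))
      / of_nat (Suc m') = hh ?y m'"
    proof -
      have e: "hh ?y m' + of_nat m' * hh ?y m' = of_nat (Suc m') * hh ?y m'"
        by (simp add: algebra_simps del: fun_upd_apply)
      show ?thesis unfolding sum.distrib s1 s2 e by (simp del: fun_upd_apply of_nat_Suc)
    qed
    have "Suc m' \<noteq> 0" "Suc m' - 1 = m'" by simp_all
    then show ?thesis using D unfolding val Suc by (simp only: if_False)
  qed
qed

text \<open>If only odd y_k are nonzero, the exponent is an odd function of t, so H(-t) = 1/H(t).
  The logarithmic derivatives of the two series are opposite, hence their product has derivative
  zero and constant term 1. Parity enters coefficientwise: either i is even and the signs match, or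
  y (i + 1) vanishes.\<close>

lemma hh_inverse:
  assumes y: "\<And>k. k \<ge> 1 \<Longrightarrow> y (2 * k) = 0"
  shows "Abs_fps (hh y) * Abs_fps (\<lambda>m. (-1) ^ m * hh y m) = 1"
proof -
  let ?H = "Abs_fps (hh y)" and ?K = "Abs_fps (\<lambda>m. (-1) ^ m * hh y m)"
  let ?Y = "Abs_fps (\<lambda>m. of_nat (m + 1) * y (m + 1))"
  have rec: "of_nat (m + 1) * hh y (m + 1) = (\<Sum>i\<in>{0..m}. of_nat (i + 1) * y (i + 1) * hh y (m - i))" for m
  proof -
    have "(\<Sum>k\<in>{1..m + 1}. of_nat k * y k * hh y (m + 1 - k)) = (\<Sum>i\<in>{0..m}. of_nat (i + 1) * y (i + 1) * hh y (m + 1 - (i + 1)))"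
      by (rule sum.reindex_bij_witness[where i = "\<lambda>i. i + 1" and j = "\<lambda>k. k - 1"]) auto
    then show ?thesis using hh_rec[of "m + 1" y] by simp
  qed
  have dH: "fps_deriv ?H = ?Y * ?H"
    by (rule fps_ext) (simp only: fps_deriv_nth fps_nth_Abs_fps fps_mult_nth rec)
  have dK: "fps_deriv ?K = - (?Y * ?K)"
  proof (rule fps_ext)
    fix m
    have "fps_nth (fps_deriv ?K) m = (-1) ^ (m + 1) * (of_nat (m + 1) * hh y (m + 1))" by simp
    also have "\<dots> = (\<Sum>i\<in>{0..m}. - (of_nat (i + 1) * y (i + 1) * ((-1) ^ (m - i) * hh y (m - i))))"
      unfolding rec sum_distrib_left
    proof (rule sum.cong[OF refl])
      fix i assume i: "i \<in> {0..m}"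
      show "(-1) ^ (m + 1) * (of_nat (i + 1) * y (i + 1) * hh y (m - i)) = - (of_nat (i + 1) * y (i + 1) * ((-1) ^ (m - i) * hh y (m - i)))"
      proof (cases "even i")
        case True
        have "(-1) ^ (m - i) = ((-1) ^ m :: complex)" using i True by (simp add: minus_one_power_iff)
        then show ?thesis by simp
      next
        case False
        then obtain k where k: "i + 1 = 2 * k" by (metis Suc_eq_plus1 even_Suc evenE)
        then have "y (i + 1) = 0" using y[of k] by (cases k) auto
        then show ?thesis by simp
      qed
    qed
    also have "\<dots> = fps_nth (- (?Y * ?K)) m" by (simp add: fps_mult_nth sum_negf)
    finally show "fps_nth (fps_deriv ?K) m = fps_nth (- (?Y * ?K)) m" .
  qed
  have "fps_deriv (?H * ?K) = 0" unfolding fps_deriv_mult dH dK by (simp add: algebra_simps)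
  then have "?H * ?K = fps_const (fps_nth (?H * ?K) 0)" by (simp only: fps_deriv_eq_0_iff)
  then show ?thesis by simp
qed

lemma neg_one_powi: "(-1) powi j = (if even j then 1 else (-1 :: complex))"
  by (simp add: power_int_minus_left)

text \<open>Multiplied by t^K, the two series U(t) and V(-t), cut off below t^(- K), become power
  series, and the residue of their product becomes the coefficient of degree 2 K - 1. The map G
  multiplies the first by H(t) and the second by H(-t), which are inverse to each other. For K = 0
  both sums are empty.\<close>

lemma residue_invariant:
  fixes U V :: "int \<Rightarrow> complex" and K :: nat
  assumes y: "\<And>k. k \<ge> 1 \<Longrightarrow> y (2 * k) = 0"
  defines "G \<equiv> \<lambda>U k. \<Sum>m\<in>{0..nat (k + int K)}. hh y m * U (k - int m)"
  shows "(\<Sum>k\<in>{- int K..<int K}. G U k * G V (- 1 - k) * (-1) powi (- 1 - k)) =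
    (\<Sum>k\<in>{- int K..<int K}. U k * V (- 1 - k) * (-1) powi (- 1 - k))"
proof (cases "K = 0")
  case False
  let ?H = "Abs_fps (hh y)" and ?K = "Abs_fps (\<lambda>m. (-1) ^ m * hh y m)"
  let ?F = "\<lambda>U. Abs_fps (\<lambda>i. U (int i - int K))"
  let ?E = "\<lambda>V. Abs_fps (\<lambda>i. (-1) ^ i * V (int i - int K))"
  have res: "fps_nth (?F U * ?E V) (2 * K - 1) = (-1) ^ K * (\<Sum>k\<in>{- int K..<int K}. U k * V (- 1 - k) * (-1) powi (- 1 - k))"
    for U V :: "int \<Rightarrow> complex"
  proof -
    have "fps_nth (?F U * ?E V) (2 * K - 1) =
       (\<Sum>i\<in>{0..2 * K - 1}. U (int i - int K) * ((-1) ^ (2 * K - 1 - i) * V (int (2 * K - 1 - i) - int K)))"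
      by (simp add: fps_mult_nth)
    also have "\<dots> = (\<Sum>k\<in>{- int K..<int K}. (-1) ^ K * (U k * V (- 1 - k) * (-1) powi (- 1 - k)))"
    proof (rule sum.reindex_bij_witness[where i = "\<lambda>k. nat (k + int K)" and j = "\<lambda>i. int i - int K"])
      fix i assume i: "i \<in> {0..2 * K - 1}"
      then have "i < 2 * K" using False by auto
      then have e: "int (2 * K - 1 - i) = 2 * int K - 1 - int i" by (simp add: of_nat_diff)
      have "((-1) ^ (2 * K - 1 - i) :: complex) = (-1) ^ K * (-1) powi (- 1 - (int i - int K))"
      proof -
        have "even (2 * K - 1 - i) \<longleftrightarrow> even (int (2 * K - 1 - i))" by simp
        also have "\<dots> \<longleftrightarrow> \<not> even (int i)" unfolding e by simp
        finally have p: "even (2 * K - 1 - i) \<longleftrightarrow> odd i" by simp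
        show ?thesis unfolding neg_one_powi minus_one_power_iff p by auto
      qed
      then show "(-1) ^ K * (U (int i - int K) * V (- 1 - (int i - int K)) * (-1) powi (- 1 - (int i - int K))) =
         U (int i - int K) * ((-1) ^ (2 * K - 1 - i) * V (int (2 * K - 1 - i) - int K))"
        unfolding e by (simp add: algebra_simps)
    qed (use False in auto)
    finally show ?thesis by (simp add: sum_distrib_left)
  qed
  have F: "?F (G U) = ?H * ?F U"
  proof (rule fps_ext)
    fix i
    show "fps_nth (?F (G U)) i = fps_nth (?H * ?F U) i"
      unfolding fps_mult_nth fps_nth_Abs_fps G_def
      by (rule sum.cong) (auto simp: of_nat_diff algebra_simps)
  qed
  have E: "?E (G V) = ?K * ?E V"
  proof (rule fps_ext)
    fix i
    have "(\<Sum>m\<in>{0..i}. (-1) ^ m * hh y m * ((-1) ^ (i - m) * V (int (i - m) - int K))) =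
       (\<Sum>m\<in>{0..i}. (-1) ^ i * (hh y m * V (int i - int K - int m)))"
    proof (rule sum.cong[OF refl])
      fix m assume m: "m \<in> {0..i}"
      then have "((-1) ^ i :: complex) = (-1) ^ m * (-1) ^ (i - m)" by (simp flip: power_add)
      then show "(-1) ^ m * hh y m * ((-1) ^ (i - m) * V (int (i - m) - int K)) = (-1) ^ i * (hh y m * V (int i - int K - int m))"
        using m by (simp add: of_nat_diff algebra_simps)
    qed
    then show "fps_nth (?E (G V)) i = fps_nth (?K * ?E V) i"
      unfolding fps_mult_nth fps_nth_Abs_fps G_def by (simp add: sum_distrib_left)
  qed
  have "?F (G U) * ?E (G V) = (?H * ?K) * (?F U * ?E V)" unfolding F E by (simp only: mult_ac)
  also have "\<dots> = ?F U * ?E V" using hh_inverse[of y] y by simp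
  finally show ?thesis using res[of "G U" "G V"] res[of U V] by simp
qed simp

section \<open>Multiplication by the exponential on truncated vectors\<close>

lemma gact_cong: "(\<And>q. c < q \<Longrightarrow> q \<le> B \<Longrightarrow> u q = v q) \<Longrightarrow> gact n x c B u p = gact n x c B v p"
  unfolding gact_def by (intro sum.cong) auto

lemma gact_sum: "gact n x c B (\<lambda>p. \<Sum>a\<in>A. k a * w a p) p = (\<Sum>a\<in>A. k a * gact n x c B (w a) p)"
  unfolding gact_def sum_distrib_left sum_distrib_right by (subst sum.swap) (simp add: mult_ac)

lemma gker_shift: "n \<ge> 1 \<Longrightarrow> gker n x (p + int n) (q + int n) = gker n x p q"
  using lev_add[of n p 1] lev_add[of n q 1] by (simp add: gker_def)

text \<open>Multiplication by t commutes with the exponential. The windows before and after the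
  shift differ only at labels at most c + n, where the kernel at p + n vanishes, and at labels above
  B, where u does.\<close>

lemma gact_tmul:
  assumes n: "n \<ge> 1" and p: "p > c" and u: "\<And>q. q > B \<Longrightarrow> u q = 0"
  shows "gact n x c B (tmul n u) p = gact n x c B u (p + int n)"
proof -
  have "gact n x c B (tmul n u) p = (\<Sum>q\<in>{c<..B}. u (q + int n) * gker n x (p + int n) (q + int n))"
    using gker_shift[OF n] by (simp add: gact_def tmul_def)
  also have "\<dots> = (\<Sum>q\<in>{c + int n<..B + int n}. u q * gker n x (p + int n) q)"
    by (rule sum.reindex_bij_witness[where i = "\<lambda>q. q - int n" and j = "\<lambda>q. q + int n"]) auto
  also have "\<dots> = gact n x c B u (p + int n)"
    unfolding gact_def
  proof (rule sum.mono_neutral_cong)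
    fix q assume "q \<in> {c<..B} - {c + int n<..B + int n}"
    then show "u q * gker n x (p + int n) q = 0" using p by (auto simp: gker_def)
  next
    fix q assume "q \<in> {c + int n<..B + int n} - {c<..B}"
    then show "u q * gker n x (p + int n) q = 0" using u by auto
  qed auto
  finally show ?thesis .
qed

text \<open>The derivative in x (k, 1) multiplies component k by t, and the coefficient of t f at
  label p is that of f at p + n.\<close>

lemma gker_deriv:
  assumes n: "n \<ge> 1"
  shows "((\<lambda>z. gker n (x((k, 1) := z)) p q) has_field_derivative
    (if colour n p = k then gker n (x((k, 1) := z)) (p + int n) q else 0)) (at z)"
proof (cases "p \<le> q \<and> colour n p = colour n q")
  case False
  have "gker n y p q = 0" for y using False unfolding gker_def by (rule if_not_P)
  moreover have "gker n y (p + int n) q = 0" for y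
  proof -
    have "\<not> (p + int n \<le> q \<and> colour n (p + int n) = colour n q)" using False by auto
    then show ?thesis unfolding gker_def by (rule if_not_P)
  qed
  ultimately show ?thesis by simp
next
  case True
  define m where "m = nat (lev n q - lev n p)"
  have m: "lev n q - lev n p = int m" using lev_mono[OF n, of p q] True by (simp add: m_def)
  have q: "q = p + int n * int m"
    using colour_lev[OF n, of p] colour_lev[OF n, of q] True m by (simp add: algebra_simps flip: m)
  have g: "gker n y p q = hh (\<lambda>i. y (colour n p, i)) m" for y using True by (simp add: gker_def m)
  have g': "gker n y (p + int n) q = (if m = 0 then 0 else hh (\<lambda>i. y (colour n p, i)) (m - 1))" for y
  proof -
    have "p + int n \<le> q \<longleftrightarrow> int n * 1 \<le> int n * int m" unfolding q by auto
    also have "\<dots> \<longleftrightarrow> m \<noteq> 0" using n by (auto simp: mult_le_cancel_left)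
    finally have "p + int n \<le> q \<longleftrightarrow> m \<noteq> 0" .
    moreover have "nat (lev n q - lev n (p + int n)) = m - 1" using lev_add[OF n, of p 1] m by simp
    ultimately show ?thesis using True by (simp add: gker_def)
  qed
  show ?thesis
  proof (cases "colour n p = k")
    case c: True
    have e: "(\<lambda>i. (x((k, 1) := z)) (k, i)) = (\<lambda>i. x (k, i))(1 := z)" for z by auto
    show ?thesis using hh_deriv[of "\<lambda>i. x (k, i)" m z] c unfolding g g' c e by simp
  next
    case c: False
    have e: "(\<lambda>i. (x((k, 1) := z)) (colour n p, i)) = (\<lambda>i. x (colour n p, i))" for z using c by auto
    show ?thesis using c unfolding g e by simp
  qed
qed

lemma gact_deriv:
  assumes n: "n \<ge> 1"
  shows "((\<lambda>z. gact n (x((k, 1) := z)) c B u p) has_field_derivative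
    (if colour n p = k then gact n (x((k, 1) := z)) c B u (p + int n) else 0)) (at z)"
proof -
  have "((\<lambda>z. gact n (x((k, 1) := z)) c B u p) has_field_derivative
    (\<Sum>q\<in>{c<..B}. u q * (if colour n p = k then gker n (x((k, 1) := z)) (p + int n) q else 0))) (at z)"
    unfolding gact_def by (intro DERIV_sum DERIV_cmult gker_deriv[OF n])
  moreover have "(\<Sum>q\<in>{c<..B}. u q * (if colour n p = k then gker n (x((k, 1) := z)) (p + int n) q else 0)) =
    (if colour n p = k then gact n (x((k, 1) := z)) c B u (p + int n) else 0)"
    by (simp add: gact_def)
  ultimately show ?thesis by simp
qed

section \<open>Linear algebra\<close>

lemma dt_inverse:
  assumes "dt m A \<noteq> 0"
  obtains B where "\<And>a a'. a < m \<Longrightarrow> a' < m \<Longrightarrow> (\<Sum>r<m. A a r * B r a') = (if a = a' then 1 else 0)"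
    and "\<And>r r'. r < m \<Longrightarrow> r' < m \<Longrightarrow> (\<Sum>a<m. B r a * A a r') = (if r = r' then 1 else 0)"
proof -
  let ?A = "Matrix.mat m m (\<lambda>(a, b). A a b)"
  have "?A \<in> carrier_mat m m" by simp
  from det_non_zero_imp_unit[OF this, of "()"] assms obtain B where B: "B \<in> carrier_mat m m" "B * ?A = 1\<^sub>m m" "?A * B = 1\<^sub>m m"
    unfolding dt_def Units_def ring_mat_def by auto
  show ?thesis
  proof (rule that[of "\<lambda>r a. B $$ (r, a)"])
    fix a a' assume a: "a < m" "a' < m"
    have "(?A * B) $$ (a, a') = (\<Sum>r<m. A a r * B $$ (r, a'))"
      using a B(1) by (simp add: scalar_prod_def atLeast0LessThan)
    then show "(\<Sum>r<m. A a r * B $$ (r, a')) = (if a = a' then 1 else 0)" using a B by simp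
    have "(B * ?A) $$ (a, a') = (\<Sum>r<m. B $$ (a, r) * A r a')"
      using a B(1) by (simp add: scalar_prod_def atLeast0LessThan)
    then show "(\<Sum>r<m. B $$ (a, r) * A r a') = (if a = a' then 1 else 0)" using a B by simp
  qed
qed

lemma dt_independent:
  assumes "dt m A \<noteq> 0" "\<And>a. a < m \<Longrightarrow> (\<Sum>r<m. A a r * y r) = 0" "r < m"
  shows "y r = 0"
proof -
  obtain B where B: "\<And>r r'. r < m \<Longrightarrow> r' < m \<Longrightarrow> (\<Sum>a<m. B r a * A a r') = (if r = r' then 1 else 0)"
    using dt_inverse[OF assms(1)] by metis
  have "y r = (\<Sum>r'<m. (if r = r' then 1 else 0) * y r')"
    using assms(3) by (simp add: if_distrib[of "\<lambda>t. t * _"] cong: if_cong)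
  also have "\<dots> = (\<Sum>r'<m. (\<Sum>a<m. B r a * A a r') * y r')" using B assms(3) by (intro sum.cong) auto
  also have "\<dots> = (\<Sum>a<m. B r a * (\<Sum>r'<m. A a r' * y r'))"
    unfolding sum_distrib_left sum_distrib_right by (subst sum.swap) (simp add: mult_ac)
  also have "\<dots> = 0" using assms(2) by simp
  finally show ?thesis .
qed

lemma dt_cramer:
  assumes D: "dt m A \<noteq> 0" and a: "a < m"
  shows "(\<Sum>r<m. A a r * (dt m (\<lambda>a r'. if r' = r then b a else A a r') / dt m A)) = b a"
proof -
  obtain B where B: "\<And>a a'. a < m \<Longrightarrow> a' < m \<Longrightarrow> (\<Sum>r<m. A a r * B r a') = (if a = a' then 1 else 0)"
    using dt_inverse[OF D] by metis
  define y where "y r = (\<Sum>a'<m. B r a' * b a')" for r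
  have y: "(\<Sum>r<m. A a r * y r) = b a" if "a < m" for a
  proof -
    have "(\<Sum>r<m. A a r * y r) = (\<Sum>a'<m. (\<Sum>r<m. A a r * B r a') * b a')"
      unfolding y_def sum_distrib_left sum_distrib_right by (subst sum.swap) (simp add: mult_ac)
    also have "\<dots> = (\<Sum>a'<m. (if a = a' then 1 else 0) * b a')" using B that by (intro sum.cong) auto
    also have "\<dots> = b a" using that by (simp add: if_distrib[of "\<lambda>t. t * _"] cong: if_cong)
    finally show ?thesis .
  qed
  have "dt m (\<lambda>a r'. if r' = r then b a else A a r') = y r * dt m A" if r: "r < m" for r
  proof -
    let ?A = "Matrix.mat m m (\<lambda>(a, b). A a b)" and ?y = "Matrix.vec m y"
    have "Determinant.det (replace_col ?A (?A *\<^sub>v ?y) r) = Matrix.vec_index ?y r * Determinant.det ?A"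
      by (rule cramer_lemma_mat) (use r in auto)
    moreover have "replace_col ?A (?A *\<^sub>v ?y) r = Matrix.mat m m (\<lambda>(a, r'). if r' = r then b a else A a r')"
      unfolding replace_col_def
      by (rule eq_matI) (auto simp: scalar_prod_def atLeast0LessThan y)
    ultimately show ?thesis using r by (simp add: dt_def)
  qed
  then have "(\<Sum>r<m. A a r * (dt m (\<lambda>a r'. if r' = r then b a else A a r') / dt m A)) = (\<Sum>r<m. A a r * y r)"
    using D by (intro sum.cong) auto
  then show ?thesis using y[OF a] by simp
qed

text \<open>The column is moved by I transpositions of neighbours. With I = n - j this sign cancels
  the power of -1 found in \<open>qprod_ddelta\<close>.\<close>

lemma dt_col_to_front:
  assumes "I < m"
  shows "dt m (\<lambda>a b. if b = 0 then A a I else if b \<le> I then A a (b - 1) else A a b) = (-1) ^ I * dt m A"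
proof -
  let ?A = "Matrix.mat m m (\<lambda>(a, b). A a b)"
  have c: "?A \<in> carrier_mat m m" by simp
  have "swap_col_to_front ?A I = Matrix.mat m m (\<lambda>(a, b). if b = 0 then A a I else if b \<le> I then A a (b - 1) else A a b)"
    unfolding swap_col_to_front_result[OF c assms]
    by (rule eq_matI) (use assms in auto)
  then show ?thesis using swap_col_to_front_det[OF c assms] by (simp add: dt_def)
qed

lemma dt_differentiable:
  assumes "\<And>a r. (\<lambda>z. A z a r) holomorphic_on UNIV"
  shows "(\<lambda>z. dt m (A z)) holomorphic_on UNIV"
  unfolding dt_sum by (intro holomorphic_intros assms)

section \<open>Frames of a point of the Grassmannian\<close>

text \<open>Spanning modulo the sea is what the expansion of elements of W uses. The nondegeneracy
  of the rows enters through the determinant assumed nonzero in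
  \<open>isotropic_frame\<close>.\<close>

definition frame :: "(int \<Rightarrow> complex) set \<Rightarrow> nat \<Rightarrow> (nat \<Rightarrow> int \<Rightarrow> complex) \<Rightarrow> bool" where
  "frame W M w \<longleftrightarrow> (\<forall>a<M. w a \<in> W) \<and> Hsub (- int M) \<subseteq> W \<and>
     (\<forall>u\<in>W. \<exists>c. (\<lambda>p. u p - (\<Sum>a<M. c a * w a p)) \<in> Hsub (- int M))"

lemma frame_Suc:
  assumes "frame W N w"
  shows "frame W (Suc N) (w(N := (\<lambda>p. if p = - int N then 1 else 0)))"
  unfolding frame_def
proof (intro conjI allI impI ballI)
  let ?w = "w(N := (\<lambda>p. if p = - int N then 1 else 0))"
  have H: "Hsub (- int N) \<subseteq> W" using assms by (simp add: frame_def)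
  show "?w a \<in> W" if "a < Suc N" for a
  proof (cases "a = N")
    case True
    have "(\<lambda>p. if p = - int N then 1 else 0) \<in> Hsub (- int N)" by (simp add: Hsub_def)
    then show ?thesis using True H by auto
  qed (use assms that in \<open>auto simp: frame_def less_Suc_eq\<close>)
  have "Hsub (- int (Suc N)) \<subseteq> Hsub (- int N)" by (auto simp: Hsub_def)
  then show "Hsub (- int (Suc N)) \<subseteq> W" using H by blast
  fix u assume "u \<in> W"
  then obtain c where c: "(\<lambda>p. u p - (\<Sum>a<N. c a * w a p)) \<in> Hsub (- int N)" using assms by (auto simp: frame_def)
  define r where "r p = u p - (\<Sum>a<N. c a * w a p)" for p
  have r: "r p = 0" if "p > - int N" for p using c that by (simp add: Hsub_def r_def)
  have "u p - (\<Sum>a<Suc N. (c(N := r (- int N))) a * ?w a p) = (if p = - int N then 0 else r p)" for p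
  proof -
    have "(\<Sum>a<N. (c(N := r (- int N))) a * ?w a p) = (\<Sum>a<N. c a * w a p)" by (intro sum.cong) auto
    then show ?thesis by (simp add: r_def)
  qed
  then have "(\<lambda>p. u p - (\<Sum>a<Suc N. (c(N := r (- int N))) a * ?w a p)) \<in> Hsub (- int (Suc N))"
    using r unfolding Hsub_def by auto
  then show "\<exists>c. (\<lambda>p. u p - (\<Sum>a<Suc N. c a * ?w a p)) \<in> Hsub (- int (Suc N))" by blast
qed

text \<open>Sea vectors are appended as rows while the wedge stays the same. This serves to reach at
  least n rows, so that each label j - n with j in 1..n lies above the remaining sea.\<close>

lemma frame_enlarge:
  assumes "frame W N w"
  shows "\<exists>w'. frame W (N + d) w' \<and> wedgeW (N + d) w' = wedgeW N w"
proof (induction d)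
  case 0
  then show ?case using assms by auto
next
  case (Suc d)
  then obtain w' where w': "frame W (N + d) w'" "wedgeW (N + d) w' = wedgeW N w" by blast
  then show ?case using frame_Suc[OF w'(1)] wedgeW_Suc[of "N + d" w'] by (metis add_Suc_right)
qed

lemma frame_bounded:
  assumes "frame W M w" "W \<subseteq> Hn"
  obtains B where "\<And>a p. a < M \<Longrightarrow> p > B \<Longrightarrow> w a p = 0"
proof -
  have "\<forall>a<M. \<exists>b. \<forall>p>b. w a p = 0" using assms by (auto simp: frame_def Hn_def)
  then obtain b where b: "\<And>a p. a < M \<Longrightarrow> p > b a \<Longrightarrow> w a p = 0" by metis
  show ?thesis
  proof (rule that[of "Max (insert 0 (b ` {..<M}))"])
    fix a p assume a: "a < M" "p > Max (insert 0 (b ` {..<M}))"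
    have "b a \<le> Max (insert 0 (b ` {..<M}))" using a(1) by (intro Max_ge) auto
    then show "w a p = 0" using b[OF a(1), of p] a(2) by simp
  qed
qed

lemma dl_atMost: "dl ({..0} - {..- int M}) = map (\<lambda>r. - int r) [0..<M]"
proof -
  have s: "sorted_wrt (>) (map (\<lambda>r. - int r) [0..<M])" by (simp add: sorted_wrt_map sorted_wrt_iff_nth_less)
  have "p \<in> set (map (\<lambda>r. - int r) [0..<M]) \<longleftrightarrow> p \<in> {..0} - {..- int M}" for p
  proof
    assume "p \<in> {..0} - {..- int M}"
    then have p: "p \<le> 0" "- int M < p" by simp_all
    have "p = - int (nat (- p))" using p(1) by simp
    moreover have "nat (- p) \<in> {0..<M}" using p by (simp add: nat_less_iff)
    ultimately show "p \<in> set (map (\<lambda>r. - int r) [0..<M])" unfolding set_map set_upt by (rule image_eqI)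
  next
    assume "p \<in> set (map (\<lambda>r. - int r) [0..<M])"
    then obtain r where "r < M" "p = - int r" by auto
    then show "p \<in> {..0} - {..- int M}" by simp
  qed
  then have "set (map (\<lambda>r. - int r) [0..<M]) = {..0} - {..- int M}" by blast
  then show ?thesis using dl_eqI[OF s] by simp
qed

text \<open>The particle at i comes first and delays the sea labels by one position, until the hole
  at - (n - j) absorbs the delay. This is the column pattern of
  \<open>dt_col_to_front\<close>.\<close>

lemma dl_ddelta:
  assumes n: "n \<ge> 1" "i \<in> {1..n}" "j \<in> {1..n}" "i \<noteq> j" and M: "M \<ge> n" and b: "b < M"
  shows "dl (gnd n (ddelta i j) - {..- int M}) ! b =
    (if b = 0 then int i else if b \<le> n - j then - int (b - 1) else - int b)"
proof -
  define I where "I = n - j"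
  have I: "I < M" "int I = int n - int j" using n(3) M by (auto simp: I_def)
  define L where "L = map (\<lambda>b. if b = 0 then int i else if b \<le> I then - int (b - 1) else - int b) [0..<M]"
  have s: "sorted_wrt (>) L" unfolding L_def sorted_wrt_map
    by (rule sorted_wrt_mono_rel[OF _ sorted_wrt_upt]) (use n(2) in auto)
  have "set L = gnd n (ddelta i j) - {..- int M}"
  proof (intro Set.set_eqI iffI)
    fix p assume "p \<in> set L"
    then obtain b where b: "b < M" "p = (if b = 0 then int i else if b \<le> I then - int (b - 1) else - int b)"
      unfolding L_def by auto
    show "p \<in> gnd n (ddelta i j) - {..- int M}"
      unfolding gnd_ddelta[OF n] using b I n(2) by (auto split: if_splits)
  next
    fix p assume p: "p \<in> gnd n (ddelta i j) - {..- int M}"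
    have "p = int i \<or> (p \<le> 0 \<and> p \<noteq> - int I)" using p I unfolding gnd_ddelta[OF n] by auto
    then consider "p = int i" | "p \<le> 0" "p > - int I" | "p < - int I" by linarith
    then show "p \<in> set L"
    proof cases
      case 1
      then show ?thesis using I(1) by (auto simp: L_def intro!: image_eqI[of _ _ 0])
    next
      case 2
      then show ?thesis using I(1) by (auto simp: L_def intro!: image_eqI[of _ _ "nat (- p) + 1"])
    next
      case 3
      then show ?thesis using p by (auto simp: L_def intro!: image_eqI[of _ _ "nat (- p)"])
    qed
  qed
  then have "dl (gnd n (ddelta i j) - {..- int M}) = L" using dl_eqI[OF s] by simp
  then show ?thesis using b by (simp add: L_def I_def)
qed

section \<open>The normalized basis\<close>

text \<open>The value at the positive label \<open>p\<close> of the element of \<open>exp(\<xi>(x)) W\<close> that is congruent to the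
  basis vector of label \<open>- r\<close> modulo labels \<open>p > 0\<close> and \<open>p \<le> - M\<close>.\<close>
definition nrm :: "nat \<Rightarrow> nat \<Rightarrow> int \<Rightarrow> (nat \<Rightarrow> int \<Rightarrow> complex) \<Rightarrow> (nat \<times> nat \<Rightarrow> complex) \<Rightarrow> int \<Rightarrow> nat \<Rightarrow> complex" where
  "nrm n M B w x p r = dt M (\<lambda>a r'. if r' = r then gact n x (- int M) B (w a) p else gact n x (- int M) B (w a) (- int r'))
     / dt M (\<lambda>a r'. gact n x (- int M) B (w a) (- int r'))"

lemma tau_0:
  assumes n: "n \<ge> 1" and w: "\<And>a p. a < M \<Longrightarrow> p > B \<Longrightarrow> w a p = 0"
  shows "tau n M w (\<lambda>_. 0) x = dt M (\<lambda>a r. gact n x (- int M) B (w a) (- int r))"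
proof -
  have "tau n M w (\<lambda>_. 0) x = qprod n (\<lambda>_. 0) (gnd n (\<lambda>_. 0)) *
    dt M (\<lambda>a b. gact n x (- int M) B (w a) (dl (gnd n (\<lambda>_. 0) - {..- int M}) ! b))"
    by (rule tau_dt[OF n _ _ w]) (auto simp: Mlat_def gnd_0[OF n])
  also have "qprod n (\<lambda>_. 0) (gnd n (\<lambda>_. 0)) = 1" by (simp add: qprod_0 gnd_0[OF n] vac_def)
  also have "dt M (\<lambda>a b. gact n x (- int M) B (w a) (dl (gnd n (\<lambda>_. 0) - {..- int M}) ! b)) =
     dt M (\<lambda>a r. gact n x (- int M) B (w a) (- int r))"
    unfolding gnd_0[OF n] dl_atMost by (intro dt_cong) simp
  finally show ?thesis by simp
qed

text \<open>Putting the column of label i where the vacated label j - n used to be gives Cramer's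
  numerator. The two factors (-1)^(n - j) cancel, and \<open>eps j i\<close> times
  \<open>eps i j\<close> leaves the minus sign.\<close>

lemma egamma_nrm:
  assumes n: "n \<ge> 1" "i \<in> {1..n}" "j \<in> {1..n}" "i \<noteq> j" and M: "M \<ge> n"
    and w: "\<And>a p. a < M \<Longrightarrow> p > B \<Longrightarrow> w a p = 0"
  shows "egamma n M w i j x = - nrm n M B w x (int i) (n - j)"
proof -
  let ?A = "\<lambda>a p. gact n x (- int M) B (w a) p"
  let ?D = "dt M (\<lambda>a r'. if r' = n - j then ?A a (int i) else ?A a (- int r'))"
  have I: "n - j < M" using n(3) M by auto
  have ml: "ddelta i j \<in> Mlat n"
    using n by (auto simp: Mlat_def ddelta_def sum_subtractf sum.delta)
  have sub: "{..- int M} \<subseteq> gnd n (ddelta i j)" unfolding gnd_ddelta[OF n] using M n(3) by auto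
  have "tau n M w (ddelta i j) x = qprod n (ddelta i j) (gnd n (ddelta i j)) *
    dt M (\<lambda>a b. ?A a (dl (gnd n (ddelta i j) - {..- int M}) ! b))"
    by (rule tau_dt[OF n(1) ml sub w])
  also have "qprod n (ddelta i j) (gnd n (ddelta i j)) = (-1) ^ (n - j) * eps i j"
    unfolding qprod_ddelta[OF n] by (simp add: ev_def)
  also have "dt M (\<lambda>a b. ?A a (dl (gnd n (ddelta i j) - {..- int M}) ! b)) =
    dt M (\<lambda>a b. if b = 0 then (\<lambda>a r'. if r' = n - j then ?A a (int i) else ?A a (- int r')) a (n - j)
       else if b \<le> n - j then (\<lambda>a r'. if r' = n - j then ?A a (int i) else ?A a (- int r')) a (b - 1)
       else (\<lambda>a r'. if r' = n - j then ?A a (int i) else ?A a (- int r')) a b)"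
    by (rule dt_cong) (auto simp: dl_ddelta[OF n M])
  also have "\<dots> = (-1) ^ (n - j) * ?D" by (rule dt_col_to_front[OF I])
  finally have t: "tau n M w (ddelta i j) x = eps i j * ?D"
    by (simp flip: power_mult_distrib mult.assoc add: mult.commute[of "eps i j"] mult.left_commute)
  have t0: "tau n M w (\<lambda>_. 0) x = dt M (\<lambda>a r. ?A a (- int r))" by (rule tau_0[OF n(1)]) (rule w)
  have "eps j i * eps i j = -1" using n(4) by (auto simp: eps_def)
  then show ?thesis
    unfolding egamma_def t t0 nrm_def by (simp add: mult.assoc[symmetric])
qed

lemma gact_holomorphic:
  assumes n: "n \<ge> 1"
  shows "(\<lambda>z. gact n (x((k, 1) := z)) c B u p) holomorphic_on UNIV"
proof -
  have "(\<lambda>z. gact n (x((k, 1) := z)) c B u p) field_differentiable (at z)" for z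
    using gact_deriv[OF n, of x k c B u p z] by (auto simp: field_differentiable_def)
  then show ?thesis by (simp add: holomorphic_on_def)
qed

section \<open>The equations at a point where the vacuum minor does not vanish\<close>

locale isotropic_frame =
  fixes n M :: nat and B :: int and W :: "(int \<Rightarrow> complex) set" and w :: "nat \<Rightarrow> int \<Rightarrow> complex" and x :: "nat \<times> nat \<Rightarrow> complex"
  assumes n: "n \<ge> 1" and M: "M \<ge> n" and W: "W \<in> gr2 n" and fr: "frame W M w"
    and wB: "\<And>a p. a < M \<Longrightarrow> p > B \<Longrightarrow> w a p = 0"
    and D0: "dt M (\<lambda>a r. gact n x (- int M) B (w a) (- int r)) \<noteq> 0"
begin

abbreviation "A y \<equiv> \<lambda>a p. gact n y (- int M) B (w a) p"
abbreviation "\<beta> y \<equiv> nrm n M B w y"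

lemma nrm_solves:
  assumes "dt M (\<lambda>a r. A y a (- int r)) \<noteq> 0" "a < M"
  shows "A y a p = (\<Sum>r<M. A y a (- int r) * \<beta> y p r)"
  using dt_cramer[OF assms, of "\<lambda>a. A y a p"] unfolding nrm_def by simp

text \<open>The relation is linear in the vector, and \<open>gact\<close> does not see the part in
  the sea, so it passes from the rows to all of W. It is needed for t times a row and for the
  normalized vectors.\<close>

lemma nrm_solves_W:
  assumes "v \<in> W" "p > 0"
  shows "gact n x (- int M) B v p = (\<Sum>r<M. gact n x (- int M) B v (- int r) * \<beta> x p r)"
proof -
  obtain c where c: "(\<lambda>p. v p - (\<Sum>a<M. c a * w a p)) \<in> Hsub (- int M)" using fr assms(1) by (auto simp: frame_def)
  have v: "gact n x (- int M) B v p = (\<Sum>a<M. c a * A x a p)" for p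
  proof -
    have "gact n x (- int M) B v p = gact n x (- int M) B (\<lambda>p. \<Sum>a<M. c a * w a p) p"
      using c by (intro gact_cong) (auto simp: Hsub_def)
    then show ?thesis by (simp add: gact_sum)
  qed
  have "(\<Sum>a<M. c a * A x a p) = (\<Sum>a<M. c a * (\<Sum>r<M. A x a (- int r) * \<beta> x p r))"
    using nrm_solves[OF D0] by (intro sum.cong) auto
  also have "\<dots> = (\<Sum>r<M. (\<Sum>a<M. c a * A x a (- int r)) * \<beta> x p r)"
    unfolding sum_distrib_left sum_distrib_right by (subst sum.swap) (simp add: mult_ac)
  finally show ?thesis unfolding v .
qed

lemma nrm_differentiable: "(\<lambda>z. \<beta> (x((k, 1) := z)) p r) field_differentiable (at (x (k, 1)))"
proof -
  have x: "x((k, 1) := x (k, 1)) = x" by simp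
  have "(\<lambda>z. dt M (\<lambda>a r'. if r' = r then A (x((k, 1) := z)) a p else A (x((k, 1) := z)) a (- int r'))) holomorphic_on UNIV"
  proof (rule dt_differentiable)
    fix a r'
    show "(\<lambda>z. if r' = r then A (x((k, 1) := z)) a p else A (x((k, 1) := z)) a (- int r')) holomorphic_on UNIV"
      using gact_holomorphic[OF n, of x k] by (cases "r' = r") simp_all
  qed
  moreover have "(\<lambda>z. dt M (\<lambda>a r'. A (x((k, 1) := z)) a (- int r'))) holomorphic_on UNIV"
    by (rule dt_differentiable) (rule gact_holomorphic[OF n])
  ultimately show ?thesis unfolding nrm_def
    using D0 by (intro field_differentiable_divide) (auto simp: holomorphic_on_def)
qed

definition \<beta>' :: "nat \<Rightarrow> int \<Rightarrow> nat \<Rightarrow> complex" where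
  "\<beta>' k p r = deriv (\<lambda>z. \<beta> (x((k, 1) := z)) p r) (x (k, 1))"

lemma nrm_deriv: "((\<lambda>z. \<beta> (x((k, 1) := z)) p r) has_field_derivative \<beta>' k p r) (at (x (k, 1)))"
  unfolding \<beta>'_def using nrm_differentiable by (rule field_differentiable_derivI)

text \<open>Cramer's relation holds not only at x but for all nearby values of x (k, 1), so it may
  be differentiated; the product rule gives the two kinds of terms on the right.\<close>

lemma differentiated:
  assumes a: "a < M"
  shows "(if colour n p = k then A x a (p + int n) else 0) =
    (\<Sum>r<M. (if colour n (- int r) = k then A x a (- int r + int n) else 0) * \<beta> x p r + A x a (- int r) * \<beta>' k p r)"
proof -
  let ?x = "\<lambda>z. x((k, 1) := z)" and ?z = "x (k, 1)"
  have x: "?x ?z = x" by simp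
  let ?F = "\<lambda>z. A (?x z) a p - (\<Sum>r<M. A (?x z) a (- int r) * \<beta> (?x z) p r)"
  have gd: "((\<lambda>z. A (?x z) a p) has_field_derivative (if colour n p = k then A x a (p + int n) else 0)) (at ?z)" for p
    using gact_deriv[OF n, of x k "- int M" B "w a" p ?z] unfolding x .
  have md: "((\<lambda>z. A (?x z) a (- int r) * \<beta> (?x z) p r) has_field_derivative
      (if colour n (- int r) = k then A x a (- int r + int n) else 0) * \<beta> x p r + A x a (- int r) * \<beta>' k p r) (at ?z)" for r
    using DERIV_mult[OF gd[of "- int r"] nrm_deriv[of k p r]] unfolding x by (simp add: mult.commute)
  have "(?F has_field_derivative (if colour n p = k then A x a (p + int n) else 0) -
     (\<Sum>r<M. (if colour n (- int r) = k then A x a (- int r + int n) else 0) * \<beta> x p r + A x a (- int r) * \<beta>' k p r)) (at ?z)"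
    by (intro DERIV_diff DERIV_sum gd md)
  moreover have "(?F has_field_derivative 0) (at ?z)"
  proof -
    let ?D = "\<lambda>z. dt M (\<lambda>a r. A (?x z) a (- int r))"
    have hol: "?D holomorphic_on UNIV" by (rule dt_differentiable) (rule gact_holomorphic[OF n])
    \<comment> \<open>The relation is known only where the minor is nonzero, which is an open set
      around the given value.\<close>
    have "open (?D -` (- {0}))"
      using hol by (intro open_vimage holomorphic_on_imp_continuous_on) auto
    moreover have "?z \<in> ?D -` (- {0})" using D0 unfolding vimage_def x by simp
    moreover have "0 = ?F z" if "z \<in> ?D -` (- {0})" for z
    proof -
      have "?D z \<noteq> 0" using that by simp
      from nrm_solves[OF this a, of p] show ?thesis by (simp only: diff_self)
    qed
    ultimately show ?thesis
      by (rule has_field_derivative_transform_within_open[of "\<lambda>_. 0" 0 ?z "?D -` (- {0})", OF DERIV_const])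
  qed
  ultimately show ?thesis by (rule right_minus_eq[THEN iffD1, OF DERIV_unique])
qed

text \<open>Since i differs from k, the left-hand side of \<open>differentiated\<close> is zero at
  label i. On the right, shifting the column r by n gives another column when r is at least n; among
  r < n only r = n - k has colour k, and it is shifted to the positive label k. Everything then
  becomes a linear relation between the columns, whose coefficients vanish.\<close>

lemma nrm_pde:
  assumes ijk: "i \<in> {1..n}" "j \<in> {1..n}" "k \<in> {1..n}" "i \<noteq> k" "j \<noteq> k"
  shows "\<beta>' k (int i) (n - j) = - (\<beta> x (int k) (n - j) * \<beta> x (int i) (n - k))"
proof -
  have col: "colour n (int i) = i" using colour_lev_unique(1)[OF n ijk(1), of "int i" 0] by simp
  have low: "colour n (- int r) = k \<longleftrightarrow> r = n - k" if "r < n" for r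
  proof -
    have "- int r = int (n - r) + int n * (- 1)" "n - r \<in> {1..n}" using that by auto
    then have "colour n (- int r) = n - r" by (intro colour_lev_unique(1)[OF n])
    then show ?thesis using that ijk(3) by auto
  qed
  \<comment> \<open>The coefficients of this relation. At r = n - j the last summand drops out
    because - (n - j) has colour j, which differs from k.\<close>
  define y where "y r = \<beta>' k (int i) r + \<beta> x (int k) r * \<beta> x (int i) (n - k) +
    (if r + n < M \<and> colour n (- int r) = k then \<beta> x (int i) (r + n) else 0)" for r
  have "(\<Sum>r<M. A x a (- int r) * y r) = 0" if a: "a < M" for a
  proof -
    let ?t = "\<lambda>r. (if colour n (- int r) = k then A x a (- int r + int n) else 0) * \<beta> x (int i) r"
    have "(\<Sum>r<M. ?t r) = (\<Sum>r<n. ?t r) + (\<Sum>r\<in>{n..<M}. ?t r)"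
    proof -
      have U: "{..<M} = {..<n} \<union> {n..<M}" using M by auto
      show ?thesis unfolding U by (rule sum.union_disjoint) auto
    qed
    also have "(\<Sum>r<n. ?t r) = (\<Sum>r<n. if r = n - k then A x a (int k) * \<beta> x (int i) (n - k) else 0)"
      using low ijk(3) by (intro sum.cong) (auto simp: of_nat_diff)
    also have "\<dots> = A x a (int k) * \<beta> x (int i) (n - k)" using ijk(3) by simp
    \<comment> \<open>Expressing the positive label k through the columns is what makes the equation
      quadratic.\<close>
    also have "A x a (int k) = (\<Sum>r<M. A x a (- int r) * \<beta> x (int k) r)" by (rule nrm_solves[OF D0 a])
    also have "(\<Sum>r\<in>{n..<M}. ?t r) = (\<Sum>r<M - n. A x a (- int r) * (if colour n (- int r) = k then \<beta> x (int i) (r + n) else 0))"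
    proof (rule sum.reindex_bij_witness[where i = "\<lambda>r. r + n" and j = "\<lambda>r. r - n"])
      fix r assume r: "r \<in> {n..<M}"
      have e: "- int (r - n) = - int r + int n" using r by auto
      have "colour n (- int (r - n)) = colour n (- int r)" unfolding e by (rule colour_add(3))
      then show "A x a (- int (r - n)) * (if colour n (- int (r - n)) = k then \<beta> x (int i) (r - n + n) else 0) = ?t r"
        using r e by simp
    qed auto
    also have "\<dots> = (\<Sum>r<M. A x a (- int r) * (if r + n < M \<and> colour n (- int r) = k then \<beta> x (int i) (r + n) else 0))"
      by (rule sum.mono_neutral_cong_left) auto
    finally have "(\<Sum>r<M. ?t r) = (\<Sum>r<M. A x a (- int r) * \<beta> x (int k) r) * \<beta> x (int i) (n - k) +
      (\<Sum>r<M. A x a (- int r) * (if r + n < M \<and> colour n (- int r) = k then \<beta> x (int i) (r + n) else 0))" .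
    moreover have "0 = (\<Sum>r<M. ?t r) + (\<Sum>r<M. A x a (- int r) * \<beta>' k (int i) r)"
      using differentiated[OF a, of "int i" k] col ijk(4) by (simp add: sum.distrib)
    ultimately show ?thesis unfolding y_def by (simp add: sum.distrib distrib_left sum_distrib_right mult.assoc add_ac)
  qed
  moreover have "n - j < M" using ijk(2) M by auto
  ultimately have "y (n - j) = 0" using dt_independent[OF D0] by blast
  moreover have "colour n (- int (n - j)) \<noteq> k"
    using low[of "n - j"] ijk by auto
  ultimately show ?thesis unfolding y_def by (simp add: eq_neg_iff_add_eq_0)
qed

text \<open>Summed over all colours, the derivatives multiply by t as a whole. As t times a row lies
  in W again, \<open>nrm_solves_W\<close> accounts for all terms except those with derivatives of
  \<beta>, and these form a relation between independent columns.\<close>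

lemma nrm_trace:
  assumes p: "p > 0" and r: "r < M"
  shows "(\<Sum>k\<in>{1..n}. \<beta>' k p r) = 0"
proof (rule dt_independent[OF D0 _ r, of "\<lambda>r. \<Sum>k\<in>{1..n}. \<beta>' k p r"])
  fix a assume a: "a < M"
  have cr: "colour n q \<in> {1..n}" for q by (rule colour_range[OF n])
  have one: "(\<Sum>k\<in>{1..n}. if colour n q = k then c else 0) = c" for q and c :: complex
    using cr[of q] by (subst sum.delta') auto
  have tW: "tmul n (w a) \<in> W" using W fr a by (auto simp: gr2_def gr0_def frame_def)
  have sh: "gact n x (- int M) B (tmul n (w a)) q = A x a (q + int n)" if "q > - int M" for q
    using gact_tmul[OF n that wB[OF a]] .
  have e: "A x a (p + int n) = (\<Sum>r<M. A x a (- int r + int n) * \<beta> x p r)"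
  proof -
    have "A x a (p + int n) = (\<Sum>r<M. gact n x (- int M) B (tmul n (w a)) (- int r) * \<beta> x p r)"
      using nrm_solves_W[OF tW p] sh[of p] p by simp
    also have "\<dots> = (\<Sum>r<M. A x a (- int r + int n) * \<beta> x p r)" using sh by (intro sum.cong) auto
    finally show ?thesis .
  qed
  have "(\<Sum>k\<in>{1..n}. if colour n p = k then A x a (p + int n) else 0) =
    (\<Sum>k\<in>{1..n}. \<Sum>r<M. (if colour n (- int r) = k then A x a (- int r + int n) else 0) * \<beta> x p r + A x a (- int r) * \<beta>' k p r)"
    by (intro sum.cong refl differentiated a)
  also have "\<dots> = (\<Sum>r<M. \<Sum>k\<in>{1..n}. (if colour n (- int r) = k then A x a (- int r + int n) else 0) * \<beta> x p r + A x a (- int r) * \<beta>' k p r)"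
    by (rule sum.swap)
  also have "\<dots> = (\<Sum>r<M. A x a (- int r + int n) * \<beta> x p r + A x a (- int r) * (\<Sum>k\<in>{1..n}. \<beta>' k p r))"
    by (simp only: sum.distrib sum_distrib_left[symmetric] sum_distrib_right[symmetric] one)
  also have "(\<Sum>k\<in>{1..n}. if colour n p = k then A x a (p + int n) else 0) = A x a (p + int n)" by (rule one)
  finally show "(\<Sum>r<M. A x a (- int r) * (\<Sum>k\<in>{1..n}. \<beta>' k p r)) = 0" using e by (simp add: sum.distrib)
qed

text \<open>The row r0 of the inverse matrix gives the combination of the frame. The vector stays in
  W before the exponential acts, so that isotropy of W can be applied to it.\<close>

lemma exists_normalized:
  assumes r0: "r0 < M"
  obtains v where "v \<in> W" "\<And>p. p > B \<Longrightarrow> v p = 0"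
    "\<And>r. r < M \<Longrightarrow> gact n x (- int M) B v (- int r) = (if r = r0 then 1 else 0)"
    "\<And>p. p > 0 \<Longrightarrow> gact n x (- int M) B v p = \<beta> x p r0"
proof -
  obtain C where C: "\<And>r r'. r < M \<Longrightarrow> r' < M \<Longrightarrow> (\<Sum>a<M. C r a * A x a (- int r')) = (if r = r' then 1 else 0)"
    using dt_inverse[OF D0] by metis
  define v where "v p = (\<Sum>a<M. C r0 a * w a p)" for p
  have sub: "subspace_H W" using W by (simp add: gr2_def gr0_def Gr0_def)
  have add: "\<And>u v. u \<in> W \<Longrightarrow> v \<in> W \<Longrightarrow> (\<lambda>p. u p + v p) \<in> W"
    and mul: "\<And>c u. u \<in> W \<Longrightarrow> (\<lambda>p. c * u p) \<in> W" using sub unfolding subspace_H_def by blast+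
  have "(\<lambda>p. \<Sum>a\<in>S. C r0 a * w a p) \<in> W" if "finite S" "S \<subseteq> {..<M}" for S
    using that
  proof (induction S)
    case empty
    then show ?case using sub by (simp add: subspace_H_def)
  next
    case (insert a S)
    have "w a \<in> W" using fr insert.prems by (auto simp: frame_def)
    then have "(\<lambda>p. C r0 a * w a p) \<in> W" by (rule mul)
    moreover have "(\<lambda>p. \<Sum>a\<in>S. C r0 a * w a p) \<in> W"
      by (rule insert.IH) (use insert.prems in blast)
    ultimately have "(\<lambda>p. C r0 a * w a p + (\<Sum>a\<in>S. C r0 a * w a p)) \<in> W" by (rule add)
    then show ?case using insert.hyps by simp
  qed
  then have vW: "v \<in> W" unfolding v_def by simp
  have vr: "gact n x (- int M) B v (- int r) = (if r = r0 then 1 else 0)" if "r < M" for r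
    unfolding v_def gact_sum C[OF r0 that] by (rule if_cong) auto
  show ?thesis
  proof (rule that[OF vW _ vr])
    show "v p = 0" if "p > B" for p using wB that by (simp add: v_def)
    show "gact n x (- int M) B v p = \<beta> x p r0" if "p > 0" for p
    proof -
      have "gact n x (- int M) B v p = (\<Sum>r<M. (if r = r0 then 1 else 0) * \<beta> x p r)"
        unfolding nrm_solves_W[OF vW that] using vr by (intro sum.cong) simp_all
      then show ?thesis using r0 by (simp add: if_distrib[of "\<lambda>t. t * _"] cong: if_cong)
    qed
  qed
qed

section \<open>Isotropy and the symmetry of the normalized coefficients\<close>

definition Kc :: "nat \<Rightarrow> nat" where "Kc a = (M + a - 1) div n"

lemma lab_gt:
  assumes "a \<in> {1..n}" shows "lab n a k > - int M \<longleftrightarrow> k < int (Kc a)"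
proof -
  have "lab n a k > - int M \<longleftrightarrow> int n * (k + 1) \<le> int M + int a - 1" by (auto simp: lab_def)
  also have "\<dots> \<longleftrightarrow> k + 1 \<le> (int M + int a - 1) div int n" using le_div_iff[OF n] by simp
  also have "(int M + int a - 1) div int n = int (Kc a)"
    using assms unfolding Kc_def by (simp add: of_nat_div of_nat_diff)
  finally show ?thesis by auto
qed

text \<open>\<open>W\<close> is orthogonal to its subspace \<open>Hsub (- M)\<close>.\<close>
lemma W_vanish:
  assumes u: "u \<in> W" and a: "a \<in> {1..n}" and k: "k < - int (Kc a)"
  shows "u (lab n a k) = 0"
proof -
  let ?p = "lab n a (- 1 - k)"
  let ?e = "\<lambda>q. if q = ?p then 1 else (0::complex)"
  have "\<not> ?p > - int M" unfolding lab_gt[OF a] using k by linarith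
  then have "?e \<in> Hsub (- int M)" by (auto simp: Hsub_def)
  then have "?e \<in> W" using fr by (auto simp: frame_def)
  then have "pairing n u ?e = 0" using W u by (auto simp: gr2_def)
  moreover have "pairing n u ?e = \<i> * (u (lab n a k) * (-1) powi (- 1 - k))"
  proof -
    have inner: "(\<Sum>k'\<in>{k'. u (lab n a' k') \<noteq> 0 \<and> ?e (lab n a' (- 1 - k')) \<noteq> 0}.
        u (lab n a' k') * ?e (lab n a' (- 1 - k')) * (-1) powi (- 1 - k')) =
       (if a' = a then u (lab n a k) * (-1) powi (- 1 - k) else 0)" if a': "a' \<in> {1..n}" for a'
    proof -
      have iff: "lab n a' (- 1 - k') = ?p \<longleftrightarrow> a' = a \<and> k' = k" for k'
      proof
        assume e: "lab n a' (- 1 - k') = ?p"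
        then have "a' = a" using colour_lab[OF n a', of "- 1 - k'"] colour_lab[OF n a, of "- 1 - k"] by simp
        then show "a' = a \<and> k' = k" using e n by (auto simp: lab_def)
      qed auto
      show ?thesis
      proof (cases "a' = a \<and> u (lab n a k) \<noteq> 0")
        case True
        then have "{k'. u (lab n a' k') \<noteq> 0 \<and> ?e (lab n a' (- 1 - k')) \<noteq> 0} = {k}" using iff by auto
        then show ?thesis using True by simp
      next
        case False
        then have S: "{k'. u (lab n a' k') \<noteq> 0 \<and> ?e (lab n a' (- 1 - k')) \<noteq> 0} = {}" using iff by auto
        show ?thesis unfolding S using False by auto
      qed
    qed
    show ?thesis unfolding pairing_def using inner a by (simp add: sum.delta)
  qed
  ultimately show ?thesis by (simp add: neg_one_powi split: if_splits)
qed

text \<open>\<open>W_vanish\<close> bounds the exponents of both factors from below. Since they add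
  up to -1, they lie in a symmetric window, the one used in
  \<open>residue_invariant\<close>.\<close>

lemma pairing_finite:
  assumes "u \<in> W" "v \<in> W"
  shows "pairing n u v = \<i> * (\<Sum>a\<in>{1..n}. \<Sum>k\<in>{- int (Kc a)..<int (Kc a)}.
    u (lab n a k) * v (lab n a (- 1 - k)) * (-1) powi (- 1 - k))"
proof -
  have "(\<Sum>k\<in>{k. u (lab n a k) \<noteq> 0 \<and> v (lab n a (- 1 - k)) \<noteq> 0}. u (lab n a k) * v (lab n a (- 1 - k)) * (-1) powi (- 1 - k)) =
    (\<Sum>k\<in>{- int (Kc a)..<int (Kc a)}. u (lab n a k) * v (lab n a (- 1 - k)) * (-1) powi (- 1 - k))" if a: "a \<in> {1..n}" for a
  proof (rule sum.mono_neutral_left)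
    show "{k. u (lab n a k) \<noteq> 0 \<and> v (lab n a (- 1 - k)) \<noteq> 0} \<subseteq> {- int (Kc a)..<int (Kc a)}"
    proof
      fix k assume k: "k \<in> {k. u (lab n a k) \<noteq> 0 \<and> v (lab n a (- 1 - k)) \<noteq> 0}"
      have "\<not> k < - int (Kc a)" using W_vanish[OF assms(1) a, of k] k by auto
      moreover have "\<not> - 1 - k < - int (Kc a)" using W_vanish[OF assms(2) a, of "- 1 - k"] k by auto
      ultimately show "k \<in> {- int (Kc a)..<int (Kc a)}" by auto
    qed
  qed auto
  then show ?thesis unfolding pairing_def by simp
qed

text \<open>In colour a the label shift by n m is the power t^m, and the coefficients of u below
  exponent - Kc vanish. The window of labels thus becomes the truncated convolution G of
  \<open>residue_invariant\<close>.\<close>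

lemma gact_lab:
  assumes u: "u \<in> W" "\<And>p. p > B \<Longrightarrow> u p = 0" and a: "a \<in> {1..n}" and k: "k < int (Kc a)"
  shows "gact n x (- int M) B u (lab n a k) =
    (\<Sum>m\<in>{0..nat (k + int (Kc a))}. hh (\<lambda>i. x (a, i)) m * u (lab n a (k - int m)))"
proof -
  have lm: "lab n a (k - int m) = lab n a k + int n * int m" for m by (simp add: lab_def algebra_simps)
  have c: "colour n (lab n a k) = a" by (rule colour_lab[OF n a])
  have g: "gker n x (lab n a k) (lab n a (k - int m)) = hh (\<lambda>i. x (a, i)) m" for m
  proof -
    have "lev n (lab n a (k - int m)) - lev n (lab n a k) = int m" unfolding lm using lev_add[OF n] by simp
    then show ?thesis unfolding gker_def lm using c by simp
  qed
  let ?I = "(\<lambda>m. lab n a (k - int m)) ` {0..nat (k + int (Kc a))}"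
  have inj: "inj_on (\<lambda>m. lab n a (k - int m)) {0..nat (k + int (Kc a))}"
    using n by (auto simp: inj_on_def lm)
  have "(\<Sum>m\<in>{0..nat (k + int (Kc a))}. hh (\<lambda>i. x (a, i)) m * u (lab n a (k - int m))) =
    (\<Sum>q\<in>?I. u q * gker n x (lab n a k) q)"
    by (subst sum.reindex[OF inj]) (simp add: g mult.commute)
  also have "\<dots> = (\<Sum>q\<in>{- int M<..B}. u q * gker n x (lab n a k) q)"
  proof (rule sum.mono_neutral_cong)
    fix q assume q: "q \<in> ?I - {- int M<..B}"
    then obtain m where "q = lab n a (k - int m)" by auto
    then have "q > - int M" unfolding \<open>q = _\<close> lab_gt[OF a] using k by simp
    then have "q > B" using q by auto
    then show "u q * gker n x (lab n a k) q = 0" using u(2) by simp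
  next
    fix q assume q: "q \<in> {- int M<..B} - ?I"
    show "u q * gker n x (lab n a k) q = 0"
    proof (cases "lab n a k \<le> q \<and> colour n (lab n a k) = colour n q")
      case False
      then have "gker n x (lab n a k) q = 0" unfolding gker_def by (rule if_not_P)
      then show ?thesis by simp
    next
      case True
      then obtain d where d: "q = lab n a k + int n * d" using same_colour[OF n, of "lab n a k" q] by auto
      then have "int n * d \<ge> 0" using True by simp
      then have "d \<ge> 0" using n by (simp add: zero_le_mult_iff)
      then have qm: "q = lab n a (k - int (nat d))" unfolding lm using d by simp
      then have "nat d \<notin> {0..nat (k + int (Kc a))}" using q by blast
      then have "k - int (nat d) < - int (Kc a)" by auto
      then have "u q = 0" unfolding qm by (rule W_vanish[OF u(1) a])
      then show ?thesis by simp
    qed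
  qed auto
  finally show ?thesis unfolding gact_def by simp
qed

text \<open>The pairing of the normalized vectors equals that of their preimages in W, hence is
  zero. Their nonnegative powers of t below the sea bound reduce to the constants e_i and e_j, so
  the residue picks out just the coefficients of t^(-1), with opposite signs.\<close>

lemma nrm_symmetric:
  assumes i: "i \<in> {1..n}" and j: "j \<in> {1..n}" and ev: "\<And>l k. k \<ge> 1 \<Longrightarrow> x (l, 2 * k) = 0"
  shows "\<beta> x (int i) (n - j) = \<beta> x (int j) (n - i)"
proof -
  have rM: "n - l < M" if "l \<in> {1..n}" for l using that M by auto
  obtain vi where vi: "vi \<in> W" "\<And>p. p > B \<Longrightarrow> vi p = 0"
    "\<And>r. r < M \<Longrightarrow> gact n x (- int M) B vi (- int r) = (if r = n - i then 1 else 0)"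
    "\<And>p. p > 0 \<Longrightarrow> gact n x (- int M) B vi p = \<beta> x p (n - i)" using exists_normalized[OF rM[OF i]] by blast
  obtain vj where vj: "vj \<in> W" "\<And>p. p > B \<Longrightarrow> vj p = 0"
    "\<And>r. r < M \<Longrightarrow> gact n x (- int M) B vj (- int r) = (if r = n - j then 1 else 0)"
    "\<And>p. p > 0 \<Longrightarrow> gact n x (- int M) B vj p = \<beta> x p (n - j)" using exists_normalized[OF rM[OF j]] by blast
  let ?gi = "\<lambda>p. gact n x (- int M) B vi p" and ?gj = "\<lambda>p. gact n x (- int M) B vj p"
  have K1: "Kc a \<ge> 1" if a: "a \<in> {1..n}" for a
  proof -
    have "lab n a 0 > - int M" using a M by (auto simp: lab_def)
    then show ?thesis unfolding lab_gt[OF a] by simp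
  qed
  have neg: "gact n x (- int M) B v (lab n a k) = (if a = l \<and> k = 0 then 1 else 0)"
    if v: "\<And>r. r < M \<Longrightarrow> gact n x (- int M) B v (- int r) = (if r = n - l then 1 else 0)"
      and a: "a \<in> {1..n}" and l: "l \<in> {1..n}" and k: "0 \<le> k" "k < int (Kc a)" for v a l k
  proof -
    have "int n * (k + 1) \<ge> int n * 1" using k by (intro mult_left_mono) auto
    moreover have "int a \<le> int n" using a by simp
    ultimately have le: "lab n a k \<le> 0" unfolding lab_def mult_minus_left by linarith
    define r where "r = nat (- lab n a k)"
    have r: "lab n a k = - int r" "r < M" using le lab_gt[OF a, of k] k unfolding r_def by auto
    have "r = n - l \<longleftrightarrow> lab n a k = lab n l 0"
    proof -
      have "lab n l 0 = - int (n - l)" using l by (simp add: lab_def of_nat_diff)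
      then show ?thesis using r(1) by auto
    qed
    also have "\<dots> \<longleftrightarrow> a = l \<and> k = 0"
    proof
      assume e: "lab n a k = lab n l 0"
      then have "a = l" using colour_lab[OF n a, of k] colour_lab[OF n l, of 0] by simp
      then show "a = l \<and> k = 0" using e n by (auto simp: lab_def)
    qed auto
    finally show ?thesis using v[OF r(2)] r(1) by simp
  qed
  have pos: "lab n a k > 0" if "a \<in> {1..n}" "k \<le> - 1" for a k
  proof -
    have "int n * (k + 1) \<le> 0" using that by (intro mult_nonneg_nonpos) auto
    then show ?thesis using that by (auto simp: lab_def)
  qed
  have inv: "(\<Sum>k\<in>{- int (Kc a)..<int (Kc a)}. ?gi (lab n a k) * ?gj (lab n a (- 1 - k)) * (-1) powi (- 1 - k)) =
     (\<Sum>k\<in>{- int (Kc a)..<int (Kc a)}. vi (lab n a k) * vj (lab n a (- 1 - k)) * (-1) powi (- 1 - k))"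
    if a: "a \<in> {1..n}" for a
  proof -
    have "(\<Sum>k\<in>{- int (Kc a)..<int (Kc a)}. ?gi (lab n a k) * ?gj (lab n a (- 1 - k)) * (-1) powi (- 1 - k)) =
      (\<Sum>k\<in>{- int (Kc a)..<int (Kc a)}.
        (\<Sum>m\<in>{0..nat (k + int (Kc a))}. hh (\<lambda>i. x (a, i)) m * vi (lab n a (k - int m))) *
        (\<Sum>m\<in>{0..nat (- 1 - k + int (Kc a))}. hh (\<lambda>i. x (a, i)) m * vj (lab n a (- 1 - k - int m))) * (-1) powi (- 1 - k))"
      using gact_lab[OF vi(1,2) a] gact_lab[OF vj(1,2) a] by (intro sum.cong refl) auto
    also have "\<dots> = (\<Sum>k\<in>{- int (Kc a)..<int (Kc a)}. vi (lab n a k) * vj (lab n a (- 1 - k)) * (-1) powi (- 1 - k))"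
      using residue_invariant[where y = "\<lambda>i. x (a, i)" and K = "Kc a" and U = "\<lambda>k. vi (lab n a k)"
          and V = "\<lambda>k. vj (lab n a k)"] ev by simp
    finally show ?thesis .
  qed
  have "0 = (\<Sum>a\<in>{1..n}. \<Sum>k\<in>{- int (Kc a)..<int (Kc a)}. ?gi (lab n a k) * ?gj (lab n a (- 1 - k)) * (-1) powi (- 1 - k))"
    using pairing_finite[OF vi(1) vj(1)] W vi(1) vj(1) inv by (simp add: gr2_def)
  also have "\<dots> = (\<Sum>a\<in>{1..n}. (if a = j then \<beta> x (int j) (n - i) else 0) - (if a = i then \<beta> x (int i) (n - j) else 0))"
  proof (rule sum.cong[OF refl])
    fix a assume a: "a \<in> {1..n}"
    have l1: "lab n a (- 1) = int a" by (simp add: lab_def)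
    \<comment> \<open>One of the exponents k and - 1 - k is nonnegative, and it contributes only
      when it is 0; hence k is 0 or -1.\<close>
    have "(\<Sum>k\<in>{- int (Kc a)..<int (Kc a)}. ?gi (lab n a k) * ?gj (lab n a (- 1 - k)) * (-1) powi (- 1 - k)) =
      (\<Sum>k\<in>{- 1, 0}. ?gi (lab n a k) * ?gj (lab n a (- 1 - k)) * (-1) powi (- 1 - k))"
    proof (rule sum.mono_neutral_right)
      show "{- 1, 0} \<subseteq> {- int (Kc a)..<int (Kc a)}" using K1[OF a] by auto
      show "\<forall>k\<in>{- int (Kc a)..<int (Kc a)} - {- 1, 0}. ?gi (lab n a k) * ?gj (lab n a (- 1 - k)) * (-1) powi (- 1 - k) = 0"
      proof
        fix k assume k: "k \<in> {- int (Kc a)..<int (Kc a)} - {- 1, 0}"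
        show "?gi (lab n a k) * ?gj (lab n a (- 1 - k)) * (-1) powi (- 1 - k) = 0"
        proof (cases "k \<ge> 0")
          case True
          then have "?gi (lab n a k) = 0" using neg[OF vi(3) a i, of k] k by auto
          then show ?thesis by simp
        next
          case False
          then have "?gj (lab n a (- 1 - k)) = 0" using neg[OF vj(3) a j, of "- 1 - k"] k by auto
          then show ?thesis by simp
        qed
      qed
    qed auto
    also have "\<dots> = ?gi (int a) * ?gj (lab n a 0) - ?gi (lab n a 0) * ?gj (int a)"
      by (simp add: l1 neg_one_powi)
    also have "\<dots> = (if a = j then \<beta> x (int j) (n - i) else 0) - (if a = i then \<beta> x (int i) (n - j) else 0)"
      using neg[OF vi(3) a i, of 0] neg[OF vj(3) a j, of 0] vi(4)[of "int a"] vj(4)[of "int a"] K1[OF a] a by auto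
    finally show "(\<Sum>k\<in>{- int (Kc a)..<int (Kc a)}. ?gi (lab n a k) * ?gj (lab n a (- 1 - k)) * (-1) powi (- 1 - k)) =
      (if a = j then \<beta> x (int j) (n - i) else 0) - (if a = i then \<beta> x (int i) (n - j) else 0)" .
  qed
  also have "\<dots> = \<beta> x (int j) (n - i) - \<beta> x (int i) (n - j)"
    using i j by (simp add: sum_subtractf sum.delta)
  finally show ?thesis by simp
qed

end

theorem theorem4:
  fixes n N :: nat and W :: "(int \<Rightarrow> complex) set" and w :: "nat \<Rightarrow> int \<Rightarrow> complex"
    and x :: "nat \<times> nat \<Rightarrow> complex"
  assumes "n \<ge> 2"
    and "W \<in> gr2 n"
    and "Hsub (- int N) \<subseteq> W" and "qbasis W (- int N) N w"
    and "\<forall>l k. k \<ge> 1 \<longrightarrow> x (l, 2 * k) = 0"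
    and "tau n N w (\<lambda>_. 0) x \<noteq> 0"
  shows "(\<forall>i\<in>{1..n}. \<forall>j\<in>{1..n}. i \<noteq> j \<longrightarrow> egamma n N w i j x = egamma n N w j i x)
    \<and> (\<forall>i\<in>{1..n}. \<forall>j\<in>{1..n}. \<forall>k\<in>{1..n}. i \<noteq> j \<and> j \<noteq> k \<and> i \<noteq> k \<longrightarrow>
         ((\<lambda>z. egamma n N w i j (x((k, 1) := z))) has_field_derivative
            (egamma n N w i k x * egamma n N w k j x)) (at (x (k, 1))))
    \<and> (\<forall>i\<in>{1..n}. \<forall>j\<in>{1..n}. i \<noteq> j \<longrightarrow>
         (\<Sum>k\<in>{1..n}. deriv (\<lambda>z. egamma n N w i j (x((k, 1) := z))) (x (k, 1))) = 0)"
proof -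
  have n: "n \<ge> 1" using assms(1) by simp
  have "frame W N w" using assms(3,4) by (simp add: frame_def qbasis_def)
  then obtain w' where w': "frame W (N + n) w'" "wedgeW (N + n) w' = wedgeW N w"
    using frame_enlarge by blast
  \<comment> \<open>Adding n rows guarantees M at least n, whatever N was given.\<close>
  define M where "M = N + n"
  have "W \<subseteq> Hn" using assms(2) by (simp add: gr2_def gr0_def Gr0_def subspace_H_def)
  then obtain B where B: "\<And>a p. a < M \<Longrightarrow> p > B \<Longrightarrow> w' a p = 0"
    using frame_bounded[OF w'(1)] unfolding M_def by blast
  have tau: "tau n N w = tau n M w'" by (intro ext) (simp add: tau_def w'(2) M_def)
  have eg: "egamma n N w i j y = egamma n M w' i j y" for i j y by (simp add: egamma_def tau)
  interpret isotropic_frame n M B W w' x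
  proof
    show "dt M (\<lambda>a r. gact n x (- int M) B (w' a) (- int r)) \<noteq> 0"
    proof -
      have "tau n M w' (\<lambda>_. 0) x = dt M (\<lambda>a r. gact n x (- int M) B (w' a) (- int r))"
        by (rule tau_0[OF n]) (rule B)
      then show ?thesis using assms(6) unfolding tau by simp
    qed
  qed (use n w'(1) assms(2) B in \<open>auto simp: M_def\<close>)
  have eb: "egamma n N w i j y = - \<beta> y (int i) (n - j)" if "i \<in> {1..n}" "j \<in> {1..n}" "i \<noteq> j" for i j y
    unfolding eg using egamma_nrm[OF n that M B] .
  have d: "((\<lambda>z. egamma n N w i j (x((k, 1) := z))) has_field_derivative - \<beta>' k (int i) (n - j)) (at (x (k, 1)))"
    if "i \<in> {1..n}" "j \<in> {1..n}" "i \<noteq> j" for i j k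
    unfolding eb[OF that] by (intro DERIV_minus nrm_deriv)
  have "egamma n N w i j x = egamma n N w j i x" if "i \<in> {1..n}" "j \<in> {1..n}" "i \<noteq> j" for i j
    using nrm_symmetric[OF that(1,2)] assms(5) that by (simp add: eb)
  moreover have "((\<lambda>z. egamma n N w i j (x((k, 1) := z))) has_field_derivative
      (egamma n N w i k x * egamma n N w k j x)) (at (x (k, 1)))"
    if "i \<in> {1..n}" "j \<in> {1..n}" "k \<in> {1..n}" "i \<noteq> j" "j \<noteq> k" "i \<noteq> k" for i j k
  proof -
    \<comment> \<open>The two signs from \<gamma> = - \<beta> on the right cancel, and the one on
      the left meets the minus sign of \<open>nrm_pde\<close>.\<close>
    have "- \<beta>' k (int i) (n - j) = egamma n N w i k x * egamma n N w k j x"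
      using nrm_pde[OF that(1,2,3,6,5)] that by (simp add: eb)
    then show ?thesis using d[OF that(1,2,4), of k] by simp
  qed
  moreover have "(\<Sum>k\<in>{1..n}. deriv (\<lambda>z. egamma n N w i j (x((k, 1) := z))) (x (k, 1))) = 0"
    if "i \<in> {1..n}" "j \<in> {1..n}" "i \<noteq> j" for i j
  proof -
    have "(\<Sum>k\<in>{1..n}. deriv (\<lambda>z. egamma n N w i j (x((k, 1) := z))) (x (k, 1))) = (\<Sum>k\<in>{1..n}. - \<beta>' k (int i) (n - j))"
      using DERIV_imp_deriv[OF d[OF that]] by simp
    moreover have "n - j < M" using that(2) M by auto
    then have "(\<Sum>k\<in>{1..n}. - \<beta>' k (int i) (n - j)) = 0"
      using nrm_trace[of "int i" "n - j"] that(1) by (simp add: sum_negf)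
    ultimately show ?thesis by simp
  qed
  ultimately show ?thesis by blast
qed

end
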